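(* Let $A$ be a commutative unital separable $C^*$-algebra and let $S\subset A$ be an operator system with $C^*(S)=A$. Let $\varphi,\psi\in\mathcal E(A)$. Then: (1) $\varphi\preceq_{\mathrm S}\psi$ if and only if $\varphi\preceq_{\mathrm{ISD}}\psi$. (2) $\varphi$ is maximal in $\preceq_{\mathrm S}$ if and only if $\varphi$ is maximal in $\preceq_{\mathrm{ISD}}$.
   Context: An operator system in $A$ is a unital self-adjoint linear subspace of $A$; $C^*(S)$ is the $C^*$-subalgebra generated by $S$. $\mathcal E(A)$ is the state space of $A$ with the weak-$*$ topology. UCP means unital completely positive. For $\varphi\in\mathcal E(A)$, $(\pi_\varphi,H_\varphi,\xi_\varphi)$ denotes its GNS representation. All relations below are associated with the pair $(S,A)$. Dilation order: $\varphi\preceq_{\mathrm D}\psi$ if there exists a UCP map $\Phi:A\to B(H_\varphi)$ with $\Phi(s)=\pi_\varphi(s)$ for all $s\in S$ and $\psi(a)=\langle\Phi(a)\xi_\varphi,\xi_\varphi\rangle$ for all $a\in A$. Strong dilation relation: $\varphi\preceq_{\mathrm S}\psi$ if there exists such a UCP map $\Phi$ with range contained in the bicommutant $\pi_\varphi(A)''$. Barycenter: for a Borel probability measure $\mu$ on $\mathcal E(A)$, $\mathfrak b(\mu)(a)=\int_{\mathcal E(A)}\alpha(a)\,d\mu(\alpha)$, $a\in A$. $\bar\mu$ denotes the completion of $\mu$. Integral subdivision relation: $\varphi\preceq_{\mathrm{ISD}}\psi$ if for every Borel probability measure $\mu$ on $\mathcal E(A)$ with $\mathfrak b(\mu)=\varphi$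 there is a family of states $\alpha\mapsto\psi_\alpha\in\mathcal E(A)$ ($\alpha\in\mathcal E(A)$) such that $\alpha\mapsto\psi_\alpha(a)$ is $\bar\mu$-measurable for every $a\in A$, $\alpha\preceq_{\mathrm D}\psi_\alpha$ for $\bar\mu$-almost every $\alpha$, and $\psi(a)=\int_{\mathcal E(A)}\psi_\alpha(a)\,d\bar\mu(\alpha)$ for all $a\in A$. A state $\varphi$ is maximal for a relation $\preceq$ on $\mathcal E(A)$ if $\varphi\preceq\psi$ implies $\psi=\varphi$ for every $\psi\in\mathcal E(A)$. *)

theory Defs
  imports "HOL-Analysis.Analysis"
begin

section \<open>Unital C*-algebras and operator systems\<close>

text \<open>The algebra is the whole type. The superclass axiom \<open>norm 1 = 1\<close> holds in every nonzero
  unital C*-algebra; the zero algebra has no states.\<close>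

class cstar_algebra = real_normed_algebra_1 + banach +
  fixes scaleC :: "complex \<Rightarrow> 'a \<Rightarrow> 'a"
    and star :: "'a \<Rightarrow> 'a"
  assumes scaleC_add_right: "scaleC c (a + b) = scaleC c a + scaleC c b"
    and scaleC_add_left: "scaleC (c + d) a = scaleC c a + scaleC d a"
    and scaleC_scaleC: "scaleC c (scaleC d a) = scaleC (c * d) a"
    and scaleC_one: "scaleC 1 a = a"
    and scaleR_scaleC: "scaleR r a = scaleC (complex_of_real r) a"
    and mult_scaleC_left: "scaleC c a * b = scaleC c (a * b)"
    and mult_scaleC_right: "a * scaleC c b = scaleC c (a * b)"
    and norm_scaleC: "norm (scaleC c a) = cmod c * norm a"
    and star_add: "star (a + b) = star a + star b"
    and star_scaleC: "star (scaleC c a) = scaleC (cnj c) (star a)"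
    and star_mult: "star (a * b) = star b * star a"
    and star_star: "star (star a) = a"
    and cstar_identity: "norm (star a * a) = (norm a)\<^sup>2"

definition self_adjoint_subspace :: "'a::cstar_algebra set \<Rightarrow> bool" where
  "self_adjoint_subspace S \<longleftrightarrow>
     0 \<in> S \<and> (\<forall>a\<in>S. \<forall>b\<in>S. a + b \<in> S) \<and> (\<forall>c. \<forall>a\<in>S. scaleC c a \<in> S) \<and> (\<forall>a\<in>S. star a \<in> S)"

definition operator_system :: "'a::cstar_algebra set \<Rightarrow> bool" where
  "operator_system S \<longleftrightarrow> self_adjoint_subspace S \<and> 1 \<in> S"

definition cstar_subalgebra :: "'a::cstar_algebra set \<Rightarrow> bool" where
  "cstar_subalgebra B \<longleftrightarrow> self_adjoint_subspace B \<and> (\<forall>a\<in>B. \<forall>b\<in>B. a * b \<in> B) \<and> closed B"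

definition generated_cstar :: "'a::cstar_algebra set \<Rightarrow> 'a set" where
  "generated_cstar S = cstar_subalgebra hull S"


section \<open>The state space\<close>

definition states :: "('a::cstar_algebra \<Rightarrow> complex) set" where
  "states = {\<phi>. (\<forall>a b. \<phi> (a + b) = \<phi> a + \<phi> b) \<and> (\<forall>c a. \<phi> (scaleC c a) = c * \<phi> a) \<and>
                (\<forall>a. \<phi> (star a * a) \<in> \<real>\<^sub>\<ge>\<^sub>0) \<and> \<phi> 1 = 1}"

text \<open>The topology of the function type is that of pointwise convergence, so its trace on
  \<^const>\<open>states\<close> is the weak-* topology, and the trace of its Borel sets is the Borel
  \<open>\<sigma>\<close>-algebra of the state space.\<close>

definition borel_prob_on_states :: "('a::cstar_algebra \<Rightarrow> complex) measure \<Rightarrow> bool" where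
  "borel_prob_on_states \<mu> \<longleftrightarrow> sets \<mu> = sets (restrict_space borel states) \<and> emeasure \<mu> (space \<mu>) = 1"

definition barycenter :: "('a::cstar_algebra \<Rightarrow> complex) measure \<Rightarrow> 'a \<Rightarrow> complex" where
  "barycenter \<mu> a = (\<integral>\<alpha>. \<alpha> a \<partial>\<mu>)"


section \<open>Hilbert spaces with explicit carrier\<close>

text \<open>The GNS space depends on the state, so it cannot be a type; it is given by a carrier and
  operations, which matter on the carrier only. Inner products are linear in the first argument.
  Operators are functions that are \<^const>\<open>undefined\<close> outside the carrier, so that equality
  of operators is equality of functions.\<close>

record 'h hilb =
  hcarrier :: "'h set"
  hadd :: "'h \<Rightarrow> 'h \<Rightarrow> 'h"
  hscale :: "complex \<Rightarrow> 'h \<Rightarrow> 'h"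
  hinner :: "'h \<Rightarrow> 'h \<Rightarrow> complex"

definition hnorm :: "'h hilb \<Rightarrow> 'h \<Rightarrow> real" where
  "hnorm H u = sqrt (Re (hinner H u u))"

definition bounded_ops :: "'h hilb \<Rightarrow> ('h \<Rightarrow> 'h) set" where
  "bounded_ops H = {T \<in> hcarrier H \<rightarrow>\<^sub>E hcarrier H.
     (\<forall>u\<in>hcarrier H. \<forall>v\<in>hcarrier H. T (hadd H u v) = hadd H (T u) (T v)) \<and>
     (\<forall>c. \<forall>u\<in>hcarrier H. T (hscale H c u) = hscale H c (T u)) \<and>
     (\<exists>K. \<forall>u\<in>hcarrier H. hnorm H (T u) \<le> K * hnorm H u)}"

definition commutant :: "'h hilb \<Rightarrow> ('h \<Rightarrow> 'h) set \<Rightarrow> ('h \<Rightarrow> 'h) set" where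
  "commutant H M = {T \<in> bounded_ops H. \<forall>R\<in>M. compose (hcarrier H) T R = compose (hcarrier H) R T}"

definition bicommutant :: "'h hilb \<Rightarrow> ('h \<Rightarrow> 'h) set \<Rightarrow> ('h \<Rightarrow> 'h) set" where
  "bicommutant H M = commutant H (commutant H M)"


section \<open>Unital completely positive maps\<close>

text \<open>An element of \<open>M\<^sub>n(A)\<close> is positive if it has the form \<open>Y\<^sup>* Y\<close>. An element of
  \<open>M\<^sub>n(B(H))\<close> is positive if it is positive as an operator on \<open>H\<^sup>n\<close>.\<close>

definition matrix_pos :: "nat \<Rightarrow> (nat \<Rightarrow> nat \<Rightarrow> 'a::cstar_algebra) \<Rightarrow> bool" where
  "matrix_pos n X \<longleftrightarrow> (\<exists>Y. \<forall>i<n. \<forall>j<n. X i j = (\<Sum>k<n. star (Y k i) * Y k j))"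

definition op_matrix_pos :: "'h hilb \<Rightarrow> nat \<Rightarrow> (nat \<Rightarrow> nat \<Rightarrow> 'h \<Rightarrow> 'h) \<Rightarrow> bool" where
  "op_matrix_pos H n T \<longleftrightarrow>
     (\<forall>h. (\<forall>i<n. h i \<in> hcarrier H) \<longrightarrow> (\<Sum>i<n. \<Sum>j<n. hinner H (T i j (h j)) (h i)) \<in> \<real>\<^sub>\<ge>\<^sub>0)"

definition completely_positive :: "'h hilb \<Rightarrow> ('a::cstar_algebra \<Rightarrow> 'h \<Rightarrow> 'h) \<Rightarrow> bool" where
  "completely_positive H \<Phi> \<longleftrightarrow>
     (\<forall>n X. matrix_pos n X \<longrightarrow> op_matrix_pos H n (\<lambda>i j. \<Phi> (X i j)))"

definition ucp :: "'h hilb \<Rightarrow> ('a::cstar_algebra \<Rightarrow> 'h \<Rightarrow> 'h) \<Rightarrow> bool" where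
  "ucp H \<Phi> \<longleftrightarrow>
     (\<forall>a. \<Phi> a \<in> bounded_ops H) \<and>
     (\<forall>a b. \<forall>u\<in>hcarrier H. \<Phi> (a + b) u = hadd H (\<Phi> a u) (\<Phi> b u)) \<and>
     (\<forall>c a. \<forall>u\<in>hcarrier H. \<Phi> (scaleC c a) u = hscale H c (\<Phi> a u)) \<and>
     (\<forall>u\<in>hcarrier H. \<Phi> 1 u = u) \<and>
     completely_positive H \<Phi>"


section \<open>The GNS representation\<close>

text \<open>The GNS space is the completion of \<open>A / N\<^sub>\<phi>\<close>, where \<open>N\<^sub>\<phi> = {a. \<phi> (a\<^sup>* a) = 0}\<close>,
  formed in one step: sequences in \<open>A\<close> that are Cauchy for the seminorm
  \<open>a \<mapsto> \<phi> (a\<^sup>* a)\<^sup>1\<^sup>/\<^sup>2\<close>, modulo sequences that tend to 0 in this seminorm.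
  The operations do not depend on the representatives chosen by \<open>gns_rep_seq\<close>.\<close>

definition gns_seminorm :: "('a::cstar_algebra \<Rightarrow> complex) \<Rightarrow> 'a \<Rightarrow> real" where
  "gns_seminorm \<phi> a = sqrt (Re (\<phi> (star a * a)))"

definition gns_cauchy :: "('a::cstar_algebra \<Rightarrow> complex) \<Rightarrow> (nat \<Rightarrow> 'a) set" where
  "gns_cauchy \<phi> = {x. \<forall>e>0. \<exists>N. \<forall>m\<ge>N. \<forall>n\<ge>N. gns_seminorm \<phi> (x m - x n) < e}"

definition gns_equiv :: "('a::cstar_algebra \<Rightarrow> complex) \<Rightarrow> ((nat \<Rightarrow> 'a) \<times> (nat \<Rightarrow> 'a)) set" where
  "gns_equiv \<phi> = {(x, y). x \<in> gns_cauchy \<phi> \<and> y \<in> gns_cauchy \<phi> \<and>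
                          (\<lambda>n. gns_seminorm \<phi> (x n - y n)) \<longlonglongrightarrow> 0}"

definition gns_class :: "('a::cstar_algebra \<Rightarrow> complex) \<Rightarrow> (nat \<Rightarrow> 'a) \<Rightarrow> (nat \<Rightarrow> 'a) set" where
  "gns_class \<phi> x = gns_equiv \<phi> `` {x}"

definition gns_rep_seq :: "(nat \<Rightarrow> 'a::cstar_algebra) set \<Rightarrow> nat \<Rightarrow> 'a" where
  "gns_rep_seq u = (SOME x. x \<in> u)"

definition gns_space :: "('a::cstar_algebra \<Rightarrow> complex) \<Rightarrow> (nat \<Rightarrow> 'a) set hilb" where
  "gns_space \<phi> = \<lparr>
     hcarrier = gns_cauchy \<phi> // gns_equiv \<phi>,
     hadd = (\<lambda>u v. gns_class \<phi> (\<lambda>n. gns_rep_seq u n + gns_rep_seq v n)),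
     hscale = (\<lambda>c u. gns_class \<phi> (\<lambda>n. scaleC c (gns_rep_seq u n))),
     hinner = (\<lambda>u v. lim (\<lambda>n. \<phi> (star (gns_rep_seq v n) * gns_rep_seq u n)))\<rparr>"

definition gns_rep :: "('a::cstar_algebra \<Rightarrow> complex) \<Rightarrow> 'a \<Rightarrow> (nat \<Rightarrow> 'a) set \<Rightarrow> (nat \<Rightarrow> 'a) set" where
  "gns_rep \<phi> a = (\<lambda>u\<in>hcarrier (gns_space \<phi>). gns_class \<phi> (\<lambda>n. a * gns_rep_seq u n))"

definition gns_vec :: "('a::cstar_algebra \<Rightarrow> complex) \<Rightarrow> (nat \<Rightarrow> 'a) set" where
  "gns_vec \<phi> = gns_class \<phi> (\<lambda>n. 1)"


section \<open>The relations on the state space\<close>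

definition dilation_map ::
  "'a::cstar_algebra set \<Rightarrow> ('a \<Rightarrow> complex) \<Rightarrow> ('a \<Rightarrow> complex) \<Rightarrow>
   ('a \<Rightarrow> (nat \<Rightarrow> 'a) set \<Rightarrow> (nat \<Rightarrow> 'a) set) \<Rightarrow> bool" where
  "dilation_map S \<phi> \<psi> \<Phi> \<longleftrightarrow>
     ucp (gns_space \<phi>) \<Phi> \<and> (\<forall>s\<in>S. \<Phi> s = gns_rep \<phi> s) \<and>
     (\<forall>a. \<psi> a = hinner (gns_space \<phi>) (\<Phi> a (gns_vec \<phi>)) (gns_vec \<phi>))"

definition dilation_le ::
  "'a::cstar_algebra set \<Rightarrow> ('a \<Rightarrow> complex) \<Rightarrow> ('a \<Rightarrow> complex) \<Rightarrow> bool" where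
  "dilation_le S \<phi> \<psi> \<longleftrightarrow> (\<exists>\<Phi>. dilation_map S \<phi> \<psi> \<Phi>)"

definition strong_dilation_le ::
  "'a::cstar_algebra set \<Rightarrow> ('a \<Rightarrow> complex) \<Rightarrow> ('a \<Rightarrow> complex) \<Rightarrow> bool" where
  "strong_dilation_le S \<phi> \<psi> \<longleftrightarrow>
     (\<exists>\<Phi>. dilation_map S \<phi> \<psi> \<Phi> \<and>
          range \<Phi> \<subseteq> bicommutant (gns_space \<phi>) (range (gns_rep \<phi>)))"

definition isd_le ::
  "'a::cstar_algebra set \<Rightarrow> ('a \<Rightarrow> complex) \<Rightarrow> ('a \<Rightarrow> complex) \<Rightarrow> bool" where
  "isd_le S \<phi> \<psi> \<longleftrightarrow>
     (\<forall>\<mu>. borel_prob_on_states \<mu> \<and> barycenter \<mu> = \<phi> \<longrightarrow>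
        (\<exists>\<Psi>\<in>states \<rightarrow> states.
           (\<forall>a. (\<lambda>\<alpha>. \<Psi> \<alpha> a) \<in> borel_measurable (completion \<mu>)) \<and>
           (AE \<alpha> in completion \<mu>. dilation_le S \<alpha> (\<Psi> \<alpha>)) \<and>
           (\<forall>a. \<psi> a = (\<integral>\<alpha>. \<Psi> \<alpha> a \<partial>completion \<mu>))))"

definition maximal_state ::
  "(('a::cstar_algebra \<Rightarrow> complex) \<Rightarrow> ('a \<Rightarrow> complex) \<Rightarrow> bool) \<Rightarrow> ('a \<Rightarrow> complex) \<Rightarrow> bool" where
  "maximal_state R \<phi> \<longleftrightarrow> \<phi> \<in> states \<and> (\<forall>\<psi>\<in>states. R \<phi> \<psi> \<longrightarrow> \<psi> = \<phi>)"

end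

theory Submission
  imports Defs
begin

text \<open>A strong dilation map, or a solution of the integral subdivision problem, is approximated by
  completely positive contractions \<open>a \<mapsto> \<Sum>i. c\<^sub>i(a) b\<^sub>i\<^sup>* b\<^sub>i\<close> of \<open>A\<close> itself, where the \<open>b\<^sub>i\<^sup>* b\<^sub>i\<close>
  form a partition of unity and the \<open>c\<^sub>i\<close> are states; this replaces Gelfand duality and representing
  measures. If \<open>\<phi> \<preceq>\<^sub>S \<psi>\<close> through \<open>\<Phi>\<close>, averaging \<open>\<Phi>\<close> over the pieces gives maps \<open>\<Theta>\<^sub>j\<close> with
  \<open>\<Theta>\<^sub>j(a) \<rightarrow> \<Phi>(a) \<xi>\<close> in the GNS space of \<open>\<phi>\<close>; along a fast subsequence they converge in the GNS space of
  \<open>\<mu>\<close>-almost every \<open>\<alpha>\<close> and define there a dilation of \<open>\<alpha>\<close>. Conversely the integral subdivision property,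
  applied to the discrete measures \<open>\<Sum>i. \<phi>(b\<^sub>i\<^sup>* b\<^sub>i) \<delta>(\<phi>\<^sub>i)\<close> with \<open>\<phi>\<^sub>i\<close> the normalised functional
  \<open>\<phi>(b\<^sub>i\<^sup>* b\<^sub>i \<cdot>)\<close>, gives maps \<open>\<Theta>\<close> with \<open>\<phi> \<circ> \<Theta> = \<psi>\<close> that almost fix \<open>S\<close>; these form convex sets, and
  minimising a quadratic functional over them yields a convergent sequence. Its limit is a strong
  operator limit of elements of \<open>\<pi>\<^sub>\<phi>(A)\<close>, hence takes values in the bicommutant.\<close>

section \<open>The involution and square roots\<close>

text \<open>In the picture of \<open>A\<close> as C(X), the GNS space of \<phi> is an L2 space and
  the bicommutant consists of the bounded functions on it. A strong dilation map is thus given only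
  almost everywhere for \<phi>, whereas integral subdivision asks for something at states \<alpha>
  selected by an arbitrary \<mu>. Elements of \<open>A\<close> can be evaluated at every state,
  which is why both directions pass through maps from \<open>A\<close> to \<open>A\<close>. The
  bridge is that the square of \<open>gns_seminorm \<alpha> z\<close> is affine in \<alpha>, so its
  \<mu>-integral is the same expression at \<phi>: convergence at a geometric rate for \<phi> forces
  convergence for almost every \<alpha>. In the other direction each discrete measure yields its own
  solution, with no compatibility between different partitions. A weak cluster point of these would
  not provide the norm-Cauchy sequences of which GNS vectors consist, hence the detour through
  convexity.\<close>

context cstar_algebra
begin

lemma star_zero [simp]: "star 0 = 0"
  using star_add[of 0 0] by simp

lemma star_minus: "star (- a) = - star a"
  using star_add[of a "- a"] by (simp add: eq_neg_iff_add_eq_0 add.commute)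

lemma star_diff: "star (a - b) = star a - star b"
  using star_add[of a "- b"] star_minus[of b] by simp

lemma star_one [simp]: "star 1 = 1"
  using star_mult[of "star 1" 1] star_star[of 1] by simp

lemma star_sum: "star (sum f I) = (\<Sum>i\<in>I. star (f i))"
  by (induction I rule: infinite_finite_induct) (simp_all add: star_add)

lemma star_scaleR: "star (scaleR r a) = scaleR r (star a)"
  by (simp add: scaleR_scaleC star_scaleC)

lemma star_power: "star (a ^ n) = star a ^ n"
  by (induction n) (simp_all add: star_mult power_commutes)

lemma norm_star [simp]: "norm (star a) = norm a"
proof -
  have le: "norm x \<le> norm (star x)" for x
  proof (cases "norm x = 0")
    case False
    have "norm x * norm x \<le> norm (star x) * norm x"
      using norm_mult_ineq[of "star x" x] unfolding cstar_identity monoid_mult_class.power2_eq_square .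
    with False show ?thesis by simp
  qed simp
  show ?thesis using le[of a] le[of "star a"] by (simp add: star_star)
qed

lemma scaleC_zero_left [simp]: "scaleC 0 a = 0"
  using scaleC_add_left[of 0 0 a] by simp

lemma scaleC_zero_right [simp]: "scaleC c 0 = 0"
  using scaleC_add_right[of c 0 0] by simp

lemma scaleC_minus_left: "scaleC (- c) a = - scaleC c a"
  using scaleC_add_left[of c "- c" a] by (simp add: eq_neg_iff_add_eq_0 add.commute)

lemma scaleC_minus_right: "scaleC c (- a) = - scaleC c a"
  using scaleC_add_right[of c a "- a"] by (simp add: eq_neg_iff_add_eq_0 add.commute)

lemma scaleC_diff_left: "scaleC (c - d) a = scaleC c a - scaleC d a"
  using scaleC_add_left[of c "- d" a] by (simp add: scaleC_minus_left)

lemma scaleC_diff_right: "scaleC c (a - b) = scaleC c a - scaleC c b"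
  using scaleC_add_right[of c a "- b"] by (simp add: scaleC_minus_right)

lemma scaleC_sum_right: "scaleC c (sum f I) = (\<Sum>i\<in>I. scaleC c (f i))"
  by (induction I rule: infinite_finite_induct) (simp_all add: scaleC_add_right)

end

lemma bounded_linear_star: "bounded_linear (star :: 'a::cstar_algebra \<Rightarrow> 'a)"
  by (rule bounded_linear_intro[where K = 1]) (simp_all add: star_add star_scaleR)

text \<open>Consecutive coefficients have the ratio \<open>(1/2 - n) / Suc n\<close>, of modulus at
  most 1. The bound lets a geometric series dominate the binomial series of the square root.\<close>

lemma abs_gbinomial_half_le_1: "\<bar>(1/2 :: real) gchoose n\<bar> \<le> 1"
proof (induction n)
  case (Suc n)
  have "(1/2 :: real) gchoose Suc n = (1/2 gchoose n) * ((1/2 - real n) / real (Suc n))"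
    using gbinomial_mult_1[of "1/2 :: real" n] by (simp add: field_simps)
  moreover have "\<bar>(1/2 - real n) / real (Suc n)\<bar> \<le> 1"
    by (simp add: abs_if divide_simps)
  ultimately show ?case
    using mult_mono[OF Suc.IH, of "\<bar>(1/2 - real n) / real (Suc n)\<bar>" 1] by (simp add: abs_mult)
qed simp

text \<open>The root is the binomial series of exponent 1/2 in \<open>- x\<close>. Real coefficients
  make it self-adjoint, and by Vandermonde's identity its Cauchy square has the coefficients
  \<open>1 gchoose k\<close>, which vanish for \<open>k > 1\<close>. It stands in for the continuous
  functional calculus, both in the norm bound for states and in the construction of
  partitions.\<close>

lemma one_minus_eq_square:
  fixes x :: "'a::cstar_algebra"
  assumes "star x = x" and "norm x < 1"
  obtains y where "star y = y" and "y * y = 1 - x"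
proof -
  define c where "c n = (1/2 :: real) gchoose n" for n
  define f where "f n = c n *\<^sub>R (- x) ^ n" for n
  have bound: "norm (f n) \<le> norm x ^ n" for n
  proof -
    have "norm (f n) = \<bar>c n\<bar> * norm ((- x) ^ n)" by (simp add: f_def)
    also have "\<dots> \<le> 1 * norm (- x) ^ n"
      by (intro mult_mono norm_power_ineq) (auto simp: c_def abs_gbinomial_half_le_1)
    finally show ?thesis by simp
  qed
  have summ: "summable (\<lambda>n. norm (f n))"
    by (rule summable_comparison_test'[where g = "\<lambda>n. norm x ^ n" and N = 0])
       (use bound assms(2) in auto)
  define y where "y = suminf f"
  have "star y = (\<Sum>n. star (f n))"
    unfolding y_def by (rule bounded_linear.suminf[OF bounded_linear_star summable_norm_cancel[OF summ]])
  also have "(\<lambda>n. star (f n)) = f"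
    by (auto simp: f_def star_scaleR star_power star_minus assms(1))
  finally have "star y = y" by (simp add: y_def)
  have conv: "(\<Sum>i\<le>k. f i * f (k - i)) = (1 gchoose k) *\<^sub>R (- x) ^ k" for k
  proof -
    have "(\<Sum>i\<le>k. f i * f (k - i)) = (\<Sum>i\<le>k. (c i * c (k - i)) *\<^sub>R (- x) ^ k)"
      by (intro sum.cong refl) (simp add: f_def flip: power_add)
    also have "\<dots> = (\<Sum>i\<le>k. c i * c (k - i)) *\<^sub>R (- x) ^ k"
      by (simp add: scaleR_sum_left)
    also have "(\<Sum>i\<le>k. c i * c (k - i)) = 1 gchoose k"
      using gbinomial_Vandermonde[of "1/2::real" "1/2" k] by (simp add: c_def atMost_atLeast0)
    finally show ?thesis .
  qed
  have "y * y = (\<Sum>k. (1 gchoose k) *\<^sub>R (- x) ^ k)"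
    unfolding y_def using Cauchy_product[OF summ summ] by (simp add: conv)
  also have "\<dots> = (\<Sum>k\<in>{0, 1}. (1 gchoose k) *\<^sub>R (- x) ^ k)"
  proof (rule suminf_finite)
    fix k :: nat assume "k \<notin> {0, 1}"
    then have "(1::real) gchoose k = 0"
      using binomial_gbinomial[of 1 k, where ?'a = real] by (simp add: binomial_eq_0)
    then show "(1 gchoose k) *\<^sub>R (- x) ^ k = 0" by simp
  qed simp
  also have "\<dots> = 1 - x" by simp
  finally show thesis using \<open>star y = y\<close> that by blast
qed

section \<open>The seminorm of a state\<close>

context
  fixes \<phi> :: "'a::cstar_algebra \<Rightarrow> complex"
  assumes \<phi>: "\<phi> \<in> states"
begin

lemma state_add: "\<phi> (a + b) = \<phi> a + \<phi> b"
  and state_scaleC: "\<phi> (scaleC c a) = c * \<phi> a"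
  and state_pos: "\<phi> (star a * a) \<in> \<real>\<^sub>\<ge>\<^sub>0"
  and state_one: "\<phi> 1 = 1"
  using \<phi> by (auto simp: states_def)

lemma state_zero: "\<phi> 0 = 0"
  using state_add[of 0 0] by simp

lemma state_minus: "\<phi> (- a) = - \<phi> a"
  using state_add[of a "- a"] by (simp add: state_zero eq_neg_iff_add_eq_0 add.commute)

lemma state_diff: "\<phi> (a - b) = \<phi> a - \<phi> b"
  using state_add[of a "- b"] by (simp add: state_minus)

lemma state_sum: "\<phi> (sum f I) = (\<Sum>i\<in>I. \<phi> (f i))"
  by (induction I rule: infinite_finite_induct) (simp_all add: state_add state_zero)

lemma state_star_mult_self: "\<phi> (star a * a) = complex_of_real ((gns_seminorm \<phi> a)\<^sup>2)"
  using state_pos[of a]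
  by (auto simp: gns_seminorm_def complex_nonneg_Reals_iff complex_eq_iff)

text \<open>Polarisation: positivity at \<open>a + scaleC c b\<close> settles the imaginary part for
  \<open>c = 1\<close> and the real part for \<open>c = \<i>\<close>.\<close>

lemma state_inner_cnj: "\<phi> (star a * b) = cnj (\<phi> (star b * a))"
proof -
  have im: "Im (\<phi> (star (a + scaleC c b) * (a + scaleC c b))) = 0" for c
    using state_pos by (auto simp: complex_nonneg_Reals_iff)
  have "Im (\<phi> (star a * a)) = 0" "Im (\<phi> (star b * b)) = 0"
    using state_pos by (auto simp: complex_nonneg_Reals_iff)
  then show ?thesis
    using im[of 1] im[of \<i>]
    by (simp add: complex_eq_iff algebra_simps star_add star_scaleC mult_scaleC_left
        mult_scaleC_right scaleC_scaleC state_add state_scaleC scaleC_one)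
qed

lemma gns_seminorm_nonneg: "gns_seminorm \<phi> a \<ge> 0"
  using state_pos[of a] by (simp add: gns_seminorm_def complex_nonneg_Reals_iff)

lemma gns_seminorm_square: "(gns_seminorm \<phi> a)\<^sup>2 = Re (\<phi> (star a * a))"
  by (simp add: state_star_mult_self)

lemma gns_seminorm_zero [simp]: "gns_seminorm \<phi> 0 = 0"
  by (simp add: gns_seminorm_def state_zero)

lemma gns_seminorm_scaleC: "gns_seminorm \<phi> (scaleC c a) = cmod c * gns_seminorm \<phi> a"
proof -
  have "(gns_seminorm \<phi> (scaleC c a))\<^sup>2 = (cmod c * gns_seminorm \<phi> a)\<^sup>2"
    by (simp add: gns_seminorm_square star_scaleC mult_scaleC_left mult_scaleC_right
        scaleC_scaleC state_scaleC power_mult_distrib complex_norm_square cmod_power2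
        flip: mult.assoc) (simp add: power2_eq_square algebra_simps)
  then show ?thesis
    by (simp add: gns_seminorm_nonneg power2_eq_iff_nonneg)
qed

lemma gns_seminorm_minus: "gns_seminorm \<phi> (- a) = gns_seminorm \<phi> a"
  by (simp add: gns_seminorm_def star_minus)

lemma gns_seminorm_minus_commute: "gns_seminorm \<phi> (a - b) = gns_seminorm \<phi> (b - a)"
  using gns_seminorm_minus[of "a - b"] by simp

lemma gns_seminorm_add_square:
  "(gns_seminorm \<phi> (a + b))\<^sup>2 =
     (gns_seminorm \<phi> a)\<^sup>2 + 2 * Re (\<phi> (star a * b)) + (gns_seminorm \<phi> b)\<^sup>2"
  using state_inner_cnj[of b a]
  by (simp add: gns_seminorm_square star_add algebra_simps state_add)

text \<open>Positivity at \<open>scaleC c a + b\<close> with \<open>c = - t z\<close> gives a real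
  quadratic in \<open>t\<close>, minimal at \<open>t = 1 / A\<close>. For \<open>A = 0\<close> it is
  affine, and a large \<open>t\<close> makes it negative unless \<open>z\<close> vanishes.\<close>

lemma state_Cauchy_Schwarz:
  "cmod (\<phi> (star a * b)) \<le> gns_seminorm \<phi> a * gns_seminorm \<phi> b"
proof -
  define z where "z = \<phi> (star a * b)"
  define A where "A = (gns_seminorm \<phi> a)\<^sup>2"
  define B where "B = (gns_seminorm \<phi> b)\<^sup>2"
  have key: "0 \<le> t\<^sup>2 * (cmod z)\<^sup>2 * A - 2 * t * (cmod z)\<^sup>2 + B" for t :: real
  proof -
    define c where "c = - of_real t * z"
    have "0 \<le> (gns_seminorm \<phi> (scaleC c a + b))\<^sup>2" by simp
    also have "\<dots> = (cmod c)\<^sup>2 * A + 2 * Re (cnj c * z) + B"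
      by (simp add: gns_seminorm_add_square gns_seminorm_scaleC star_scaleC mult_scaleC_left
          state_scaleC A_def B_def z_def power_mult_distrib)
    also have "Re (cnj c * z) = - t * (cmod z)\<^sup>2"
      unfolding c_def cmod_power2 by (simp add: power2_eq_square algebra_simps)
    also have "(cmod c)\<^sup>2 = t\<^sup>2 * (cmod z)\<^sup>2"
      by (simp add: c_def norm_mult power_mult_distrib)
    finally show ?thesis by simp
  qed
  have "(cmod z)\<^sup>2 \<le> A * B"
  proof (cases "A = 0")
    case True
    have "(cmod z)\<^sup>2 \<le> 0"
    proof (rule ccontr)
      assume "\<not> (cmod z)\<^sup>2 \<le> 0"
      then have pos: "(cmod z)\<^sup>2 > 0" by simp
      have "2 * ((B + 1) / (cmod z)\<^sup>2) * (cmod z)\<^sup>2 = 2 * (B + 1)" using pos by simp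
      then have "2 * (B + 1) \<le> B" using key[of "(B + 1) / (cmod z)\<^sup>2"] True by simp
      moreover have "B \<ge> 0" by (simp add: B_def)
      ultimately show False by simp
    qed
    then show ?thesis using True by simp
  next
    case False
    then have "A > 0" by (simp add: A_def)
    then show ?thesis using key[of "1 / A"]
      by (simp add: field_simps power2_eq_square)
  qed
  then show ?thesis
    using power2_le_imp_le[of "cmod z" "gns_seminorm \<phi> a * gns_seminorm \<phi> b"]
    by (simp add: A_def B_def z_def power_mult_distrib gns_seminorm_nonneg)
qed

lemma gns_seminorm_triangle: "gns_seminorm \<phi> (a + b) \<le> gns_seminorm \<phi> a + gns_seminorm \<phi> b"
proof (rule power2_le_imp_le)
  show "(gns_seminorm \<phi> (a + b))\<^sup>2 \<le> (gns_seminorm \<phi> a + gns_seminorm \<phi> b)\<^sup>2"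
    using state_Cauchy_Schwarz[of a b] complex_Re_le_cmod[of "\<phi> (star a * b)"]
    by (simp add: gns_seminorm_add_square power2_sum)
qed (simp add: gns_seminorm_nonneg)

lemma gns_seminorm_diff_triangle:
  "gns_seminorm \<phi> (a - c) \<le> gns_seminorm \<phi> (a - b) + gns_seminorm \<phi> (b - c)"
  using gns_seminorm_triangle[of "a - b" "b - c"] by simp

text \<open>For \<open>r > norm x\<close> and \<open>y\<close> the multiple of \<open>x\<close> by
  \<open>1 / r\<close>, the element \<open>1 - star y * y\<close> is a square \<open>w * w\<close>,
  and positivity at \<open>w * a\<close> is the claim with \<open>r\<close> in place of
  \<open>norm x\<close>. The square root requires the strict inequality; letting \<open>r\<close>
  decrease to \<open>norm x\<close> removes it.\<close>

lemma gns_seminorm_mult: "gns_seminorm \<phi> (x * a) \<le> norm x * gns_seminorm \<phi> a"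
proof -
  have "gns_seminorm \<phi> (x * a) \<le> r * gns_seminorm \<phi> a" if r: "norm x < r" for r
  proof -
    have "r > 0" using r norm_ge_zero[of x] by linarith
    define y where "y = scaleR (1 / r) x"
    have ny: "norm y < 1" using r \<open>r > 0\<close> by (simp add: y_def)
    have "star (star y * y) = star y * y" by (simp add: star_mult star_star)
    moreover have "norm (star y * y) < 1"
      using ny by (simp add: cstar_identity power_less_one_iff)
    ultimately obtain w where w: "star w = w" "w * w = 1 - star y * y"
      using one_minus_eq_square by blast
    have "0 \<le> (gns_seminorm \<phi> (w * a))\<^sup>2" by simp
    also have "\<dots> = Re (\<phi> (star a * (w * w) * a))"
      by (simp add: gns_seminorm_square star_mult w(1) mult.assoc)
    also have "\<dots> = (gns_seminorm \<phi> a)\<^sup>2 - (gns_seminorm \<phi> (y * a))\<^sup>2"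
      unfolding w(2) by (simp add: algebra_simps state_diff gns_seminorm_square star_mult)
    finally have "gns_seminorm \<phi> (y * a) \<le> gns_seminorm \<phi> a"
      using power2_le_imp_le gns_seminorm_nonneg by auto
    moreover have "x * a = scaleC (of_real r) (y * a)"
      using \<open>r > 0\<close> by (simp add: y_def flip: scaleR_scaleC)
    ultimately show ?thesis
      using \<open>r > 0\<close> by (simp add: gns_seminorm_scaleC)
  qed
  then have ev: "\<forall>\<^sub>F r in at_right (norm x). gns_seminorm \<phi> (x * a) \<le> r * gns_seminorm \<phi> a"
    by (simp add: eventually_at_filter)
  have "((\<lambda>r. r * gns_seminorm \<phi> a) \<longlongrightarrow> norm x * gns_seminorm \<phi> a) (at_right (norm x))"
    by (intro tendsto_intros)
  then show ?thesis
    using ev by (rule tendsto_lowerbound) simp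
qed

lemma gns_seminorm_one [simp]: "gns_seminorm \<phi> 1 = 1"
  by (simp add: gns_seminorm_def state_one)

lemma gns_seminorm_le_norm: "gns_seminorm \<phi> a \<le> norm a"
  using gns_seminorm_mult[of a 1] by simp

lemma cmod_state_le_gns_seminorm: "cmod (\<phi> a) \<le> gns_seminorm \<phi> a"
  using state_Cauchy_Schwarz[of 1 a] by simp

lemma cmod_state_le_norm: "cmod (\<phi> a) \<le> norm a"
  using cmod_state_le_gns_seminorm[of a] gns_seminorm_le_norm[of a] by simp

end

section \<open>Partitions of unity\<close>

text \<open>The weights are given through factors \<open>b i\<close>, so that positivity is built in
  and \<open>gns_seminorm \<phi> (b i * u)\<close> measures \<open>u\<close> on the i-th
  piece.\<close>

definition partition_of_unity :: "nat \<Rightarrow> (nat \<Rightarrow> 'a::cstar_algebra) \<Rightarrow> bool" where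
  "partition_of_unity n b \<longleftrightarrow> (\<Sum>i<n. star (b i) * b i) = 1"

text \<open>On a null piece the mean is 0, since \<open>x / 0 = 0\<close>.\<close>

definition local_mean :: "('a::cstar_algebra \<Rightarrow> complex) \<Rightarrow> 'a \<Rightarrow> 'a \<Rightarrow> complex" where
  "local_mean \<phi> b y = \<phi> (star b * b * y) / \<phi> (star b * b)"

text \<open>Deliberately not divided by the mass of the piece: in this form the variances of the
  pieces can be summed and bound seminorms in \<open>A\<close> directly.\<close>

definition local_variance :: "('a::cstar_algebra \<Rightarrow> complex) \<Rightarrow> 'a \<Rightarrow> 'a \<Rightarrow> real" where
  "local_variance \<phi> b y = (gns_seminorm \<phi> (b * (y - scaleC (local_mean \<phi> b y) 1)))\<^sup>2"

lemma gns_seminorm_partition: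
  assumes "\<phi> \<in> states" and "partition_of_unity n b"
  shows "(\<Sum>i<n. (gns_seminorm \<phi> (b i * u))\<^sup>2) = (gns_seminorm \<phi> u)\<^sup>2"
proof -
  have "star u * u = star u * (\<Sum>i<n. star (b i) * b i) * u"
    using assms(2) by (simp add: partition_of_unity_def)
  also have "\<dots> = (\<Sum>i<n. star (b i * u) * (b i * u))"
    by (simp add: sum_distrib_left sum_distrib_right star_mult mult.assoc)
  finally show ?thesis
    using assms(1) by (simp add: gns_seminorm_square state_sum)
qed

text \<open>The row \<open>(star (b i))\<close> is a coisometry.\<close>

lemma gns_seminorm_partition_combination:
  assumes \<phi>: "\<phi> \<in> states" and b: "partition_of_unity n b"
  shows "(gns_seminorm \<phi> (\<Sum>i<n. star (b i) * b i * g i))\<^sup>2 \<le> (\<Sum>i<n. (gns_seminorm \<phi> (b i * g i))\<^sup>2)"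
proof -
  define z where "z = (\<Sum>i<n. star (b i) * b i * g i)"
  have "star z * z = (\<Sum>i<n. star (b i * z) * (b i * g i))"
    by (subst (2) z_def) (simp add: sum_distrib_left star_mult mult.assoc)
  then have "(gns_seminorm \<phi> z)\<^sup>2 = (\<Sum>i<n. Re (\<phi> (star (b i * z) * (b i * g i))))"
    using \<phi> by (simp add: gns_seminorm_square state_sum)
  \<comment> \<open>Cauchy-Schwarz and the inequality of means. The first squares add up to half the
    left-hand side and are absorbed by it.\<close>
  also have "\<dots> \<le> (\<Sum>i<n. ((gns_seminorm \<phi> (b i * z))\<^sup>2 + (gns_seminorm \<phi> (b i * g i))\<^sup>2) / 2)"
  proof (rule sum_mono)
    fix i
    have "Re (\<phi> (star (b i * z) * (b i * g i))) \<le> gns_seminorm \<phi> (b i * z) * gns_seminorm \<phi> (b i * g i)"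
      using state_Cauchy_Schwarz[OF \<phi>] complex_Re_le_cmod order_trans by blast
    then show "Re (\<phi> (star (b i * z) * (b i * g i)))
        \<le> ((gns_seminorm \<phi> (b i * z))\<^sup>2 + (gns_seminorm \<phi> (b i * g i))\<^sup>2) / 2"
      using sum_squares_bound[of "gns_seminorm \<phi> (b i * z)" "gns_seminorm \<phi> (b i * g i)"] by simp
  qed
  also have "\<dots> = ((gns_seminorm \<phi> z)\<^sup>2 + (\<Sum>i<n. (gns_seminorm \<phi> (b i * g i))\<^sup>2)) / 2"
    by (simp add: sum.distrib gns_seminorm_partition[OF \<phi> b] flip: sum_divide_distrib)
  finally show ?thesis by (simp add: z_def)
qed

text \<open>A locale over the type rather than a class: commutativity is a hypothesis of the theorem
  about a given type, and \<open>ty\<close> names that type for the interpretation.\<close>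

locale commutative_cstar =
  fixes ty :: "'a::cstar_algebra itself"
  assumes comm: "a * b = b * (a :: 'a)"
begin

lemma left_comm: "a * (b * c) = b * (a * (c :: 'a))"
  by (metis comm mult.assoc)

lemmas mult_ac = mult.assoc comm left_comm

lemma gns_seminorm_mult_right:
  assumes "\<phi> \<in> states"
  shows "gns_seminorm \<phi> (a * x) \<le> norm (x :: 'a) * gns_seminorm \<phi> a"
  using gns_seminorm_mult[OF assms, of x a] by (simp add: comm)

section \<open>Mean and variance of an element on a piece\<close>

context
  fixes \<phi> :: "'a \<Rightarrow> complex" and b :: 'a
  assumes \<phi>: "\<phi> \<in> states"
begin

text \<open>Cauchy-Schwarz against \<open>b\<close>. It makes the relation "mean times mass is the
  integral" hold on null pieces too, in spite of the division by zero.\<close>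

lemma null_piece:
  assumes "\<phi> (star b * b) = 0"
  shows "\<phi> (star b * b * y) = 0"
proof -
  have "gns_seminorm \<phi> b = 0" using assms \<phi> by (simp add: state_star_mult_self)
  then show ?thesis
    using state_Cauchy_Schwarz[OF \<phi>, of b "b * y"] by (simp add: mult.assoc)
qed

lemma local_mean_mult: "local_mean \<phi> b y * \<phi> (star b * b) = \<phi> (star b * b * y)"
  using null_piece by (simp add: local_mean_def)

lemma local_mean_diff: "local_mean \<phi> b (x - y) = local_mean \<phi> b x - local_mean \<phi> b y"
  using \<phi> by (simp add: local_mean_def right_diff_distrib state_diff diff_divide_distrib)

lemma local_mean_add: "local_mean \<phi> b (x + y) = local_mean \<phi> b x + local_mean \<phi> b y"
  using \<phi> by (simp add: local_mean_def distrib_left state_add add_divide_distrib)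

lemma local_mean_scaleC: "local_mean \<phi> b (scaleC c y) = c * local_mean \<phi> b y"
  using \<phi> by (simp add: local_mean_def mult_scaleC_right state_scaleC)

text \<open>Pythagoras, known as Steiner's theorem on moments: for the local mean \<open>m\<close>,
  the vector \<open>b * (y - scaleC m 1)\<close> is orthogonal to \<open>b\<close>. Hence the mean
  is the best constant, and \<open>c = 0\<close> gives a Jensen inequality.\<close>

lemma gns_seminorm_local_shift:
  "(gns_seminorm \<phi> (b * (y - scaleC c 1)))\<^sup>2 =
     local_variance \<phi> b y + (cmod (local_mean \<phi> b y - c))\<^sup>2 * (gns_seminorm \<phi> b)\<^sup>2"
proof -
  define m where "m = local_mean \<phi> b y"
  define x where "x = b * (y - scaleC m 1)"
  have "\<phi> (star x * b) = cnj (\<phi> (star b * x))"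
    by (rule state_inner_cnj[OF \<phi>])
  also have "\<phi> (star b * x) = \<phi> (star b * b * y) - m * \<phi> (star b * b)"
    using \<phi> by (simp add: x_def right_diff_distrib mult_scaleC_right state_diff state_scaleC mult.assoc)
  finally have "\<phi> (star x * b) = 0"
    by (simp add: local_mean_mult m_def)
  moreover have "b * (y - scaleC c 1) = x + scaleC (m - c) b"
    by (simp add: x_def right_diff_distrib mult_scaleC_right scaleC_diff_left)
  ultimately show ?thesis
    using \<phi> by (simp add: gns_seminorm_add_square mult_scaleC_right state_scaleC
        gns_seminorm_scaleC local_variance_def x_def[symmetric] m_def[symmetric] power_mult_distrib)
qed

lemma local_variance_le: "local_variance \<phi> b y \<le> (gns_seminorm \<phi> (b * (y - scaleC c 1)))\<^sup>2"
  by (simp add: gns_seminorm_local_shift)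

lemma local_mean_bound: "(cmod (local_mean \<phi> b y))\<^sup>2 * (gns_seminorm \<phi> b)\<^sup>2 \<le> (gns_seminorm \<phi> (b * y))\<^sup>2"
  using gns_seminorm_local_shift[of y 0] by (simp add: local_variance_def)

lemma local_variance_le_square: "local_variance \<phi> b y \<le> (gns_seminorm \<phi> (b * y))\<^sup>2"
  using local_variance_le[of y 0] by simp

lemma local_variance_scaleC: "local_variance \<phi> b (scaleC c y) = (cmod c)\<^sup>2 * local_variance \<phi> b y"
proof -
  have "b * (scaleC c y - scaleC (c * local_mean \<phi> b y) 1) = scaleC c (b * (y - scaleC (local_mean \<phi> b y) 1))"
    by (simp add: right_diff_distrib mult_scaleC_right scaleC_diff_right scaleC_scaleC)
  then show ?thesis
    using \<phi> by (simp add: local_variance_def local_mean_scaleC gns_seminorm_scaleC power_mult_distrib)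
qed

lemma local_variance_add:
  "local_variance \<phi> b (x + y) \<le> 2 * local_variance \<phi> b x + 2 * local_variance \<phi> b y"
proof -
  let ?N = "\<lambda>y. gns_seminorm \<phi> (b * (y - scaleC (local_mean \<phi> b y) 1))"
  have "b * (x + y - scaleC (local_mean \<phi> b (x + y)) 1) =
      b * (x - scaleC (local_mean \<phi> b x) 1) + b * (y - scaleC (local_mean \<phi> b y) 1)"
    by (simp add: local_mean_add scaleC_add_left algebra_simps)
  then have "?N (x + y) \<le> ?N x + ?N y"
    using gns_seminorm_triangle[OF \<phi>] by metis
  then have "(?N (x + y))\<^sup>2 \<le> (?N x + ?N y)\<^sup>2"
    using gns_seminorm_nonneg[OF \<phi>] by (intro power_mono)
  also have "\<dots> \<le> 2 * (?N x)\<^sup>2 + 2 * (?N y)\<^sup>2"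
    using sum_squares_bound[of "?N x" "?N y"] by (simp add: power2_sum)
  finally show ?thesis by (simp add: local_variance_def)
qed

end

subsection \<open>Fine partitions\<close>

text \<open>Lists suit the doubling of the number of pieces at each splitting. The order of the two
  blocks matters once endpoints of a walk are attached to the pieces.\<close>

definition split_list :: "'a \<Rightarrow> 'a \<Rightarrow> 'a list \<Rightarrow> 'a list" where
  "split_list r t bs = map (\<lambda>b. b * r) bs @ map (\<lambda>b. b * t) bs"

lemma pieces_split:
  fixes b r t y :: 'a
  assumes "\<phi> \<in> states" "star r * r + star t * t = 1"
  shows "(gns_seminorm \<phi> (b * r * y))\<^sup>2 + (gns_seminorm \<phi> (b * t * y))\<^sup>2 = (gns_seminorm \<phi> (b * y))\<^sup>2"
proof -
  have "star (b * r * y) * (b * r * y) + star (b * t * y) * (b * t * y) =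
      (star r * r + star t * t) * (star (b * y) * (b * y))"
    by (simp add: star_mult distrib_right distrib_left mult_ac)
  then show ?thesis
    using assms by (simp add: gns_seminorm_square flip: state_add plus_complex.sel(1))
qed

lemma split_list_partition:
  assumes "star r * r + star t * t = 1" "(\<Sum>b\<leftarrow>bs. star b * b) = 1"
  shows "(\<Sum>b\<leftarrow>split_list r t bs. star b * b) = 1"
proof -
  have "(\<Sum>b\<leftarrow>split_list r t bs. star b * b) = (\<Sum>b\<leftarrow>bs. star (b * r) * (b * r) + star (b * t) * (b * t))"
    by (simp add: split_list_def o_def sum_list_addf)
  also have "(\<lambda>b. star (b * r) * (b * r) + star (b * t) * (b * t)) = (\<lambda>b. (star r * r + star t * t) * (star b * b))"
    by (auto simp: star_mult distrib_right distrib_left mult_ac)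
  finally show ?thesis using assms by simp
qed

text \<open>The mean of the unsplit piece is a competitor on both halves. Splitting therefore never
  spoils a partition that is already fine for other elements.\<close>

lemma split_list_variance:
  assumes "\<phi> \<in> states" "star r * r + star t * t = 1"
  shows "(\<Sum>b\<leftarrow>split_list r t bs. local_variance \<phi> b y) \<le> (\<Sum>b\<leftarrow>bs. local_variance \<phi> b y)"
proof -
  have "(\<Sum>b\<leftarrow>split_list r t bs. local_variance \<phi> b y) =
      (\<Sum>b\<leftarrow>bs. local_variance \<phi> (b * r) y + local_variance \<phi> (b * t) y)"
    by (simp add: split_list_def o_def sum_list_addf)
  also have "\<dots> \<le> (\<Sum>b\<leftarrow>bs. local_variance \<phi> b y)"
  proof (rule sum_list_mono)
    fix b
    have "local_variance \<phi> (b * r) y + local_variance \<phi> (b * t) y \<le>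
        (gns_seminorm \<phi> (b * r * (y - scaleC (local_mean \<phi> b y) 1)))\<^sup>2 +
        (gns_seminorm \<phi> (b * t * (y - scaleC (local_mean \<phi> b y) 1)))\<^sup>2"
      by (intro add_mono local_variance_le assms(1))
    then show "local_variance \<phi> (b * r) y + local_variance \<phi> (b * t) y \<le> local_variance \<phi> b y"
      unfolding pieces_split[OF assms] by (simp add: local_variance_def)
  qed
  finally show ?thesis .
qed

text \<open>Splitting \<open>n\<close> times along \<open>(1 \<plusminus> s) / 2\<close> attaches to each piece the endpoint \<open>c\<close> of a walk
  with steps \<open>\<plusminus>1\<close> and drift \<open>s\<close>, and the variance of \<open>n s - c\<close> grows by \<open>1 - s\<^sup>2\<close> in each
  step.\<close>

lemma random_walk_step:
  fixes b r t s d :: 'a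
  assumes \<phi>: "\<phi> \<in> states" and s: "star s = s"
    and r: "star r * r = scaleR (1/2) (1 + s)" and t: "star t * t = scaleR (1/2) (1 - s)"
    and d: "star d = d"
  shows "(gns_seminorm \<phi> (b * r * (d + s - 1)))\<^sup>2 + (gns_seminorm \<phi> (b * t * (d + s + 1)))\<^sup>2
    \<le> (gns_seminorm \<phi> (b * d))\<^sup>2 + (gns_seminorm \<phi> b)\<^sup>2"
proof -
  define p where "p = star b * b"
  \<comment> \<open>Here \<open>d\<close> is the deviation before the step; \<open>d + s - 1\<close>
    and \<open>d + s + 1\<close> are the deviations after the endpoint has moved up or down by 1.
    The terms linear in \<open>d\<close> cancel in the weighted mean.\<close>
  have "star (b * r * (d + s - 1)) * (b * r * (d + s - 1)) +
      star (b * t * (d + s + 1)) * (b * t * (d + s + 1)) =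
      p * ((star r * r) * ((d + s - 1) * (d + s - 1)) + (star t * t) * ((d + s + 1) * (d + s + 1)))"
    using s d by (simp add: p_def star_mult star_add star_diff distrib_left mult_ac)
  also have "(star r * r) * ((d + s - 1) * (d + s - 1)) + (star t * t) * ((d + s + 1) * (d + s + 1)) =
      scaleR (1/2) ((1 + s) * ((d + s - 1) * (d + s - 1)) + (1 - s) * ((d + s + 1) * (d + s + 1)))"
    unfolding r t mult_scaleR_left scaleR_add_right[symmetric] ..
  also have "(1 + s) * ((d + s - 1) * (d + s - 1)) + (1 - s) * ((d + s + 1) * (d + s + 1)) =
      scaleR 2 (d * d + 1 - s * s)"
    by (simp add: algebra_simps comm[of s d] left_comm[of s d] scaleR_2)
  also have "scaleR (1/2) (scaleR 2 (d * d + 1 - s * s)) = d * d + 1 - s * s"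
    by (simp only: scaleR_scaleR) simp
  also have "p * (d * d + 1 - s * s) = star (b * d) * (b * d) + star b * b - star (b * s) * (b * s)"
    using s d by (simp add: p_def star_mult algebra_simps mult_ac)
  finally have eq: "star (b * r * (d + s - 1)) * (b * r * (d + s - 1)) +
      star (b * t * (d + s + 1)) * (b * t * (d + s + 1)) =
      star (b * d) * (b * d) + star b * b - star (b * s) * (b * s)" .
  have "(gns_seminorm \<phi> (b * r * (d + s - 1)))\<^sup>2 + (gns_seminorm \<phi> (b * t * (d + s + 1)))\<^sup>2
      = (gns_seminorm \<phi> (b * d))\<^sup>2 + (gns_seminorm \<phi> b)\<^sup>2 - (gns_seminorm \<phi> (b * s))\<^sup>2"
    unfolding gns_seminorm_square[OF \<phi>] plus_complex.sel(1)[symmetric] minus_complex.sel(1)[symmetric]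
      state_add[OF \<phi>, symmetric] state_diff[OF \<phi>, symmetric] eq ..
  \<comment> \<open>The term with \<open>b * s\<close> is dropped, which leaves a growth by at most
    the mass of the piece.\<close>
  then show ?thesis by simp
qed

lemma half_sum: "scaleR (1/2) (1 + s) + scaleR (1/2) (1 - s) = (1 :: 'a)"
proof -
  have "scaleR (1/2) (1 + s) + scaleR (1/2) (1 - s) = scaleR (1/2 + 1/2) (1 :: 'a)"
    by (simp only: scaleR_add_right scaleR_diff_right scaleR_left_distrib) simp
  then show ?thesis by simp
qed

text \<open>The masses add up to 1, so each round of splittings adds at most 1 to the total. The
  endpoints recorded in \<open>zs\<close> do not depend on \<phi>, which makes the bound uniform
  over all states. Pinning the first components to the iterated \<open>split_list\<close> keeps the
  monotonicity of the variance under splitting applicable.\<close>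

lemma random_walk:
  fixes r s t :: 'a
  assumes s: "star s = s" and r: "star r * r = scaleR (1/2) (1 + s)" and t: "star t * t = scaleR (1/2) (1 - s)"
    and bs: "(\<Sum>b\<leftarrow>bs. star b * b) = 1"
  shows "\<exists>zs :: ('a \<times> real) list. map fst zs = ((split_list r t) ^^ n) bs \<and>
    (\<forall>\<phi>\<in>states. (\<Sum>(b, c)\<leftarrow>zs. (gns_seminorm \<phi> (b * (scaleR n s - scaleR c 1)))\<^sup>2) \<le> n)"
proof (induction n)
  case 0
  have "(\<Sum>b\<leftarrow>bs. (gns_seminorm \<phi> 0)\<^sup>2) = 0" if "\<phi> \<in> states" for \<phi> :: "'a \<Rightarrow> complex"
    using that by simp
  then show ?case
    by (intro exI[of _ "map (\<lambda>b. (b, 0)) bs"]) (simp add: o_def)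
next
  case (Suc n)
  then obtain zs :: "('a \<times> real) list" where zs: "map fst zs = ((split_list r t) ^^ n) bs"
    and le: "\<And>\<phi>. \<phi> \<in> states \<Longrightarrow> (\<Sum>(b, c)\<leftarrow>zs. (gns_seminorm \<phi> (b * (scaleR n s - scaleR c 1)))\<^sup>2) \<le> n"
    by blast
  have rt: "star r * r + star t * t = 1"
    unfolding r t by (rule half_sum)
  have part: "(\<Sum>b\<leftarrow>((split_list r t) ^^ m) bs. star b * b) = 1" for m
    by (induction m) (simp_all add: bs split_list_partition[OF rt])
  define zs' where "zs' = map (\<lambda>(b, c). (b * r, c + 1)) zs @ map (\<lambda>(b, c). (b * t, c - 1)) zs"
  have "map fst zs' = ((split_list r t) ^^ Suc n) bs"
    by (simp add: zs'_def split_list_def flip: zs) (simp add: o_def case_prod_unfold)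
  moreover have "(\<Sum>(b, c)\<leftarrow>zs'. (gns_seminorm \<phi> (b * (scaleR (Suc n) s - scaleR c 1)))\<^sup>2) \<le> Suc n"
    if \<phi>: "\<phi> \<in> states" for \<phi>
  proof -
    let ?d = "\<lambda>c. scaleR n s - scaleR c 1"
    have "(\<Sum>(b, c)\<leftarrow>zs'. (gns_seminorm \<phi> (b * (scaleR (Suc n) s - scaleR c 1)))\<^sup>2) =
        (\<Sum>(b, c)\<leftarrow>zs. (gns_seminorm \<phi> (b * r * (?d c + s - 1)))\<^sup>2 + (gns_seminorm \<phi> (b * t * (?d c + s + 1)))\<^sup>2)"
      by (simp add: zs'_def o_def case_prod_unfold sum_list_addf algebra_simps)
    also have "\<dots> \<le> (\<Sum>(b, c)\<leftarrow>zs. (gns_seminorm \<phi> (b * ?d c))\<^sup>2 + (gns_seminorm \<phi> b)\<^sup>2)"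
    proof (rule sum_list_mono, clarify)
      fix b c
      show "(gns_seminorm \<phi> (b * r * (?d c + s - 1)))\<^sup>2 + (gns_seminorm \<phi> (b * t * (?d c + s + 1)))\<^sup>2
          \<le> (gns_seminorm \<phi> (b * ?d c))\<^sup>2 + (gns_seminorm \<phi> b)\<^sup>2"
        by (rule random_walk_step[OF \<phi> s r t]) (simp add: star_diff star_scaleR s)
    qed
    also have "\<dots> = (\<Sum>(b, c)\<leftarrow>zs. (gns_seminorm \<phi> (b * ?d c))\<^sup>2) + (\<Sum>b\<leftarrow>map fst zs. (gns_seminorm \<phi> b)\<^sup>2)"
      by (simp add: case_prod_unfold sum_list_addf o_def)
    also have "(\<Sum>b\<leftarrow>map fst zs. (gns_seminorm \<phi> b)\<^sup>2) = Re (\<phi> (\<Sum>b\<leftarrow>map fst zs. star b * b))"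
      by (induction zs) (simp_all add: gns_seminorm_square[OF \<phi>] state_add[OF \<phi>] state_zero[OF \<phi>])
    also have "\<dots> = 1"
      unfolding zs part by (simp add: state_one[OF \<phi>])
    finally show ?thesis using le[OF \<phi>] by simp
  qed
  ultimately show ?case by blast
qed

text \<open>A law of large numbers: after \<open>n\<close> splittings along \<open>s\<close>, the
  constants \<open>c / n\<close> approximate \<open>s\<close> with total mean square at most
  \<open>n\<close> divided by the square of \<open>n\<close>. A new element is treated by splitting
  the partition found for the others.\<close>

lemma exists_fine_list:
  assumes "finite F" and sa: "\<And>y :: 'a. y \<in> F \<Longrightarrow> star y = y \<and> norm y < 1" and "e > 0"
  shows "\<exists>bs. (\<Sum>b\<leftarrow>bs. star b * b) = 1 \<and>
    (\<forall>\<phi>\<in>states. \<forall>y\<in>F. (\<Sum>b\<leftarrow>bs. local_variance \<phi> b y) \<le> e)"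
  using assms(1) sa
proof (induction F)
  case empty
  show ?case by (intro exI[of _ "[1]"]) simp
next
  case (insert s F)
  then obtain bs where bs: "(\<Sum>b\<leftarrow>bs. star b * b) = 1"
    and fine: "\<And>\<phi> y. \<phi> \<in> states \<Longrightarrow> y \<in> F \<Longrightarrow> (\<Sum>b\<leftarrow>bs. local_variance \<phi> b y) \<le> e" by auto
  have s: "star s = s" "norm s < 1" using insert.prems by auto
  \<comment> \<open>The roots of \<open>1 + s\<close> and \<open>1 - s\<close> exist because
    \<open>norm s\<close> is below 1; the factor \<open>sqrt (1/2)\<close> makes the two squares sum
    to 1.\<close>
  obtain r0 where r0: "star r0 = r0" "r0 * r0 = 1 - (- s)"
    using one_minus_eq_square[of "- s"] s by (auto simp: star_minus)
  obtain t0 where t0: "star t0 = t0" "t0 * t0 = 1 - s"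
    using one_minus_eq_square[of s] s by auto
  define r where "r = scaleR (sqrt (1/2)) r0"
  define t where "t = scaleR (sqrt (1/2)) t0"
  have r: "star r * r = scaleR (1/2) (1 + s)" and t: "star t * t = scaleR (1/2) (1 - s)"
    using r0 t0 by (simp_all add: r_def t_def star_scaleR flip: real_sqrt_mult)
  have rt: "star r * r + star t * t = 1"
    unfolding r t by (rule half_sum)
  obtain n :: nat where n: "n > 0" "1 / n \<le> e"
    using \<open>e > 0\<close> by (metis nat_approx_posE less_imp_le zero_less_Suc)
  let ?bs = "((split_list r t) ^^ n) bs"
  have "(\<Sum>b\<leftarrow>((split_list r t) ^^ m) bs. star b * b) = 1" for m
    by (induction m) (simp_all add: bs split_list_partition[OF rt])
  moreover have "(\<Sum>b\<leftarrow>((split_list r t) ^^ m) bs. local_variance \<phi> b y) \<le> (\<Sum>b\<leftarrow>bs. local_variance \<phi> b y)"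
    if "\<phi> \<in> states" for m \<phi> y
    by (induction m) (auto intro: order_trans split_list_variance[OF that rt])
  moreover have "(\<Sum>b\<leftarrow>?bs. local_variance \<phi> b s) \<le> e" if \<phi>: "\<phi> \<in> states" for \<phi>
  proof -
    obtain zs :: "('a \<times> real) list" where zs: "map fst zs = ?bs"
      and le: "\<And>\<phi>. \<phi> \<in> states \<Longrightarrow> (\<Sum>(b, c)\<leftarrow>zs. (gns_seminorm \<phi> (b * (scaleR n s - scaleR c 1)))\<^sup>2) \<le> n"
      using random_walk[OF s(1) r t bs] by metis
    have "(\<Sum>b\<leftarrow>?bs. local_variance \<phi> b s) = (\<Sum>(b, c)\<leftarrow>zs. local_variance \<phi> b s)"
      by (simp add: case_prod_unfold o_def flip: zs)
    also have "\<dots> \<le> (\<Sum>(b, c)\<leftarrow>zs. (1 / n)\<^sup>2 * (gns_seminorm \<phi> (b * (scaleR n s - scaleR c 1)))\<^sup>2)"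
    proof (rule sum_list_mono, clarify)
      fix b c
      have "scaleC (of_real n) (b * (s - scaleC (of_real (c / n)) 1)) = b * (scaleR n s - scaleR c 1)"
        using n by (simp add: scaleR_scaleC scaleC_diff_right scaleC_scaleC mult_scaleC_right right_diff_distrib)
      then have "gns_seminorm \<phi> (b * (scaleR n s - scaleR c 1)) = n * gns_seminorm \<phi> (b * (s - scaleC (of_real (c / n)) 1))"
        using gns_seminorm_scaleC[OF \<phi>, of "of_real n"] by (metis norm_of_nat of_real_of_nat_eq)
      then have "(1 / n)\<^sup>2 * (gns_seminorm \<phi> (b * (scaleR n s - scaleR c 1)))\<^sup>2 =
          (gns_seminorm \<phi> (b * (s - scaleC (of_real (c / n)) 1)))\<^sup>2"
        using n by (simp add: power_divide power_mult_distrib)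
      then show "local_variance \<phi> b s \<le> (1 / n)\<^sup>2 * (gns_seminorm \<phi> (b * (scaleR n s - scaleR c 1)))\<^sup>2"
        using local_variance_le[OF \<phi>, of b s] by simp
    qed
    also have "\<dots> = (1 / n)\<^sup>2 * (\<Sum>(b, c)\<leftarrow>zs. (gns_seminorm \<phi> (b * (scaleR n s - scaleR c 1)))\<^sup>2)"
      by (simp add: case_prod_unfold sum_list_const_mult)
    also have "\<dots> \<le> (1 / n)\<^sup>2 * n"
      by (intro mult_left_mono le \<phi>) simp
    also have "\<dots> \<le> e" using n by (simp add: power2_eq_square)
    finally show ?thesis .
  qed
  ultimately show ?case using fine by (intro exI[of _ ?bs]) (fastforce intro: order_trans)
qed

section \<open>Fine partitions for arbitrary finite sets\<close>

definition total_variance :: "('a \<Rightarrow> complex) \<Rightarrow> nat \<Rightarrow> (nat \<Rightarrow> 'a) \<Rightarrow> 'a \<Rightarrow> real" where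
  "total_variance \<phi> n b y = (\<Sum>i<n. local_variance \<phi> (b i) y)"

lemma total_variance_le:
  assumes "\<phi> \<in> states" "partition_of_unity n b"
  shows "total_variance \<phi> n b y \<le> (norm y)\<^sup>2"
proof -
  have "total_variance \<phi> n b y \<le> (\<Sum>i<n. (gns_seminorm \<phi> (b i * y))\<^sup>2)"
    unfolding total_variance_def by (intro sum_mono local_variance_le_square assms)
  also have "\<dots> = (gns_seminorm \<phi> y)\<^sup>2" by (rule gns_seminorm_partition[OF assms])
  also have "\<dots> \<le> (norm y)\<^sup>2"
    by (intro power_mono gns_seminorm_le_norm gns_seminorm_nonneg assms)
  finally show ?thesis .
qed

lemma total_variance_nonneg: "total_variance \<phi> n b y \<ge> 0"
  by (simp add: total_variance_def local_variance_def sum_nonneg)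

lemma total_variance_add:
  assumes "\<phi> \<in> states"
  shows "total_variance \<phi> n b (x + y) \<le> 2 * total_variance \<phi> n b x + 2 * total_variance \<phi> n b y"
  unfolding total_variance_def sum_distrib_left sum.distrib[symmetric]
  by (intro sum_mono local_variance_add assms)

lemma total_variance_scaleC:
  assumes "\<phi> \<in> states"
  shows "total_variance \<phi> n b (scaleC c y) = (cmod c)\<^sup>2 * total_variance \<phi> n b y"
  by (simp add: total_variance_def sum_distrib_left local_variance_scaleC[OF assms])

lemma exists_fine_partition_self_adjoint:
  assumes "finite F" and "\<And>y :: 'a. y \<in> F \<Longrightarrow> star y = y \<and> norm y < 1" and "e > 0"
  shows "\<exists>n b. partition_of_unity n b \<and> (\<forall>\<phi>\<in>states. \<forall>y\<in>F. total_variance \<phi> n b y \<le> e)"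
proof -
  obtain bs where bs: "(\<Sum>b\<leftarrow>bs. star b * b) = 1"
    "\<forall>\<phi>\<in>states. \<forall>y\<in>F. (\<Sum>b\<leftarrow>bs. local_variance \<phi> b y) \<le> e"
    using exists_fine_list[OF assms] by blast
  show ?thesis
    by (rule exI[of _ "length bs"], rule exI[of _ "\<lambda>i. bs ! i"])
       (use bs in \<open>simp_all add: partition_of_unity_def total_variance_def sum_list_sum_nth atLeast0LessThan\<close>)
qed

lemma exists_fine_partition:
  assumes "finite (F :: 'a set)" and "e > 0"
  shows "\<exists>n b. partition_of_unity n b \<and> (\<forall>\<phi>\<in>states. \<forall>y\<in>F. total_variance \<phi> n b y \<le> e)"
proof -
  \<comment> \<open>The summand 1 makes the scaled real and imaginary parts strictly shorter than 1
    and keeps the denominator positive.\<close>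
  define k where "k y = 1 / (norm y + 1)" for y :: 'a
  define re where "re y = scaleR (k y / 2) (y + star y)" for y :: 'a
  define im where "im y = scaleC (- \<i> * of_real (k y / 2)) (y - star y)" for y :: 'a
  \<comment> \<open>A common bound for all \<open>1 / k y\<close> with \<open>y\<close> in
    \<open>F\<close>, so that one tolerance \<open>e / (4 * M\<^sup>2)\<close> serves every
    \<open>y\<close>. The 4 pays for two parts, each entering with a factor 2.\<close>
  define M where "M = Max (insert 1 ((\<lambda>y. norm y + 1) ` F))"
  have pos: "norm y + 1 > 0" for y :: 'a
    using norm_ge_zero[of y] by linarith
  have kpos: "k y > 0" for y
    using pos[of y] by (simp add: k_def)
  have M: "M \<ge> 1" "\<And>y. y \<in> F \<Longrightarrow> norm y + 1 \<le> M"
    unfolding M_def by (rule Max_ge; use assms(1) in simp)+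
  have ky: "k y * norm y < 1" for y
    using pos[of y] by (simp add: k_def)
  have half: "k y / 2 * norm (y + star y) < 1" "k y / 2 * norm (y - star y) < 1" for y
  proof -
    have "k y / 2 * norm (y + star y) \<le> k y / 2 * (norm y + norm y)"
      using kpos[of y] norm_triangle_ineq[of y "star y"] by (intro mult_left_mono) simp_all
    then show "k y / 2 * norm (y + star y) < 1"
      using ky[of y] by simp
    have "k y / 2 * norm (y - star y) \<le> k y / 2 * (norm y + norm y)"
      using kpos[of y] norm_triangle_ineq4[of y "star y"] by (intro mult_left_mono) simp_all
    then show "k y / 2 * norm (y - star y) < 1"
      using ky[of y] by simp
  qed
  have "star (re y) = re y" "norm (re y) < 1" for y
    using half(1)[of y] kpos[of y]
    by (simp_all add: re_def star_scaleR star_add star_star add.commute)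
  moreover have "star (im y) = im y" for y
  proof -
    have "star (im y) = scaleC (\<i> * of_real (k y / 2)) (- (y - star y))"
      by (simp add: im_def star_scaleC star_diff star_star)
    also have "\<dots> = im y"
      unfolding im_def scaleC_minus_right mult_minus_left scaleC_minus_left ..
    finally show ?thesis .
  qed
  moreover have "norm (im y) < 1" for y
    using half(2)[of y] kpos[of y] by (simp add: im_def norm_scaleC norm_mult norm_divide)
  ultimately have unit: "star z = z \<and> norm z < 1" if "z \<in> re ` F \<union> im ` F" for z
    using that by auto
  have "finite (re ` F \<union> im ` F)"
    using assms by auto
  moreover have "e / (4 * M\<^sup>2) > 0"
    using assms M(1) by auto
  ultimately have "\<exists>n b. partition_of_unity n b \<and>
      (\<forall>\<phi>\<in>states. \<forall>y\<in>re ` F \<union> im ` F. total_variance \<phi> n b y \<le> e / (4 * M\<^sup>2))"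
    by (intro exists_fine_partition_self_adjoint unit)
  then obtain n b where part: "partition_of_unity n b"
    and fine: "\<And>\<phi> y. \<phi> \<in> states \<Longrightarrow> y \<in> re ` F \<union> im ` F \<Longrightarrow> total_variance \<phi> n b y \<le> e / (4 * M\<^sup>2)"
    by blast
  have "total_variance \<phi> n b y \<le> e" if \<phi>: "\<phi> \<in> states" and y: "y \<in> F" for \<phi> y
  proof -
    have "scaleC \<i> (im y) = scaleR (k y / 2) (y - star y)"
      by (simp add: im_def scaleC_scaleC scaleR_scaleC)
    then have "re y + scaleC \<i> (im y) = scaleR (k y / 2) ((y + star y) + (y - star y))"
      by (simp only: re_def scaleR_add_right)
    also have "(y + star y) + (y - star y) = scaleR 2 y"
      by (simp add: scaleR_2)
    finally have "scaleC (of_real (k y)) y = re y + scaleC \<i> (im y)"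
      by (simp add: scaleR_scaleC[of "k y", symmetric])
    then have "(cmod (of_real (k y)))\<^sup>2 * total_variance \<phi> n b y = total_variance \<phi> n b (re y + scaleC \<i> (im y))"
      using total_variance_scaleC[OF \<phi>] by metis
    also have "\<dots> \<le> 2 * total_variance \<phi> n b (re y) + 2 * total_variance \<phi> n b (im y)"
      using total_variance_add[OF \<phi>, of n b "re y" "scaleC \<i> (im y)"] by (simp add: total_variance_scaleC[OF \<phi>])
    also have "\<dots> \<le> e / M\<^sup>2"
      using fine[OF \<phi>, of "re y"] fine[OF \<phi>, of "im y"] y by simp
    finally have "(k y)\<^sup>2 * total_variance \<phi> n b y \<le> e / M\<^sup>2" by simp
    moreover have "M\<^sup>2 > 0" using M(1) by simp
    ultimately have "M\<^sup>2 * ((k y)\<^sup>2 * total_variance \<phi> n b y) \<le> e"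
      by (simp add: pos_le_divide_eq mult.commute)
    moreover have "1 \<le> M * k y"
      using M(2)[OF y] pos[of y] by (simp add: k_def)
    then have "1 \<le> (M * k y)\<^sup>2" by (simp add: one_le_power)
    then have "1 * total_variance \<phi> n b y \<le> (M * k y)\<^sup>2 * total_variance \<phi> n b y"
      by (rule mult_right_mono) (rule total_variance_nonneg)
    ultimately show ?thesis by (simp add: power_mult_distrib)
  qed
  with part show ?thesis by blast
qed

end

section \<open>Completely positive contractions\<close>

definition cp_contraction :: "('a::cstar_algebra \<Rightarrow> 'a) \<Rightarrow> bool" where
  "cp_contraction \<Theta> \<longleftrightarrow>
     (\<forall>a b. \<Theta> (a + b) = \<Theta> a + \<Theta> b) \<and> (\<forall>c a. \<Theta> (scaleC c a) = scaleC c (\<Theta> a)) \<and>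
     (\<forall>\<phi>\<in>states. \<forall>a u. gns_seminorm \<phi> (\<Theta> a * u) \<le> norm a * gns_seminorm \<phi> u) \<and>
     (\<forall>\<phi>\<in>states. \<forall>n X h. matrix_pos n X \<longrightarrow>
        (\<Sum>i<n. \<Sum>j<n. \<phi> (star (h i) * (\<Theta> (X i j) * h j))) \<in> \<real>\<^sub>\<ge>\<^sub>0)"

lemma nonneg_Reals_sum: "(\<And>i. i \<in> I \<Longrightarrow> f i \<in> \<real>\<^sub>\<ge>\<^sub>0) \<Longrightarrow> sum f I \<in> (\<real>\<^sub>\<ge>\<^sub>0 :: complex set)"
  by (induction I rule: infinite_finite_induct) (auto intro: nonneg_Reals_add_I)

text \<open>A form of the Schur product theorem. Each step of the induction removes from every \<open>y i\<close>
  its component along the last vector.\<close>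

lemma states_Schur_product:
  fixes \<phi> \<psi> :: "'a::cstar_algebra \<Rightarrow> complex"
  assumes \<phi>: "\<phi> \<in> states" and \<psi>: "\<psi> \<in> states"
  shows "(\<Sum>i<n::nat. \<Sum>j<n. \<phi> (star (y i) * y j) * \<psi> (star (g i) * g j)) \<in> \<real>\<^sub>\<ge>\<^sub>0"
proof (induction n arbitrary: y)
  case (Suc n)
  define m where "m = \<phi> (star (y n) * y n)"
  define t where "t i = \<phi> (star (y n) * y i) / m" for i
  define z where "z i = y i - scaleC (t i) (y n)" for i
  have m: "m = complex_of_real ((gns_seminorm \<phi> (y n))\<^sup>2)"
    unfolding m_def by (rule state_star_mult_self[OF \<phi>])
  \<comment> \<open>This includes \<open>m = 0\<close>: then \<open>t i\<close> is 0 by the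
    convention on division, and the left-hand side vanishes by Cauchy-Schwarz.\<close>
  have tm: "\<phi> (star (y n) * y i) = t i * m" for i
    using state_Cauchy_Schwarz[OF \<phi>, of "y n" "y i"] m by (cases "m = 0") (auto simp: t_def)
  have tm': "\<phi> (star (y i) * y n) = cnj (t i) * m" for i
    unfolding state_inner_cnj[OF \<phi>, of "y i" "y n"] tm by (simp add: m)
  have tn: "m = 0 \<or> t n = 1" by (simp add: t_def m_def)
  have decomp: "\<phi> (star (y i) * y j) = \<phi> (star (z i) * z j) + cnj (t i) * t j * m" for i j
    by (simp add: z_def star_diff star_scaleC left_diff_distrib right_diff_distrib mult_scaleC_left
        mult_scaleC_right scaleC_scaleC state_diff[OF \<phi>] state_scaleC[OF \<phi>] tm tm' m_def[symmetric])
       (use tn in auto)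
  have "\<phi> (star (z n) * z n) = 0"
    using decomp[of n n] by (cases "m = 0") (auto simp: m_def[symmetric] t_def m)
  then have "gns_seminorm \<phi> (z n) = 0"
    by (simp add: state_star_mult_self[OF \<phi>])
  then have zn: "\<phi> (star (z n) * z j) = 0" "\<phi> (star (z j) * z n) = 0" for j
    using state_Cauchy_Schwarz[OF \<phi>, of "z n" "z j"] state_Cauchy_Schwarz[OF \<phi>, of "z j" "z n"] by auto
  \<comment> \<open>The removed components form the rank one kernel
    \<open>cnj (t i) * t j * m\<close>; multiplied by the kernel of \<psi> it sums to
    \<open>m\<close> times the square of this one vector.\<close>
  let ?w = "\<Sum>i<Suc n. scaleC (t i) (g i)"
  have "(\<Sum>i<Suc n. \<Sum>j<Suc n. cnj (t i) * t j * \<psi> (star (g i) * g j)) = \<psi> (star ?w * ?w)"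
    unfolding star_sum sum_distrib_left sum_distrib_right state_sum[OF \<psi>]
    by (subst sum.swap) (simp only: star_scaleC mult_scaleC_left mult_scaleC_right scaleC_scaleC
        state_scaleC[OF \<psi>] mult.commute mult.left_commute)
  then have "(\<Sum>i<Suc n. \<Sum>j<Suc n. \<phi> (star (y i) * y j) * \<psi> (star (g i) * g j)) =
      (\<Sum>i<Suc n. \<Sum>j<Suc n. \<phi> (star (z i) * z j) * \<psi> (star (g i) * g j)) + m * \<psi> (star ?w * ?w)"
    by (simp only: decomp distrib_right sum.distrib sum_distrib_left[symmetric] mult.assoc
        mult.left_commute[of _ m])
  also have "(\<Sum>i<Suc n. \<Sum>j<Suc n. \<phi> (star (z i) * z j) * \<psi> (star (g i) * g j)) =
      (\<Sum>i<n. \<Sum>j<n. \<phi> (star (z i) * z j) * \<psi> (star (g i) * g j))"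
    by (simp add: zn)
  finally show ?case
    using Suc.IH[of z] state_pos[OF \<psi>, of ?w] state_pos[OF \<phi>, of "y n"]
    by (simp only: m_def nonneg_Reals_add_I nonneg_Reals_mult_I)
qed simp

text \<open>A map that factors through an n-dimensional commutative algebra: \<open>a\<close> is
  reduced to the numbers \<open>c i a\<close>, which are then spread out with the weights. With
  local means for \<open>c\<close> it plays the role of a conditional expectation.\<close>

definition partition_map :: "nat \<Rightarrow> (nat \<Rightarrow> 'a::cstar_algebra) \<Rightarrow> (nat \<Rightarrow> 'a \<Rightarrow> complex) \<Rightarrow> 'a \<Rightarrow> 'a" where
  "partition_map n b c a = (\<Sum>i<n. scaleC (c i a) (star (b i) * b i))"

lemma gns_seminorm_partition_scalars:
  assumes \<phi>: "\<phi> \<in> states" and b: "partition_of_unity n b"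
  shows "(gns_seminorm \<phi> ((\<Sum>i<n. scaleC (k i) (star (b i) * b i)) * u))\<^sup>2
    \<le> (\<Sum>i<n. (cmod (k i))\<^sup>2 * (gns_seminorm \<phi> (b i * u))\<^sup>2)"
proof -
  have "(\<Sum>i<n. scaleC (k i) (star (b i) * b i)) * u = (\<Sum>i<n. star (b i) * b i * scaleC (k i) u)"
    by (simp add: sum_distrib_right mult_scaleC_left mult_scaleC_right)
  then show ?thesis
    using gns_seminorm_partition_combination[OF \<phi> b, of "\<lambda>i. scaleC (k i) u"]
    by (simp add: mult_scaleC_right gns_seminorm_scaleC[OF \<phi>] power_mult_distrib)
qed

lemma partition_map_diff:
  assumes \<phi>: "\<phi> \<in> states" and b: "partition_of_unity n b"
  shows "(gns_seminorm \<phi> (partition_map n b c a - partition_map n b c' a'))\<^sup>2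
    \<le> (\<Sum>i<n. (cmod (c i a - c' i a'))\<^sup>2 * (gns_seminorm \<phi> (b i))\<^sup>2)"
  using gns_seminorm_partition_scalars[OF \<phi> b, of "\<lambda>i. c i a - c' i a'" 1]
  by (simp add: partition_map_def scaleC_diff_left sum_subtractf)

lemma state_partition_map:
  assumes "\<phi> \<in> states"
  shows "\<phi> (partition_map n b c a) = (\<Sum>i<n. c i a * \<phi> (star (b i) * b i))"
  by (simp add: partition_map_def state_sum[OF assms] state_scaleC[OF assms])

text \<open>For a fixed piece \<open>l\<close> and a fixed row \<open>k\<close> of \<open>Y\<close>,
  the form is the entrywise product of a Gram matrix of \<open>c l\<close> with one of \<phi>, so
  positivity is the Schur product theorem. The zero functional has to be allowed because a null
  piece carries no normalised state.\<close>

lemma cp_contraction_partition_map: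
  fixes b :: "nat \<Rightarrow> 'a::cstar_algebra"
  assumes b: "partition_of_unity n b"
    and c: "\<And>i. i < n \<Longrightarrow> c i \<in> states \<or> c i = (\<lambda>_. 0)"
  shows "cp_contraction (partition_map n b c)"
  unfolding cp_contraction_def
proof (intro conjI allI ballI impI)
  have add: "c i (x + y) = c i x + c i y" and scale: "c i (scaleC k x) = k * c i x"
    and norm: "cmod (c i x) \<le> norm x" if "i < n" for i k x y
    using c[OF that] by (auto simp: state_add state_scaleC cmod_state_le_norm)
  fix x y :: 'a
  show "partition_map n b c (x + y) = partition_map n b c x + partition_map n b c y"
    by (simp add: partition_map_def add scaleC_add_left flip: sum.distrib)
  fix k :: complex
  show "partition_map n b c (scaleC k x) = scaleC k (partition_map n b c x)"
    by (simp add: partition_map_def scale scaleC_sum_right scaleC_scaleC)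
  fix \<phi> :: "'a \<Rightarrow> complex" assume \<phi>: "\<phi> \<in> states"
  show "gns_seminorm \<phi> (partition_map n b c x * y) \<le> norm x * gns_seminorm \<phi> y"
  proof (rule power2_le_imp_le)
    have "(gns_seminorm \<phi> (partition_map n b c x * y))\<^sup>2 \<le>
        (\<Sum>i<n. (cmod (c i x))\<^sup>2 * (gns_seminorm \<phi> (b i * y))\<^sup>2)"
      unfolding partition_map_def by (rule gns_seminorm_partition_scalars[OF \<phi> b])
    also have "\<dots> \<le> (\<Sum>i<n. (norm x)\<^sup>2 * (gns_seminorm \<phi> (b i * y))\<^sup>2)"
      by (intro sum_mono mult_right_mono power_mono norm) auto
    also have "\<dots> = (norm x * gns_seminorm \<phi> y)\<^sup>2"
      by (simp add: gns_seminorm_partition[OF \<phi> b] power_mult_distrib flip: sum_distrib_left)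
    finally show "(gns_seminorm \<phi> (partition_map n b c x * y))\<^sup>2 \<le> (norm x * gns_seminorm \<phi> y)\<^sup>2" .
  qed (simp add: gns_seminorm_nonneg[OF \<phi>])
  fix N :: nat and X :: "nat \<Rightarrow> nat \<Rightarrow> 'a" and h :: "nat \<Rightarrow> 'a"
  assume "matrix_pos N X"
  then obtain Y where Y: "\<And>i j. i < N \<Longrightarrow> j < N \<Longrightarrow> X i j = (\<Sum>k<N. star (Y k i) * Y k j)"
    by (auto simp: matrix_pos_def)
  have csum: "c l (sum f {..<N}) = (\<Sum>k<N. c l (f k))" if "l < n" for l f
    using c[OF that] by (auto simp: state_sum)
  have "(\<Sum>i<N. \<Sum>j<N. \<phi> (star (h i) * (partition_map n b c (X i j) * h j))) =
      (\<Sum>i<N. \<Sum>j<N. \<Sum>l<n. \<Sum>k<N. c l (star (Y k i) * Y k j) * \<phi> (star (b l * h i) * (b l * h j)))"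
    by (simp add: partition_map_def Y csum sum_distrib_left sum_distrib_right mult_scaleC_left
        mult_scaleC_right state_sum[OF \<phi>] state_scaleC[OF \<phi>] star_mult mult.assoc)
  also have "\<dots> = (\<Sum>l<n. \<Sum>k<N. \<Sum>i<N. \<Sum>j<N. c l (star (Y k i) * Y k j) * \<phi> (star (b l * h i) * (b l * h j)))"
    unfolding sum.swap[of _ "{..<N}" "{..<n}"] by (subst (2) sum.swap) (subst (3) sum.swap, rule refl)
  also have "\<dots> \<in> \<real>\<^sub>\<ge>\<^sub>0"
  proof (rule nonneg_Reals_sum, rule nonneg_Reals_sum)
    fix l k assume "l \<in> {..<n}"
    then consider "c l \<in> states" | "c l = (\<lambda>_. 0)" using c by auto
    then show "(\<Sum>i<N. \<Sum>j<N. c l (star (Y k i) * Y k j) * \<phi> (star (b l * h i) * (b l * h j))) \<in> \<real>\<^sub>\<ge>\<^sub>0"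
      by cases (use states_Schur_product[OF _ \<phi>, of "c l" "Y k"] in auto)
  qed
  finally show "(\<Sum>i<N. \<Sum>j<N. \<phi> (star (h i) * (partition_map n b c (X i j) * h j))) \<in> \<real>\<^sub>\<ge>\<^sub>0" .
qed

text \<open>Midpoints are the only convex combinations that the parallelogram law calls for.\<close>

lemma cp_contraction_midpoint:
  fixes \<Theta> \<Theta>' :: "'a::cstar_algebra \<Rightarrow> 'a"
  assumes 1: "cp_contraction \<Theta>" and 2: "cp_contraction \<Theta>'"
  shows "cp_contraction (\<lambda>a. scaleR (1/2) (\<Theta> a + \<Theta>' a))"
  unfolding cp_contraction_def
proof (intro conjI allI ballI impI)
  fix x y :: 'a and k :: complex
  show "scaleR (1/2) (\<Theta> (x + y) + \<Theta>' (x + y)) = scaleR (1/2) (\<Theta> x + \<Theta>' x) + scaleR (1/2) (\<Theta> y + \<Theta>' y)"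
    using 1 2 by (simp add: cp_contraction_def scaleR_add_right)
  show "scaleR (1/2) (\<Theta> (scaleC k x) + \<Theta>' (scaleC k x)) = scaleC k (scaleR (1/2) (\<Theta> x + \<Theta>' x))"
    using 1 2 by (simp add: cp_contraction_def scaleR_scaleC scaleC_scaleC mult.commute flip: scaleC_add_right)
  fix \<phi> :: "'a \<Rightarrow> complex" assume \<phi>: "\<phi> \<in> states"
  have "scaleR (1/2) (\<Theta> x + \<Theta>' x) * y = scaleC (1/2) (\<Theta> x * y + \<Theta>' x * y)"
    by (simp add: scaleR_scaleC mult_scaleC_left distrib_right)
  then have "gns_seminorm \<phi> (scaleR (1/2) (\<Theta> x + \<Theta>' x) * y) = 1 / 2 * gns_seminorm \<phi> (\<Theta> x * y + \<Theta>' x * y)"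
    using gns_seminorm_scaleC[OF \<phi>, of "1/2"] by simp
  also have "\<dots> \<le> 1 / 2 * (gns_seminorm \<phi> (\<Theta> x * y) + gns_seminorm \<phi> (\<Theta>' x * y))"
    by (intro mult_left_mono gns_seminorm_triangle[OF \<phi>]) simp
  also have "\<dots> \<le> 1 / 2 * (norm x * gns_seminorm \<phi> y + norm x * gns_seminorm \<phi> y)"
    using 1 2 \<phi> by (intro mult_left_mono add_mono) (auto simp: cp_contraction_def)
  finally show "gns_seminorm \<phi> (scaleR (1/2) (\<Theta> x + \<Theta>' x) * y) \<le> norm x * gns_seminorm \<phi> y" by simp
  fix n :: nat and X :: "nat \<Rightarrow> nat \<Rightarrow> 'a" and h :: "nat \<Rightarrow> 'a"
  assume X: "matrix_pos n X"
  have "(\<Sum>i<n. \<Sum>j<n. \<phi> (star (h i) * (scaleR (1/2) (\<Theta> (X i j) + \<Theta>' (X i j)) * h j))) =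
     of_real (1/2) * ((\<Sum>i<n. \<Sum>j<n. \<phi> (star (h i) * (\<Theta> (X i j) * h j))) + (\<Sum>i<n. \<Sum>j<n. \<phi> (star (h i) * (\<Theta>' (X i j) * h j))))"
    by (simp add: scaleR_scaleC mult_scaleC_left mult_scaleC_right distrib_left distrib_right
       state_scaleC[OF \<phi>] state_add[OF \<phi>] sum.distrib sum_distrib_left sum_divide_distrib)
  also have "\<dots> \<in> \<real>\<^sub>\<ge>\<^sub>0"
    using 1 2 \<phi> X by (intro nonneg_Reals_mult_I nonneg_Reals_add_I) (auto simp: cp_contraction_def)
  finally show "(\<Sum>i<n. \<Sum>j<n. \<phi> (star (h i) * (scaleR (1/2) (\<Theta> (X i j) + \<Theta>' (X i j)) * h j))) \<in> \<real>\<^sub>\<ge>\<^sub>0" .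
qed

section \<open>Averaging over finer and finer partitions\<close>

context commutative_cstar
begin

text \<open>As the weights sum to 1, the error is the weighted combination of the local deviations
  from the means. The coisometry bound turns it into the sum of the local variances.\<close>

lemma partition_map_local_mean:
  assumes \<phi>: "\<phi> \<in> states" and b: "partition_of_unity n b"
  shows "(gns_seminorm \<phi> (partition_map n b (\<lambda>i. local_mean \<phi> (b i)) y - y))\<^sup>2 \<le> total_variance \<phi> n b (y :: 'a)"
proof -
  have "y = (\<Sum>i<n. star (b i) * b i) * y"
    using b by (simp add: partition_of_unity_def)
  then have "partition_map n b (\<lambda>i. local_mean \<phi> (b i)) y - y =
      (\<Sum>i<n. star (b i) * b i * (scaleC (local_mean \<phi> (b i) y) 1 - y))"
    by (simp add: partition_map_def right_diff_distrib sum_subtractf mult_scaleC_right sum_distrib_right)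
  then have "(gns_seminorm \<phi> (partition_map n b (\<lambda>i. local_mean \<phi> (b i)) y - y))\<^sup>2 \<le>
      (\<Sum>i<n. (gns_seminorm \<phi> (b i * (scaleC (local_mean \<phi> (b i) y) 1 - y)))\<^sup>2)"
    using gns_seminorm_partition_combination[OF \<phi> b] by simp
  also have "\<dots> = total_variance \<phi> n b y"
    by (simp add: total_variance_def local_variance_def right_diff_distrib gns_seminorm_minus_commute[OF \<phi>])
  finally show ?thesis .
qed

text \<open>The j-th partition is made fine for the elements of the dense sequence up to index j;
  the variance of the remainder \<open>y - d i\<close> is controlled by its norm. A single sequence
  thus serves all elements and all states.\<close>

lemma fine_partition_sequence:
  fixes d :: "nat \<Rightarrow> 'a"
  assumes dense: "\<And>y e. e > 0 \<Longrightarrow> \<exists>i. norm (y - d i) < e"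
  obtains n b where "\<And>j. partition_of_unity (n j) (b j)"
    and "\<And>\<phi> y :: 'a. \<phi> \<in> states \<Longrightarrow> (\<lambda>j. total_variance \<phi> (n j) (b j) y) \<longlonglongrightarrow> 0"
proof -
  have "\<forall>j. \<exists>n b. partition_of_unity n b \<and> (\<forall>\<phi>\<in>states. \<forall>y\<in>d ` {..j}. total_variance \<phi> n b y \<le> 1 / Suc j)"
    by (intro allI exists_fine_partition) auto
  then obtain n b where part: "\<And>j. partition_of_unity (n j) (b j)"
    and fine: "\<And>j \<phi> y. \<phi> \<in> states \<Longrightarrow> y \<in> d ` {..j} \<Longrightarrow> total_variance \<phi> (n j) (b j) y \<le> 1 / Suc j"
    by metis
  have "(\<lambda>j. total_variance \<phi> (n j) (b j) y) \<longlonglongrightarrow> 0" if \<phi>: "\<phi> \<in> states" for \<phi> y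
  proof (rule LIMSEQ_I)
    fix e :: real assume "e > 0"
    \<comment> \<open>The variance of a sum is bounded with factors 2, so remainder and
      \<open>d i\<close> each get \<open>e / 4\<close>.\<close>
    then obtain i where i: "norm (y - d i) < sqrt (e / 4)"
      using dense[of "sqrt (e / 4)" y] by auto
    then have "(norm (y - d i))\<^sup>2 < (sqrt (e / 4))\<^sup>2" by (intro power_strict_mono) auto
    then have small: "(norm (y - d i))\<^sup>2 < e / 4" using \<open>e > 0\<close> by simp
    obtain J :: nat where J: "1 / Suc J < e / 4"
      using nat_approx_posE[of "e / 4"] \<open>e > 0\<close> by auto
    have "norm (total_variance \<phi> (n j) (b j) y - 0) < e" if j: "j \<ge> max i J" for j
    proof -
      have "total_variance \<phi> (n j) (b j) y \<le>
          2 * total_variance \<phi> (n j) (b j) (y - d i) + 2 * total_variance \<phi> (n j) (b j) (d i)"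
        using total_variance_add[OF \<phi>, of "n j" "b j" "y - d i" "d i"] by simp
      moreover have "total_variance \<phi> (n j) (b j) (y - d i) \<le> (norm (y - d i))\<^sup>2"
        by (rule total_variance_le[OF \<phi> part])
      moreover have "total_variance \<phi> (n j) (b j) (d i) \<le> 1 / Suc j"
        using j by (intro fine[OF \<phi>]) auto
      moreover have "1 / real (Suc j) \<le> 1 / Suc J" using j by (intro divide_left_mono) auto
      ultimately have "total_variance \<phi> (n j) (b j) y < e" using small J by linarith
      then show ?thesis using total_variance_nonneg[of \<phi> "n j" "b j" y] by simp
    qed
    then show "\<exists>J. \<forall>j\<ge>J. norm (total_variance \<phi> (n j) (b j) y - 0) < e" by blast
  qed
  with part show thesis by (rule that)
qed

end

section \<open>The GNS space\<close>

context
  fixes \<alpha> :: "'a::cstar_algebra \<Rightarrow> complex"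
  assumes \<alpha>: "\<alpha> \<in> states"
begin

lemma gns_cauchyD:
  assumes "x \<in> gns_cauchy \<alpha>" "e > 0"
  obtains M where "\<And>m n. m \<ge> M \<Longrightarrow> n \<ge> M \<Longrightarrow> gns_seminorm \<alpha> (x m - x n) < e"
  using assms unfolding gns_cauchy_def by blast

lemma gns_cauchy_const [simp]: "(\<lambda>_. a) \<in> gns_cauchy \<alpha>"
  by (simp add: gns_cauchy_def \<alpha>)

lemma gns_cauchy_add:
  assumes "x \<in> gns_cauchy \<alpha>" "y \<in> gns_cauchy \<alpha>"
  shows "(\<lambda>n. x n + y n) \<in> gns_cauchy \<alpha>"
  unfolding gns_cauchy_def
proof (clarify)
  fix e :: real assume "e > 0"
  obtain M1 where M1: "\<And>m n. m \<ge> M1 \<Longrightarrow> n \<ge> M1 \<Longrightarrow> gns_seminorm \<alpha> (x m - x n) < e / 2"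
    using gns_cauchyD[OF assms(1), of "e / 2"] \<open>e > 0\<close> by auto
  obtain M2 where M2: "\<And>m n. m \<ge> M2 \<Longrightarrow> n \<ge> M2 \<Longrightarrow> gns_seminorm \<alpha> (y m - y n) < e / 2"
    using gns_cauchyD[OF assms(2), of "e / 2"] \<open>e > 0\<close> by auto
  have "gns_seminorm \<alpha> (x m + y m - (x n + y n)) < e" if "m \<ge> max M1 M2" "n \<ge> max M1 M2" for m n
  proof -
    have "gns_seminorm \<alpha> (x m + y m - (x n + y n)) \<le> gns_seminorm \<alpha> (x m - x n) + gns_seminorm \<alpha> (y m - y n)"
      using gns_seminorm_triangle[OF \<alpha>, of "x m - x n" "y m - y n"] by (simp add: algebra_simps)
    with M1[of m n] M2[of m n] that show ?thesis by simp
  qed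
  then show "\<exists>M. \<forall>m\<ge>M. \<forall>n\<ge>M. gns_seminorm \<alpha> (x m + y m - (x n + y n)) < e" by blast
qed

lemma gns_cauchy_scaleC:
  assumes "x \<in> gns_cauchy \<alpha>"
  shows "(\<lambda>n. scaleC c (x n)) \<in> gns_cauchy \<alpha>"
  unfolding gns_cauchy_def
proof (clarify)
  fix e :: real assume "e > 0"
  have c: "cmod c + 1 > 0" using norm_ge_zero[of c] by linarith
  obtain M where M: "\<And>m n. m \<ge> M \<Longrightarrow> n \<ge> M \<Longrightarrow> gns_seminorm \<alpha> (x m - x n) < e / (cmod c + 1)"
    using gns_cauchyD[OF assms, of "e / (cmod c + 1)"] \<open>e > 0\<close> c by auto
  have "gns_seminorm \<alpha> (scaleC c (x m) - scaleC c (x n)) < e" if "m \<ge> M" "n \<ge> M" for m n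
  proof -
    have "gns_seminorm \<alpha> (scaleC c (x m) - scaleC c (x n)) = cmod c * gns_seminorm \<alpha> (x m - x n)"
      by (simp add: gns_seminorm_scaleC[OF \<alpha>] flip: scaleC_diff_right)
    also have "\<dots> \<le> (cmod c + 1) * gns_seminorm \<alpha> (x m - x n)"
      by (intro mult_right_mono gns_seminorm_nonneg[OF \<alpha>]) simp
    also have "\<dots> < (cmod c + 1) * (e / (cmod c + 1))"
      using M[OF that] c by (intro mult_strict_left_mono)
    also have "\<dots> = e" using c by simp
    finally show ?thesis .
  qed
  then show "\<exists>M. \<forall>m\<ge>M. \<forall>n\<ge>M. gns_seminorm \<alpha> (scaleC c (x m) - scaleC c (x n)) < e" by blast
qed

lemma gns_cauchy_diff:
  assumes "x \<in> gns_cauchy \<alpha>" "y \<in> gns_cauchy \<alpha>"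
  shows "(\<lambda>n. x n - y n) \<in> gns_cauchy \<alpha>"
  using gns_cauchy_add[OF assms(1) gns_cauchy_scaleC[OF assms(2), of "- 1"]]
  by (simp add: scaleC_minus_left scaleC_one)

lemma gns_null_add:
  assumes "(\<lambda>n. gns_seminorm \<alpha> (x n)) \<longlonglongrightarrow> 0" "(\<lambda>n. gns_seminorm \<alpha> (y n)) \<longlonglongrightarrow> 0"
  shows "(\<lambda>n. gns_seminorm \<alpha> (x n + y n)) \<longlonglongrightarrow> 0"
proof (rule tendsto_sandwich[OF _ _ tendsto_const])
  show "(\<lambda>n. gns_seminorm \<alpha> (x n) + gns_seminorm \<alpha> (y n)) \<longlonglongrightarrow> 0"
    using tendsto_add[OF assms] by simp
qed (simp_all add: gns_seminorm_nonneg[OF \<alpha>] gns_seminorm_triangle[OF \<alpha>])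

lemma equiv_gns_equiv: "equiv (gns_cauchy \<alpha>) (gns_equiv \<alpha>)"
proof (rule equivI)
  show "gns_equiv \<alpha> \<subseteq> gns_cauchy \<alpha> \<times> gns_cauchy \<alpha>"
    by (auto simp: gns_equiv_def)
  show "refl_on (gns_cauchy \<alpha>) (gns_equiv \<alpha>)"
    by (auto simp: refl_on_def gns_equiv_def \<alpha>)
  show "sym (gns_equiv \<alpha>)"
    using gns_seminorm_minus_commute[OF \<alpha>] by (auto simp: sym_def gns_equiv_def)
  show "trans (gns_equiv \<alpha>)"
  proof (rule transI)
    fix x y z assume "(x, y) \<in> gns_equiv \<alpha>" "(y, z) \<in> gns_equiv \<alpha>"
    then show "(x, z) \<in> gns_equiv \<alpha>"
      using gns_null_add[of "\<lambda>n. x n - y n" "\<lambda>n. y n - z n"] by (auto simp: gns_equiv_def)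
  qed
qed

lemma gns_class_eq_iff:
  assumes "x \<in> gns_cauchy \<alpha>" "y \<in> gns_cauchy \<alpha>"
  shows "gns_class \<alpha> x = gns_class \<alpha> y \<longleftrightarrow> (\<lambda>n. gns_seminorm \<alpha> (x n - y n)) \<longlonglongrightarrow> 0"
  using eq_equiv_class_iff[OF equiv_gns_equiv assms] assms by (simp add: gns_class_def gns_equiv_def)

lemma gns_class_carrier [simp]: "x \<in> gns_cauchy \<alpha> \<Longrightarrow> gns_class \<alpha> x \<in> hcarrier (gns_space \<alpha>)"
  by (simp add: gns_space_def gns_class_def quotientI)

lemma gns_carrier_class:
  assumes "u \<in> hcarrier (gns_space \<alpha>)"
  shows "gns_rep_seq u \<in> gns_cauchy \<alpha>" and "gns_class \<alpha> (gns_rep_seq u) = u"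
proof -
  from assms obtain x where x: "x \<in> gns_cauchy \<alpha>" "u = gns_equiv \<alpha> `` {x}"
    by (auto simp: gns_space_def elim: quotientE)
  then have "x \<in> u" using equiv_class_self[OF equiv_gns_equiv] by blast
  then have "gns_rep_seq u \<in> u" unfolding gns_rep_seq_def by (rule someI[of "\<lambda>x. x \<in> u"])
  then have r: "(x, gns_rep_seq u) \<in> gns_equiv \<alpha>" using x by auto
  then show "gns_rep_seq u \<in> gns_cauchy \<alpha>" by (simp add: gns_equiv_def)
  show "gns_class \<alpha> (gns_rep_seq u) = u"
    using equiv_class_eq[OF equiv_gns_equiv r] x by (simp add: gns_class_def)
qed

lemma gns_carrierE:
  assumes "u \<in> hcarrier (gns_space \<alpha>)"
  obtains x where "x \<in> gns_cauchy \<alpha>" "u = gns_class \<alpha> x"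
  using gns_carrier_class[OF assms] by metis

text \<open>The choice operator returns an arbitrary representative. Its distance from
  \<open>x\<close> tends to 0, and this is what allows every operation to be computed on any given
  representative.\<close>

lemma gns_rep_seq_class:
  assumes "x \<in> gns_cauchy \<alpha>"
  shows "gns_rep_seq (gns_class \<alpha> x) \<in> gns_cauchy \<alpha>"
    and "(\<lambda>n. gns_seminorm \<alpha> (gns_rep_seq (gns_class \<alpha> x) n - x n)) \<longlonglongrightarrow> 0"
  using gns_carrier_class[OF gns_class_carrier[OF assms]] assms gns_class_eq_iff by blast+

lemma hadd_gns_class:
  assumes x: "x \<in> gns_cauchy \<alpha>" and y: "y \<in> gns_cauchy \<alpha>"
  shows "hadd (gns_space \<alpha>) (gns_class \<alpha> x) (gns_class \<alpha> y) = gns_class \<alpha> (\<lambda>n. x n + y n)"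
proof -
  let ?x = "gns_rep_seq (gns_class \<alpha> x)" and ?y = "gns_rep_seq (gns_class \<alpha> y)"
  have "(\<lambda>n. gns_seminorm \<alpha> ((?x n - x n) + (?y n - y n))) \<longlonglongrightarrow> 0"
    by (intro gns_null_add gns_rep_seq_class x y)
  then have "gns_class \<alpha> (\<lambda>n. ?x n + ?y n) = gns_class \<alpha> (\<lambda>n. x n + y n)"
    by (subst gns_class_eq_iff) (auto intro!: gns_cauchy_add gns_rep_seq_class x y simp: algebra_simps)
  then show ?thesis by (simp add: gns_space_def)
qed

lemma hscale_gns_class:
  assumes x: "x \<in> gns_cauchy \<alpha>"
  shows "hscale (gns_space \<alpha>) c (gns_class \<alpha> x) = gns_class \<alpha> (\<lambda>n. scaleC c (x n))"
proof -
  let ?x = "gns_rep_seq (gns_class \<alpha> x)"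
  have "(\<lambda>n. gns_seminorm \<alpha> (scaleC c (?x n - x n))) \<longlonglongrightarrow> 0"
    using tendsto_mult_left[OF gns_rep_seq_class(2)[OF x], of "cmod c"]
    by (simp add: gns_seminorm_scaleC[OF \<alpha>])
  then have "gns_class \<alpha> (\<lambda>n. scaleC c (?x n)) = gns_class \<alpha> (\<lambda>n. scaleC c (x n))"
    by (subst gns_class_eq_iff) (auto intro!: gns_cauchy_scaleC gns_rep_seq_class x simp: scaleC_diff_right)
  then show ?thesis by (simp add: gns_space_def)
qed

lemma gns_cauchy_seminorm_Cauchy:
  assumes "x \<in> gns_cauchy \<alpha>"
  shows "Cauchy (\<lambda>n. gns_seminorm \<alpha> (x n))"
proof (rule CauchyI)
  fix e :: real assume "e > 0"
  then obtain M where M: "\<And>m n. m \<ge> M \<Longrightarrow> n \<ge> M \<Longrightarrow> gns_seminorm \<alpha> (x m - x n) < e"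
    using gns_cauchyD[OF assms] by blast
  have "norm (gns_seminorm \<alpha> (x m) - gns_seminorm \<alpha> (x n)) < e" if "m \<ge> M" "n \<ge> M" for m n
    using M[OF that] M[OF that(2,1)] gns_seminorm_triangle[OF \<alpha>, of "x m - x n" "x n"]
      gns_seminorm_triangle[OF \<alpha>, of "x n - x m" "x m"] by simp
  then show "\<exists>M. \<forall>m\<ge>M. \<forall>n\<ge>M. norm (gns_seminorm \<alpha> (x m) - gns_seminorm \<alpha> (x n)) < e" by blast
qed

lemma gns_cauchy_bounded:
  assumes "x \<in> gns_cauchy \<alpha>"
  obtains B where "B > 0" "\<And>n. gns_seminorm \<alpha> (x n) \<le> B"
proof -
  have "Bseq (\<lambda>n. gns_seminorm \<alpha> (x n))"
    by (rule Cauchy_Bseq[OF gns_cauchy_seminorm_Cauchy[OF assms]])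
  then show thesis using that by (auto simp: Bseq_def gns_seminorm_nonneg[OF \<alpha>])
qed

lemma state_inner_diff_le:
  "cmod (\<alpha> (star y * x) - \<alpha> (star y' * x')) \<le>
    gns_seminorm \<alpha> y * gns_seminorm \<alpha> (x - x') + gns_seminorm \<alpha> (y - y') * gns_seminorm \<alpha> x'"
proof -
  have "\<alpha> (star y * x) - \<alpha> (star y' * x') = \<alpha> (star y * (x - x')) + \<alpha> (star (y - y') * x')"
    by (simp add: right_diff_distrib left_diff_distrib star_diff state_diff[OF \<alpha>])
  also have "cmod \<dots> \<le> cmod (\<alpha> (star y * (x - x'))) + cmod (\<alpha> (star (y - y') * x'))"
    by (rule norm_triangle_ineq)
  also have "\<dots> \<le> gns_seminorm \<alpha> y * gns_seminorm \<alpha> (x - x') + gns_seminorm \<alpha> (y - y') * gns_seminorm \<alpha> x'"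
    by (intro add_mono state_Cauchy_Schwarz \<alpha>)
  finally show ?thesis .
qed

text \<open>Without convergence the \<open>lim\<close> in \<open>hinner\<close> would be
  unspecified. Boundedness of Cauchy sequences reduces the claim to the two differences.\<close>

lemma gns_inner_convergent:
  assumes x: "x \<in> gns_cauchy \<alpha>" and y: "y \<in> gns_cauchy \<alpha>"
  shows "convergent (\<lambda>n. \<alpha> (star (y n) * x n))"
proof (rule Cauchy_convergent, rule CauchyI)
  fix e :: real assume "e > 0"
  obtain B where B: "B > 0" "\<And>n. gns_seminorm \<alpha> (x n) \<le> B" using gns_cauchy_bounded[OF x] by blast
  obtain C where C: "C > 0" "\<And>n. gns_seminorm \<alpha> (y n) \<le> C" using gns_cauchy_bounded[OF y] by blast
  obtain M1 where M1: "\<And>m n. m \<ge> M1 \<Longrightarrow> n \<ge> M1 \<Longrightarrow> gns_seminorm \<alpha> (x m - x n) < e / (2 * C)"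
    using gns_cauchyD[OF x, of "e / (2 * C)"] \<open>e > 0\<close> C by auto
  obtain M2 where M2: "\<And>m n. m \<ge> M2 \<Longrightarrow> n \<ge> M2 \<Longrightarrow> gns_seminorm \<alpha> (y m - y n) < e / (2 * B)"
    using gns_cauchyD[OF y, of "e / (2 * B)"] \<open>e > 0\<close> B by auto
  have "norm (\<alpha> (star (y m) * x m) - \<alpha> (star (y n) * x n)) < e"
    if "m \<ge> max M1 M2" "n \<ge> max M1 M2" for m n
  proof -
    have "norm (\<alpha> (star (y m) * x m) - \<alpha> (star (y n) * x n)) \<le>
        gns_seminorm \<alpha> (y m) * gns_seminorm \<alpha> (x m - x n) + gns_seminorm \<alpha> (y m - y n) * gns_seminorm \<alpha> (x n)"
      by (rule state_inner_diff_le)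
    also have "\<dots> \<le> C * gns_seminorm \<alpha> (x m - x n) + gns_seminorm \<alpha> (y m - y n) * B"
      using B C by (intro add_mono mult_mono) (auto simp: gns_seminorm_nonneg[OF \<alpha>] less_imp_le)
    also have "\<dots> < C * (e / (2 * C)) + (e / (2 * B)) * B"
      using M1[of m n] M2[of m n] that B C by (intro add_strict_mono mult_strict_left_mono mult_strict_right_mono) auto
    also have "\<dots> = e" using B C by simp
    finally show ?thesis .
  qed
  then show "\<exists>M. \<forall>m\<ge>M. \<forall>n\<ge>M. norm (\<alpha> (star (y m) * x m) - \<alpha> (star (y n) * x n)) < e" by blast
qed

lemma hinner_gns_class:
  assumes x: "x \<in> gns_cauchy \<alpha>" and y: "y \<in> gns_cauchy \<alpha>"
  shows "(\<lambda>n. \<alpha> (star (y n) * x n)) \<longlonglongrightarrow> hinner (gns_space \<alpha>) (gns_class \<alpha> x) (gns_class \<alpha> y)"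
proof -
  let ?x = "gns_rep_seq (gns_class \<alpha> x)" and ?y = "gns_rep_seq (gns_class \<alpha> y)"
  obtain B where B: "B > 0" "\<And>n. gns_seminorm \<alpha> (?x n) \<le> B" using gns_cauchy_bounded gns_rep_seq_class(1)[OF x] by blast
  obtain C where C: "C > 0" "\<And>n. gns_seminorm \<alpha> (y n) \<le> C" using gns_cauchy_bounded[OF y] by blast
  have "(\<lambda>n. \<alpha> (star (?y n) * ?x n)) \<longlonglongrightarrow> hinner (gns_space \<alpha>) (gns_class \<alpha> x) (gns_class \<alpha> y)"
    using gns_inner_convergent[OF gns_rep_seq_class(1)[OF x] gns_rep_seq_class(1)[OF y]]
    by (simp add: gns_space_def convergent_LIMSEQ_iff)
  moreover have "(\<lambda>n. \<alpha> (star (y n) * x n) - \<alpha> (star (?y n) * ?x n)) \<longlonglongrightarrow> 0"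
  proof (rule Lim_null_comparison)
    show "\<forall>\<^sub>F n in sequentially. norm (\<alpha> (star (y n) * x n) - \<alpha> (star (?y n) * ?x n)) \<le>
        C * gns_seminorm \<alpha> (x n - ?x n) + gns_seminorm \<alpha> (y n - ?y n) * B"
    proof (intro always_eventually allI)
      fix n
      have "gns_seminorm \<alpha> (y n) * gns_seminorm \<alpha> (x n - ?x n) + gns_seminorm \<alpha> (y n - ?y n) * gns_seminorm \<alpha> (?x n)
        \<le> C * gns_seminorm \<alpha> (x n - ?x n) + gns_seminorm \<alpha> (y n - ?y n) * B"
        using B C by (intro add_mono mult_mono) (auto simp: gns_seminorm_nonneg[OF \<alpha>] less_imp_le)
      then show "norm (\<alpha> (star (y n) * x n) - \<alpha> (star (?y n) * ?x n)) \<le>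
        C * gns_seminorm \<alpha> (x n - ?x n) + gns_seminorm \<alpha> (y n - ?y n) * B"
        using state_inner_diff_le order_trans by blast
    qed
    have "(\<lambda>n. gns_seminorm \<alpha> (x n - ?x n)) \<longlonglongrightarrow> 0" "(\<lambda>n. gns_seminorm \<alpha> (y n - ?y n)) \<longlonglongrightarrow> 0"
      using gns_rep_seq_class(2) x y gns_seminorm_minus_commute[OF \<alpha>] by auto
    then show "(\<lambda>n. C * gns_seminorm \<alpha> (x n - ?x n) + gns_seminorm \<alpha> (y n - ?y n) * B) \<longlonglongrightarrow> 0"
      by (auto intro!: tendsto_eq_intros)
  qed
  ultimately show ?thesis using tendsto_add by fastforce
qed

lemma hnorm_gns_class:
  assumes x: "x \<in> gns_cauchy \<alpha>"
  shows "(\<lambda>n. gns_seminorm \<alpha> (x n)) \<longlonglongrightarrow> hnorm (gns_space \<alpha>) (gns_class \<alpha> x)"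
  unfolding gns_seminorm_def hnorm_def by (intro tendsto_intros hinner_gns_class x)

end

section \<open>Multiplication operators on the GNS space\<close>

text \<open>These sequences represent bounded functions in the L2 space of \<alpha>: Cauchy as
  vectors and uniformly bounded as multiplication operators. The uniform bound permits termwise
  products with arbitrary Cauchy sequences.\<close>

definition gns_multiplier :: "('a::cstar_algebra \<Rightarrow> complex) \<Rightarrow> (nat \<Rightarrow> 'a) \<Rightarrow> bool" where
  "gns_multiplier \<alpha> z \<longleftrightarrow> z \<in> gns_cauchy \<alpha> \<and> (\<exists>K. \<forall>n u. gns_seminorm \<alpha> (z n * u) \<le> K * gns_seminorm \<alpha> u)"

definition gns_mult :: "('a::cstar_algebra \<Rightarrow> complex) \<Rightarrow> (nat \<Rightarrow> 'a) \<Rightarrow> (nat \<Rightarrow> 'a) set \<Rightarrow> (nat \<Rightarrow> 'a) set" where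
  "gns_mult \<alpha> z = (\<lambda>u\<in>hcarrier (gns_space \<alpha>). gns_class \<alpha> (\<lambda>n. z n * gns_rep_seq u n))"

lemma gns_rep_eq_gns_mult: "gns_rep \<alpha> a = gns_mult \<alpha> (\<lambda>_. a)"
  by (simp add: gns_rep_def gns_mult_def)

context commutative_cstar
begin

context
  fixes \<alpha> :: "'a \<Rightarrow> complex"
  assumes \<alpha>: "\<alpha> \<in> states"
begin

lemma gns_multiplier_const [simp]: "gns_multiplier \<alpha> (\<lambda>_. a)"
  using gns_seminorm_mult[OF \<alpha>] by (auto simp: gns_multiplier_def \<alpha>)

lemma gns_multiplier_bound:
  assumes "gns_multiplier \<alpha> z"
  obtains K where "K > 0" "\<And>n u. gns_seminorm \<alpha> (z n * u) \<le> K * gns_seminorm \<alpha> u"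
proof -
  obtain K where K: "\<And>n u. gns_seminorm \<alpha> (z n * u) \<le> K * gns_seminorm \<alpha> u"
    using assms by (auto simp: gns_multiplier_def)
  have "gns_seminorm \<alpha> (z n * u) \<le> max K 1 * gns_seminorm \<alpha> u" for n u
    using K[of n u] mult_right_mono[OF max.cobounded1[of K 1] gns_seminorm_nonneg[OF \<alpha>, of u]] by linarith
  then show thesis using that[of "max K 1"] by simp
qed

text \<open>The terms of \<open>x\<close> have no common bound in norm, so \<open>x n\<close> is
  replaced by one fixed \<open>x p\<close> at a cost that the operator bound of \<open>z\<close>
  controls. On the fixed factor, commutativity turns the Cauchy property of \<open>z\<close> into
  smallness.\<close>

lemma gns_multiplier_diff_small:
  assumes z: "gns_multiplier \<alpha> z" and x: "x \<in> gns_cauchy \<alpha>" and "e > 0"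
  obtains M where "\<And>k n. k \<ge> M \<Longrightarrow> n \<ge> M \<Longrightarrow> gns_seminorm \<alpha> ((z n - z k) * x n) < e"
proof -
  obtain K where K: "K > 0" "\<And>n u. gns_seminorm \<alpha> (z n * u) \<le> K * gns_seminorm \<alpha> u"
    using gns_multiplier_bound[OF z] by blast
  obtain p where p: "\<And>m n. m \<ge> p \<Longrightarrow> n \<ge> p \<Longrightarrow> gns_seminorm \<alpha> (x m - x n) < e / (4 * K)"
    using gns_cauchyD[OF \<alpha> x, of "e / (4 * K)"] \<open>e > 0\<close> K by auto
  \<comment> \<open>The summand 1 makes \<open>c\<close> a legitimate divisor when
    \<open>x p\<close> is 0.\<close>
  define c where "c = norm (x p) + 1"
  have c: "c > 0" "norm (x p) \<le> c"
    using norm_ge_zero[of "x p"] by (simp_all add: c_def add_nonneg_pos)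
  obtain q where q: "\<And>m n. m \<ge> q \<Longrightarrow> n \<ge> q \<Longrightarrow> gns_seminorm \<alpha> (z m - z n) < e / (2 * c)"
    using gns_cauchyD[OF \<alpha>, of z "e / (2 * c)"] z \<open>e > 0\<close> c by (auto simp: gns_multiplier_def)
  have "gns_seminorm \<alpha> ((z n - z k) * x n) < e" if "k \<ge> max p q" "n \<ge> max p q" for k n
  proof -
    have eq: "(z n - z k) * x n = z n * (x n - x p) + (z k * (x p - x n) + (z n - z k) * x p)"
      by (simp add: algebra_simps)
    have "gns_seminorm \<alpha> ((z n - z k) * x n) \<le> gns_seminorm \<alpha> (z n * (x n - x p)) +
        (gns_seminorm \<alpha> (z k * (x p - x n)) + gns_seminorm \<alpha> ((z n - z k) * x p))"
      unfolding eq
      using gns_seminorm_triangle[OF \<alpha>, of "z n * (x n - x p)" "z k * (x p - x n) + (z n - z k) * x p"]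
        gns_seminorm_triangle[OF \<alpha>, of "z k * (x p - x n)" "(z n - z k) * x p"] by linarith
    also have "\<dots> \<le> K * gns_seminorm \<alpha> (x n - x p) + (K * gns_seminorm \<alpha> (x p - x n) + norm (x p) * gns_seminorm \<alpha> (z n - z k))"
      by (intro add_mono K gns_seminorm_mult_right[OF \<alpha>])
    also have "\<dots> \<le> K * gns_seminorm \<alpha> (x n - x p) + (K * gns_seminorm \<alpha> (x p - x n) + c * gns_seminorm \<alpha> (z n - z k))"
      by (intro add_left_mono mult_right_mono gns_seminorm_nonneg[OF \<alpha>] c)
    also have "\<dots> < K * (e / (4 * K)) + (K * (e / (4 * K)) + c * (e / (2 * c)))"
      using that K c by (intro add_strict_mono mult_strict_left_mono p q) auto
    also have "\<dots> = e" using K c by simp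
    finally show ?thesis .
  qed
  then show thesis using that by blast
qed

lemma gns_mult_cauchy:
  assumes z: "gns_multiplier \<alpha> z" and x: "x \<in> gns_cauchy \<alpha>"
  shows "(\<lambda>n. z n * x n) \<in> gns_cauchy \<alpha>"
  unfolding gns_cauchy_def
proof clarify
  fix e :: real assume "e > 0"
  obtain K where K: "K > 0" "\<And>n u. gns_seminorm \<alpha> (z n * u) \<le> K * gns_seminorm \<alpha> u"
    using gns_multiplier_bound[OF z] by blast
  obtain p where p: "\<And>m n. m \<ge> p \<Longrightarrow> n \<ge> p \<Longrightarrow> gns_seminorm \<alpha> (x m - x n) < e / (2 * K)"
    using gns_cauchyD[OF \<alpha> x, of "e / (2 * K)"] \<open>e > 0\<close> K by auto
  obtain q where q: "\<And>k n. k \<ge> q \<Longrightarrow> n \<ge> q \<Longrightarrow> gns_seminorm \<alpha> ((z n - z k) * x n) < e / 2"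
    using gns_multiplier_diff_small[OF z x, of "e / 2"] \<open>e > 0\<close> by auto
  have "gns_seminorm \<alpha> (z m * x m - z n * x n) < e" if "m \<ge> max p q" "n \<ge> max p q" for m n
  proof -
    have "z m * x m - z n * x n = (z m - z n) * x m + z n * (x m - x n)"
      by (simp add: algebra_simps)
    then have "gns_seminorm \<alpha> (z m * x m - z n * x n) \<le> gns_seminorm \<alpha> ((z m - z n) * x m) + gns_seminorm \<alpha> (z n * (x m - x n))"
      using gns_seminorm_triangle[OF \<alpha>] by metis
    also have "\<dots> \<le> gns_seminorm \<alpha> ((z m - z n) * x m) + K * gns_seminorm \<alpha> (x m - x n)"
      by (intro add_left_mono K)
    also have "\<dots> < e / 2 + K * (e / (2 * K))"
      using that K by (intro add_strict_mono mult_strict_left_mono p q) auto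
    also have "\<dots> = e" using K by simp
    finally show ?thesis .
  qed
  then show "\<exists>M. \<forall>m\<ge>M. \<forall>n\<ge>M. gns_seminorm \<alpha> (z m * x m - z n * x n) < e" by blast
qed

text \<open>Again \<open>x\<close> is frozen at one term. Applied to the difference of two
  multipliers, it shows that the operator depends only on the limit vector of the
  multiplier.\<close>

lemma gns_mult_null:
  assumes bound: "\<And>n u. gns_seminorm \<alpha> (w n * u) \<le> K * gns_seminorm \<alpha> u"
    and null: "(\<lambda>n. gns_seminorm \<alpha> (w n)) \<longlonglongrightarrow> 0" and x: "x \<in> gns_cauchy \<alpha>"
  shows "(\<lambda>n. gns_seminorm \<alpha> (w n * x n)) \<longlonglongrightarrow> 0"
proof -
  have "w \<in> gns_cauchy \<alpha>"
    unfolding gns_cauchy_def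
  proof clarify
    fix e :: real assume "e > 0"
    then obtain M where M: "\<And>n. n \<ge> M \<Longrightarrow> norm (gns_seminorm \<alpha> (w n) - 0) < e / 2"
      using LIMSEQ_D[OF null, of "e / 2"] by auto
    have "gns_seminorm \<alpha> (w m - w n) < e" if "m \<ge> M" "n \<ge> M" for m n
      using M[OF that(1)] M[OF that(2)] gns_seminorm_triangle[OF \<alpha>, of "w m" "- w n"]
      by (simp add: gns_seminorm_minus[OF \<alpha>])
    then show "\<exists>M. \<forall>m\<ge>M. \<forall>n\<ge>M. gns_seminorm \<alpha> (w m - w n) < e" by blast
  qed
  then have w: "gns_multiplier \<alpha> w" using bound by (auto simp: gns_multiplier_def)
  show ?thesis
  proof (rule LIMSEQ_I)
    fix e :: real assume "e > 0"
    obtain B where B: "B > 0" "\<And>n. gns_seminorm \<alpha> (x n) \<le> B" using gns_cauchy_bounded[OF \<alpha> x] by blast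
    obtain K' where K': "K' > 0" "\<And>n u. gns_seminorm \<alpha> (w n * u) \<le> K' * gns_seminorm \<alpha> u"
      using gns_multiplier_bound[OF w] by blast
    obtain p where p: "\<And>m n. m \<ge> p \<Longrightarrow> n \<ge> p \<Longrightarrow> gns_seminorm \<alpha> (x m - x n) < e / (2 * K')"
      using gns_cauchyD[OF \<alpha> x, of "e / (2 * K')"] \<open>e > 0\<close> K' by auto
    define c where "c = norm (x p) + 1"
    have c: "c > 0" "norm (x p) \<le> c"
      using norm_ge_zero[of "x p"] by (simp_all add: c_def add_nonneg_pos)
    obtain q where q: "\<And>n. n \<ge> q \<Longrightarrow> gns_seminorm \<alpha> (w n) < e / (2 * c)"
      using LIMSEQ_D[OF null, of "e / (2 * c)"] \<open>e > 0\<close> c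
      by (auto simp: gns_seminorm_nonneg[OF \<alpha>])
    have "gns_seminorm \<alpha> (w n * x n) < e" if "n \<ge> max p q" for n
    proof -
      have "gns_seminorm \<alpha> (w n * x n) \<le> gns_seminorm \<alpha> (w n * (x n - x p)) + gns_seminorm \<alpha> (w n * x p)"
        using gns_seminorm_triangle[OF \<alpha>, of "w n * (x n - x p)" "w n * x p"] by (simp add: algebra_simps)
      also have "\<dots> \<le> K' * gns_seminorm \<alpha> (x n - x p) + norm (x p) * gns_seminorm \<alpha> (w n)"
        by (intro add_mono K' gns_seminorm_mult_right[OF \<alpha>])
      also have "\<dots> \<le> K' * gns_seminorm \<alpha> (x n - x p) + c * gns_seminorm \<alpha> (w n)"
        by (intro add_left_mono mult_right_mono gns_seminorm_nonneg[OF \<alpha>] c)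
      also have "\<dots> < K' * (e / (2 * K')) + c * (e / (2 * c))"
        using that K' c by (intro add_strict_mono mult_strict_left_mono p q) auto
      also have "\<dots> = e" using K' c by simp
      finally show ?thesis .
    qed
    then show "\<exists>M. \<forall>n\<ge>M. norm (gns_seminorm \<alpha> (w n * x n) - 0) < e"
      by (auto simp: gns_seminorm_nonneg[OF \<alpha>] intro!: exI[of _ "max p q"])
  qed
qed

lemma gns_mult_class:
  assumes z: "gns_multiplier \<alpha> z" and x: "x \<in> gns_cauchy \<alpha>"
  shows "gns_mult \<alpha> z (gns_class \<alpha> x) = gns_class \<alpha> (\<lambda>n. z n * x n)"
proof -
  let ?x = "gns_rep_seq (gns_class \<alpha> x)"
  obtain K where K: "K > 0" "\<And>n u. gns_seminorm \<alpha> (z n * u) \<le> K * gns_seminorm \<alpha> u"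
    using gns_multiplier_bound[OF z] by blast
  have "(\<lambda>n. gns_seminorm \<alpha> (z n * ?x n - z n * x n)) \<longlonglongrightarrow> 0"
  proof (rule tendsto_sandwich[OF _ _ tendsto_const])
    show "(\<lambda>n. K * gns_seminorm \<alpha> (?x n - x n)) \<longlonglongrightarrow> 0"
      using tendsto_mult_left[OF gns_rep_seq_class(2)[OF \<alpha> x], of K] by simp
    show "\<forall>\<^sub>F n in sequentially. gns_seminorm \<alpha> (z n * ?x n - z n * x n) \<le> K * gns_seminorm \<alpha> (?x n - x n)"
      using K(2) by (simp flip: right_diff_distrib)
  qed (simp add: gns_seminorm_nonneg[OF \<alpha>])
  then have "gns_class \<alpha> (\<lambda>n. z n * ?x n) = gns_class \<alpha> (\<lambda>n. z n * x n)"
    by (subst gns_class_eq_iff[OF \<alpha>]) (auto intro!: gns_mult_cauchy z x gns_rep_seq_class[OF \<alpha>])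
  then show ?thesis by (simp add: gns_mult_def \<alpha> x)
qed

lemma gns_mult_carrier:
  assumes "gns_multiplier \<alpha> z" "u \<in> hcarrier (gns_space \<alpha>)"
  shows "gns_mult \<alpha> z u \<in> hcarrier (gns_space \<alpha>)"
proof -
  obtain x where "x \<in> gns_cauchy \<alpha>" "u = gns_class \<alpha> x" using gns_carrierE[OF \<alpha> assms(2)] by blast
  then show ?thesis
    using assms(1) by (simp add: gns_mult_class gns_mult_cauchy gns_class_carrier[OF \<alpha>])
qed

lemma gns_mult_bounded_ops:
  assumes z: "gns_multiplier \<alpha> z"
  shows "gns_mult \<alpha> z \<in> bounded_ops (gns_space \<alpha>)"
proof -
  obtain K where K: "K > 0" "\<And>n u. gns_seminorm \<alpha> (z n * u) \<le> K * gns_seminorm \<alpha> u"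
    using gns_multiplier_bound[OF z] by blast
  have "gns_mult \<alpha> z \<in> hcarrier (gns_space \<alpha>) \<rightarrow>\<^sub>E hcarrier (gns_space \<alpha>)"
    using gns_mult_carrier[OF z] by (auto simp: gns_mult_def)
  moreover have "gns_mult \<alpha> z (hadd (gns_space \<alpha>) u v) = hadd (gns_space \<alpha>) (gns_mult \<alpha> z u) (gns_mult \<alpha> z v)"
    if "u \<in> hcarrier (gns_space \<alpha>)" "v \<in> hcarrier (gns_space \<alpha>)" for u v
    using that by (auto elim!: gns_carrierE[OF \<alpha>] simp: hadd_gns_class[OF \<alpha>] gns_mult_class[OF z]
        gns_mult_cauchy[OF z] gns_cauchy_add[OF \<alpha>] distrib_left)
  moreover have "gns_mult \<alpha> z (hscale (gns_space \<alpha>) c u) = hscale (gns_space \<alpha>) c (gns_mult \<alpha> z u)"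
    if "u \<in> hcarrier (gns_space \<alpha>)" for c u
    using that by (auto elim!: gns_carrierE[OF \<alpha>] simp: hscale_gns_class[OF \<alpha>] gns_mult_class[OF z]
        gns_mult_cauchy[OF z] gns_cauchy_scaleC[OF \<alpha>] mult_scaleC_right)
  moreover have "hnorm (gns_space \<alpha>) (gns_mult \<alpha> z u) \<le> K * hnorm (gns_space \<alpha>) u"
    if u: "u \<in> hcarrier (gns_space \<alpha>)" for u
  proof -
    obtain x where x: "x \<in> gns_cauchy \<alpha>" "u = gns_class \<alpha> x" using gns_carrierE[OF \<alpha> u] by blast
    have "(\<lambda>n. gns_seminorm \<alpha> (z n * x n)) \<longlonglongrightarrow> hnorm (gns_space \<alpha>) (gns_mult \<alpha> z u)"
      using hnorm_gns_class[OF \<alpha> gns_mult_cauchy[OF z x(1)]] by (simp add: x gns_mult_class[OF z])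
    moreover have "(\<lambda>n. K * gns_seminorm \<alpha> (x n)) \<longlonglongrightarrow> K * hnorm (gns_space \<alpha>) u"
      using hnorm_gns_class[OF \<alpha> x(1)] unfolding x(2) by (rule tendsto_mult_left)
    ultimately show ?thesis by (rule LIMSEQ_le) (use K in auto)
  qed
  then have "\<exists>K. \<forall>u\<in>hcarrier (gns_space \<alpha>). hnorm (gns_space \<alpha>) (gns_mult \<alpha> z u) \<le> K * hnorm (gns_space \<alpha>) u"
    by (intro exI[of _ K] ballI)
  ultimately show ?thesis by (simp add: bounded_ops_def)
qed

lemma gns_mult_cong:
  assumes z: "gns_multiplier \<alpha> z" and w: "gns_multiplier \<alpha> w"
    and null: "(\<lambda>n. gns_seminorm \<alpha> (z n - w n)) \<longlonglongrightarrow> 0"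
  shows "gns_mult \<alpha> z = gns_mult \<alpha> w"
proof
  fix u
  show "gns_mult \<alpha> z u = gns_mult \<alpha> w u"
  proof (cases "u \<in> hcarrier (gns_space \<alpha>)")
    case True
    then obtain x where x: "x \<in> gns_cauchy \<alpha>" "u = gns_class \<alpha> x" using gns_carrierE[OF \<alpha>] by blast
    obtain K where K: "K > 0" "\<And>n u. gns_seminorm \<alpha> (z n * u) \<le> K * gns_seminorm \<alpha> u"
      using gns_multiplier_bound[OF z] by blast
    obtain L where L: "L > 0" "\<And>n u. gns_seminorm \<alpha> (w n * u) \<le> L * gns_seminorm \<alpha> u"
      using gns_multiplier_bound[OF w] by blast
    have "gns_seminorm \<alpha> ((z n - w n) * u) \<le> (K + L) * gns_seminorm \<alpha> u" for n u
      using gns_seminorm_triangle[OF \<alpha>, of "z n * u" "- (w n * u)"] K(2)[of n u] L(2)[of n u]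
      by (simp add: gns_seminorm_minus[OF \<alpha>] algebra_simps)
    then have "(\<lambda>n. gns_seminorm \<alpha> ((z n - w n) * x n)) \<longlonglongrightarrow> 0"
      by (rule gns_mult_null[OF _ null x(1)])
    then show ?thesis
      by (simp add: x gns_mult_class z w gns_class_eq_iff[OF \<alpha>] gns_mult_cauchy left_diff_distrib)
  qed (simp add: gns_mult_def)
qed

text \<open>A multiplication operator is a strong limit of the operators \<open>gns_rep \<alpha> (z k)\<close>.\<close>

lemma gns_mult_bicommutant:
  assumes z: "gns_multiplier \<alpha> z"
  shows "gns_mult \<alpha> z \<in> bicommutant (gns_space \<alpha>) (range (gns_rep \<alpha>))"
proof -
  let ?H = "gns_space \<alpha>"
  have "compose (hcarrier ?H) (gns_mult \<alpha> z) T = compose (hcarrier ?H) T (gns_mult \<alpha> z)"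
    if T: "T \<in> commutant ?H (range (gns_rep \<alpha>))" for T
  proof
    fix u
    show "compose (hcarrier ?H) (gns_mult \<alpha> z) T u = compose (hcarrier ?H) T (gns_mult \<alpha> z) u"
    proof (cases "u \<in> hcarrier ?H")
      case u: True
      have Tc: "T v \<in> hcarrier ?H" if "v \<in> hcarrier ?H" for v
        using T that by (auto simp: commutant_def bounded_ops_def)
      have Tadd: "T (hadd ?H v w) = hadd ?H (T v) (T w)" if "v \<in> hcarrier ?H" "w \<in> hcarrier ?H" for v w
        using T that by (auto simp: commutant_def bounded_ops_def)
      obtain K0 where K0: "\<And>v. v \<in> hcarrier ?H \<Longrightarrow> hnorm ?H (T v) \<le> K0 * hnorm ?H v"
        using T unfolding commutant_def bounded_ops_def by blast
      \<comment> \<open>Taken positive because tolerances are divided by it.\<close>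
      define K where "K = max K0 1"
      obtain x where x: "x \<in> gns_cauchy \<alpha>" "u = gns_class \<alpha> x" using gns_carrierE[OF \<alpha> u] by blast
      obtain y where y: "y \<in> gns_cauchy \<alpha>" "T u = gns_class \<alpha> y" using gns_carrierE[OF \<alpha> Tc[OF u]] by blast
      define zx where "zx n = z n * x n" for n
      have zx: "zx \<in> gns_cauchy \<alpha>" unfolding zx_def by (rule gns_mult_cauchy[OF z x(1)])
      obtain w where w: "w \<in> gns_cauchy \<alpha>" "T (gns_class \<alpha> zx) = gns_class \<alpha> w"
        using gns_carrierE[OF \<alpha> Tc] gns_class_carrier[OF \<alpha> zx] by metis
      \<comment> \<open>To compare \<open>T\<close> after \<open>z\<close> with \<open>z\<close>
        after \<open>T\<close>, the sequence \<open>z\<close> is replaced by a single element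
        \<open>z k\<close>, with which \<open>T\<close> commutes. The error \<open>r\<close> is
        small before \<open>T\<close> is applied, and boundedness of \<open>T\<close> keeps it
        small; the other error is \<open>(z n - z k) * y n\<close>.\<close>
      have key: "\<forall>\<^sub>F n in sequentially. gns_seminorm \<alpha> (w n - z n * y n) < e" if "e > 0" for e
      proof -
        have "K > 0" by (simp add: K_def)
        obtain p where p: "\<And>k n. k \<ge> p \<Longrightarrow> n \<ge> p \<Longrightarrow> gns_seminorm \<alpha> ((z n - z k) * x n) < e / (4 * K)"
          using gns_multiplier_diff_small[OF z x(1), of "e / (4 * K)"] \<open>e > 0\<close> \<open>K > 0\<close> by auto
        obtain q where q: "\<And>k n. k \<ge> q \<Longrightarrow> n \<ge> q \<Longrightarrow> gns_seminorm \<alpha> ((z n - z k) * y n) < e / 4"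
          using gns_multiplier_diff_small[OF z y(1), of "e / 4"] \<open>e > 0\<close> by auto
        define k where "k = max p q"
        define r where "r n = (z n - z k) * x n" for n
        have zkx: "(\<lambda>n. z k * x n) \<in> gns_cauchy \<alpha>" and zky: "(\<lambda>n. z k * y n) \<in> gns_cauchy \<alpha>"
          using gns_mult_cauchy[OF gns_multiplier_const] x y by auto
        have r: "r \<in> gns_cauchy \<alpha>"
          using gns_cauchy_diff[OF \<alpha> zx zkx] by (simp add: r_def[abs_def] zx_def left_diff_distrib)
        obtain v where v: "v \<in> gns_cauchy \<alpha>" "T (gns_class \<alpha> r) = gns_class \<alpha> v"
          using gns_carrierE[OF \<alpha> Tc] gns_class_carrier[OF \<alpha> r] by metis
        have "compose (hcarrier ?H) T (gns_rep \<alpha> (z k)) u = compose (hcarrier ?H) (gns_rep \<alpha> (z k)) T u"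
          using T by (auto simp: commutant_def)
        then have "T (gns_rep \<alpha> (z k) u) = gns_rep \<alpha> (z k) (T u)"
          using u by (simp add: compose_eq)
        then have "T (gns_mult \<alpha> (\<lambda>_. z k) (gns_class \<alpha> x)) = gns_mult \<alpha> (\<lambda>_. z k) (gns_class \<alpha> y)"
          unfolding gns_rep_eq_gns_mult y(2) unfolding x(2) .
        then have Tzk: "T (gns_class \<alpha> (\<lambda>n. z k * x n)) = gns_class \<alpha> (\<lambda>n. z k * y n)"
          by (simp add: gns_mult_class x(1) y(1))
        have "gns_class \<alpha> zx = hadd ?H (gns_class \<alpha> (\<lambda>n. z k * x n)) (gns_class \<alpha> r)"
          by (simp add: hadd_gns_class[OF \<alpha> zkx r]) (simp add: r_def zx_def[abs_def] left_diff_distrib)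
        then have "gns_class \<alpha> w = hadd ?H (gns_class \<alpha> (\<lambda>n. z k * y n)) (gns_class \<alpha> v)"
          using Tadd[OF gns_class_carrier[OF \<alpha> zkx] gns_class_carrier[OF \<alpha> r]] w(2) v(2) Tzk by simp
        also have "\<dots> = gns_class \<alpha> (\<lambda>n. z k * y n + v n)" by (rule hadd_gns_class[OF \<alpha> zky v(1)])
        finally have lim1: "(\<lambda>n. gns_seminorm \<alpha> (w n - (z k * y n + v n))) \<longlonglongrightarrow> 0"
          using gns_class_eq_iff[OF \<alpha> w(1) gns_cauchy_add[OF \<alpha> zky v(1)]] by simp
        have lim2: "(\<lambda>n. gns_seminorm \<alpha> (v n)) \<longlonglongrightarrow> hnorm ?H (gns_class \<alpha> v)"
          by (rule hnorm_gns_class[OF \<alpha> v(1)])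
        have "hnorm ?H (gns_class \<alpha> r) \<le> e / (4 * K)"
          by (rule LIMSEQ_le_const2[OF hnorm_gns_class[OF \<alpha> r]])
             (use p in \<open>auto simp: r_def k_def intro!: exI[of _ p] less_imp_le\<close>)
        moreover have "hnorm ?H (gns_class \<alpha> r) \<ge> 0"
          by (rule LIMSEQ_le_const[OF hnorm_gns_class[OF \<alpha> r]]) (simp add: gns_seminorm_nonneg[OF \<alpha>])
        ultimately have "hnorm ?H (gns_class \<alpha> v) \<le> K * (e / (4 * K))"
          using K0[OF gns_class_carrier[OF \<alpha> r]] v(2) \<open>K > 0\<close>
          by (smt (verit, best) K_def mult_left_mono mult_right_mono)
        then have "hnorm ?H (gns_class \<alpha> v) < e / 2" using \<open>K > 0\<close> \<open>e > 0\<close> by simp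
        then have "\<forall>\<^sub>F n in sequentially. gns_seminorm \<alpha> (v n) < e / 2"
          by (rule order_tendstoD(2)[OF lim2])
        moreover have "\<forall>\<^sub>F n in sequentially. gns_seminorm \<alpha> (w n - (z k * y n + v n)) < e / 4"
          using \<open>e > 0\<close> by (intro order_tendstoD(2)[OF lim1]) simp
        moreover have "\<forall>\<^sub>F n in sequentially. n \<ge> k" by simp
        ultimately show ?thesis
        proof eventually_elim
          case (elim n)
          have eq: "w n - z n * y n = (w n - (z k * y n + v n)) + (v n + - ((z n - z k) * y n))"
            by (simp add: algebra_simps)
          have "gns_seminorm \<alpha> (w n - z n * y n) \<le> gns_seminorm \<alpha> (w n - (z k * y n + v n)) +
              (gns_seminorm \<alpha> (v n) + gns_seminorm \<alpha> (- ((z n - z k) * y n)))"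
            unfolding eq
            using gns_seminorm_triangle[OF \<alpha>, of "w n - (z k * y n + v n)" "v n + - ((z n - z k) * y n)"]
              gns_seminorm_triangle[OF \<alpha>, of "v n" "- ((z n - z k) * y n)"] by linarith
          moreover have "gns_seminorm \<alpha> (- ((z n - z k) * y n)) < e / 4"
            using q[of k n] elim by (simp add: gns_seminorm_minus[OF \<alpha>] k_def)
          ultimately show ?case using elim by simp
        qed
      qed
      have "(\<lambda>n. gns_seminorm \<alpha> (w n - z n * y n)) \<longlonglongrightarrow> 0"
        by (rule order_tendstoI)
           (auto intro: key simp: less_le_trans[OF _ gns_seminorm_nonneg[OF \<alpha>]])
      then have "gns_class \<alpha> w = gns_class \<alpha> (\<lambda>n. z n * y n)"
        by (simp add: gns_class_eq_iff[OF \<alpha>] w(1) gns_mult_cauchy[OF z] y(1))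
      also have "\<dots> = gns_mult \<alpha> z (T u)"
        unfolding y(2) by (rule gns_mult_class[OF z y(1), symmetric])
      also have "gns_class \<alpha> w = T (gns_mult \<alpha> z u)"
        unfolding w(2)[symmetric] x(2) gns_mult_class[OF z x(1)] zx_def[abs_def] ..
      finally show ?thesis using u by (simp add: compose_eq)
    qed (simp add: compose_def)
  qed
  then show ?thesis
    using gns_mult_bounded_ops[OF z] by (auto simp: bicommutant_def commutant_def)
qed

end

end

lemma cp_contraction_add: "cp_contraction \<Theta> \<Longrightarrow> \<Theta> (a + b) = \<Theta> a + \<Theta> b"
  and cp_contraction_scaleC: "cp_contraction \<Theta> \<Longrightarrow> \<Theta> (scaleC c a) = scaleC c (\<Theta> a)"
  and cp_contraction_bound: "cp_contraction \<Theta> \<Longrightarrow> \<phi> \<in> states \<Longrightarrow> gns_seminorm \<phi> (\<Theta> a * u) \<le> norm a * gns_seminorm \<phi> u"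
  and cp_contraction_positive: "cp_contraction \<Theta> \<Longrightarrow> \<phi> \<in> states \<Longrightarrow> matrix_pos n X \<Longrightarrow>
     (\<Sum>i<n. \<Sum>j<n. \<phi> (star (h i) * (\<Theta> (X i j) * h j))) \<in> \<real>\<^sub>\<ge>\<^sub>0"
  by (simp_all add: cp_contraction_def)

lemma cp_contraction_diff: "cp_contraction \<Theta> \<Longrightarrow> \<Theta> (a - b) = \<Theta> a - \<Theta> b"
  using cp_contraction_add[of \<Theta> "a - b" b] by simp

lemma cp_contraction_le_norm: "cp_contraction \<Theta> \<Longrightarrow> \<phi> \<in> states \<Longrightarrow> gns_seminorm \<phi> (\<Theta> a) \<le> norm a"
  using cp_contraction_bound[of \<Theta> \<phi> a 1] by simp

lemma matrix_pos_1: "matrix_pos 1 (\<lambda>_ _. star a * a)"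
  unfolding matrix_pos_def by (intro exI[of _ "\<lambda>_ _. a"]) simp

section \<open>Dilation maps as limits of completely positive contractions\<close>

context
  fixes \<alpha> :: "'a::cstar_algebra \<Rightarrow> complex"
  assumes \<alpha>: "\<alpha> \<in> states"
begin

lemma hinner_gns_hadd:
  assumes "u \<in> hcarrier (gns_space \<alpha>)" "v \<in> hcarrier (gns_space \<alpha>)" "w \<in> hcarrier (gns_space \<alpha>)"
  shows "hinner (gns_space \<alpha>) (hadd (gns_space \<alpha>) u v) w = hinner (gns_space \<alpha>) u w + hinner (gns_space \<alpha>) v w"
proof -
  obtain x where x: "x \<in> gns_cauchy \<alpha>" "u = gns_class \<alpha> x" using gns_carrierE[OF \<alpha> assms(1)] by blast
  obtain y where y: "y \<in> gns_cauchy \<alpha>" "v = gns_class \<alpha> y" using gns_carrierE[OF \<alpha> assms(2)] by blast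
  obtain z where z: "z \<in> gns_cauchy \<alpha>" "w = gns_class \<alpha> z" using gns_carrierE[OF \<alpha> assms(3)] by blast
  have "(\<lambda>n. \<alpha> (star (z n) * (x n + y n))) \<longlonglongrightarrow> hinner (gns_space \<alpha>) (hadd (gns_space \<alpha>) u v) w"
    using hinner_gns_class[OF \<alpha> gns_cauchy_add[OF \<alpha> x(1) y(1)] z(1)] by (simp add: x y z hadd_gns_class[OF \<alpha>])
  moreover have "(\<lambda>n. \<alpha> (star (z n) * (x n + y n))) \<longlonglongrightarrow> hinner (gns_space \<alpha>) u w + hinner (gns_space \<alpha>) v w"
    using tendsto_add[OF hinner_gns_class[OF \<alpha> x(1) z(1)] hinner_gns_class[OF \<alpha> y(1) z(1)]]
    by (simp add: x y z distrib_left state_add[OF \<alpha>])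
  ultimately show ?thesis by (rule LIMSEQ_unique)
qed

lemma hinner_gns_hscale:
  assumes "u \<in> hcarrier (gns_space \<alpha>)" "w \<in> hcarrier (gns_space \<alpha>)"
  shows "hinner (gns_space \<alpha>) (hscale (gns_space \<alpha>) c u) w = c * hinner (gns_space \<alpha>) u w"
proof -
  obtain x where x: "x \<in> gns_cauchy \<alpha>" "u = gns_class \<alpha> x" using gns_carrierE[OF \<alpha> assms(1)] by blast
  obtain z where z: "z \<in> gns_cauchy \<alpha>" "w = gns_class \<alpha> z" using gns_carrierE[OF \<alpha> assms(2)] by blast
  have "(\<lambda>n. \<alpha> (star (z n) * (scaleC c (x n)))) \<longlonglongrightarrow> hinner (gns_space \<alpha>) (hscale (gns_space \<alpha>) c u) w"
    using hinner_gns_class[OF \<alpha> gns_cauchy_scaleC[OF \<alpha> x(1)] z(1)] by (simp add: x z hscale_gns_class[OF \<alpha>])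
  moreover have "(\<lambda>n. \<alpha> (star (z n) * (scaleC c (x n)))) \<longlonglongrightarrow> c * hinner (gns_space \<alpha>) u w"
    using tendsto_mult_left[OF hinner_gns_class[OF \<alpha> x(1) z(1)]]
    by (simp add: x z mult_scaleC_right state_scaleC[OF \<alpha>])
  ultimately show ?thesis by (rule LIMSEQ_unique)
qed

lemma hinner_gns_const:
  "hinner (gns_space \<alpha>) (gns_class \<alpha> (\<lambda>_. a)) (gns_class \<alpha> (\<lambda>_. b)) = \<alpha> (star b * a)"
  using hinner_gns_class[OF \<alpha> gns_cauchy_const[OF \<alpha>, of a] gns_cauchy_const[OF \<alpha>, of b]]
  by (simp add: LIMSEQ_const_iff)

end

text \<open>Contractivity makes the maps equicontinuous in the seminorm, so convergence has to be
  arranged only for countably many elements.\<close>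

lemma gns_cauchy_dense:
  assumes \<alpha>: "\<alpha> \<in> states" and \<Theta>: "\<And>n. cp_contraction (\<Theta> n)"
    and dense: "\<And>y e. e > 0 \<Longrightarrow> \<exists>i. norm (y - d i) < e"
    and d: "\<And>i. (\<lambda>n. \<Theta> n (d i)) \<in> gns_cauchy \<alpha>"
  shows "(\<lambda>n. \<Theta> n a) \<in> gns_cauchy \<alpha>"
  unfolding gns_cauchy_def
proof clarify
  fix e :: real assume "e > 0"
  obtain i where i: "norm (a - d i) < e / 4" using dense[of "e / 4" a] \<open>e > 0\<close> by auto
  obtain M where M: "\<And>m n. m \<ge> M \<Longrightarrow> n \<ge> M \<Longrightarrow> gns_seminorm \<alpha> (\<Theta> m (d i) - \<Theta> n (d i)) < e / 2"
    using gns_cauchyD[OF \<alpha> d, of "e / 2" i] \<open>e > 0\<close> by auto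
  have "gns_seminorm \<alpha> (\<Theta> m a - \<Theta> n a) < e" if "m \<ge> M" "n \<ge> M" for m n
  proof -
    have "gns_seminorm \<alpha> (\<Theta> k (a - d i)) < e / 4" for k
      using cp_contraction_le_norm[OF \<Theta> \<alpha>, of k "a - d i"] i by simp
    then have "gns_seminorm \<alpha> (\<Theta> m a - \<Theta> m (d i)) < e / 4" "gns_seminorm \<alpha> (\<Theta> n (d i) - \<Theta> n a) < e / 4"
      using gns_seminorm_minus_commute[OF \<alpha>] by (simp_all add: cp_contraction_diff[OF \<Theta>])
    then show ?thesis
      using M[OF that] gns_seminorm_diff_triangle[OF \<alpha>, of "\<Theta> m a" "\<Theta> n a" "\<Theta> m (d i)"]
        gns_seminorm_diff_triangle[OF \<alpha>, of "\<Theta> m (d i)" "\<Theta> n a" "\<Theta> n (d i)"] by linarith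
  qed
  then show "\<exists>M. \<forall>m\<ge>M. \<forall>n\<ge>M. gns_seminorm \<alpha> (\<Theta> m a - \<Theta> n a) < e" by blast
qed

lemma gns_null_dense:
  assumes \<alpha>: "\<alpha> \<in> states" and \<Theta>: "\<And>n. cp_contraction (\<Theta> n)"
    and dense: "\<And>e. e > 0 \<Longrightarrow> \<exists>i. norm (s - d i) < e"
    and d: "\<And>i. (\<lambda>n. gns_seminorm \<alpha> (\<Theta> n (d i) - d i)) \<longlonglongrightarrow> 0"
  shows "(\<lambda>n. gns_seminorm \<alpha> (\<Theta> n s - s)) \<longlonglongrightarrow> 0"
proof (rule LIMSEQ_I)
  fix e :: real assume "e > 0"
  obtain i where i: "norm (s - d i) < e / 4" using dense[of "e / 4"] \<open>e > 0\<close> by auto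
  obtain M where M: "\<And>n. n \<ge> M \<Longrightarrow> gns_seminorm \<alpha> (\<Theta> n (d i) - d i) < e / 2"
    using LIMSEQ_D[OF d[of i], of "e / 2"] \<open>e > 0\<close> by (auto simp: gns_seminorm_nonneg[OF \<alpha>])
  have "gns_seminorm \<alpha> (\<Theta> n s - s) < e" if "n \<ge> M" for n
  proof -
    have "gns_seminorm \<alpha> (\<Theta> n s - \<Theta> n (d i)) < e / 4"
      using cp_contraction_le_norm[OF \<Theta> \<alpha>, of n "s - d i"] i by (simp add: cp_contraction_diff[OF \<Theta>])
    moreover have "gns_seminorm \<alpha> (d i - s) < e / 4"
      using gns_seminorm_le_norm[OF \<alpha>, of "s - d i"] i gns_seminorm_minus_commute[OF \<alpha>, of s "d i"] by simp
    ultimately show ?thesis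
      using M[OF that] gns_seminorm_diff_triangle[OF \<alpha>, of "\<Theta> n s" s "\<Theta> n (d i)"]
        gns_seminorm_diff_triangle[OF \<alpha>, of "\<Theta> n (d i)" s "d i"] by linarith
  qed
  then show "\<exists>M. \<forall>n\<ge>M. norm (gns_seminorm \<alpha> (\<Theta> n s - s) - 0) < e"
    by (auto simp: gns_seminorm_nonneg[OF \<alpha>])
qed

section \<open>Limits of contractions as dilation maps\<close>

context commutative_cstar
begin

context
  fixes S :: "'a set" and \<alpha> :: "'a \<Rightarrow> complex" and \<Theta> :: "nat \<Rightarrow> 'a \<Rightarrow> 'a"
  assumes S: "operator_system S" and \<alpha>: "\<alpha> \<in> states" and \<Theta>: "\<And>n. cp_contraction (\<Theta> n)"
    and cauchy: "\<And>a. (\<lambda>n. \<Theta> n a) \<in> gns_cauchy \<alpha>"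
    and fixes_S: "\<And>s. s \<in> S \<Longrightarrow> (\<lambda>n. gns_seminorm \<alpha> (\<Theta> n s - s)) \<longlonglongrightarrow> 0"
begin

lemma limit_multiplier: "gns_multiplier \<alpha> (\<lambda>n. \<Theta> n a)"
  unfolding gns_multiplier_def
  using cauchy cp_contraction_bound[OF \<Theta> \<alpha>] by (intro conjI exI[of _ "norm a"] allI)

lemma limit_tendsto_hinner:
  "(\<lambda>n. \<alpha> (\<Theta> n a)) \<longlonglongrightarrow> hinner (gns_space \<alpha>) (gns_mult \<alpha> (\<lambda>n. \<Theta> n a) (gns_vec \<alpha>)) (gns_vec \<alpha>)"
  using hinner_gns_class[OF \<alpha> cauchy[of a] gns_cauchy_const[OF \<alpha>, of 1]]
  by (simp add: gns_vec_def gns_mult_class[OF \<alpha> limit_multiplier] \<alpha>)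

lemma limit_tendsto: "(\<lambda>n. \<alpha> (\<Theta> n a)) \<longlonglongrightarrow> lim (\<lambda>n. \<alpha> (\<Theta> n a))"
  using limit_tendsto_hinner convergent_LIMSEQ_iff convergentI by blast

lemma limit_fixes_S: "s \<in> S \<Longrightarrow> gns_mult \<alpha> (\<lambda>n. \<Theta> n s) = gns_rep \<alpha> s"
  unfolding gns_rep_eq_gns_mult
  by (rule gns_mult_cong[OF \<alpha> limit_multiplier gns_multiplier_const[OF \<alpha>] fixes_S])

text \<open>Additivity, homogeneity and matrix positivity hold for every \<open>\<Theta> n\<close>
  and pass to the limit, positivity because the nonnegative reals are closed. Unitality is not part
  of \<open>cp_contraction\<close>; it comes from \<open>1 \<in> S\<close>.\<close>

lemma limit_ucp: "ucp (gns_space \<alpha>) (\<lambda>a. gns_mult \<alpha> (\<lambda>n. \<Theta> n a))"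
  unfolding ucp_def
proof (intro conjI allI ballI)
  fix a b :: 'a and c :: complex and u
  assume u: "u \<in> hcarrier (gns_space \<alpha>)"
  obtain x where x: "x \<in> gns_cauchy \<alpha>" "u = gns_class \<alpha> x" using gns_carrierE[OF \<alpha> u] by blast
  note simps = x(2) gns_mult_class[OF \<alpha> limit_multiplier x(1)] gns_mult_cauchy[OF \<alpha> limit_multiplier x(1)]
  show "gns_mult \<alpha> (\<lambda>n. \<Theta> n (a + b)) u = hadd (gns_space \<alpha>) (gns_mult \<alpha> (\<lambda>n. \<Theta> n a) u) (gns_mult \<alpha> (\<lambda>n. \<Theta> n b) u)"
    unfolding simps(1,2) hadd_gns_class[OF \<alpha> simps(3) simps(3)]
    by (simp add: cp_contraction_add[OF \<Theta>] distrib_right)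
  show "gns_mult \<alpha> (\<lambda>n. \<Theta> n (scaleC c a)) u = hscale (gns_space \<alpha>) c (gns_mult \<alpha> (\<lambda>n. \<Theta> n a) u)"
    unfolding simps(1,2) hscale_gns_class[OF \<alpha> simps(3)]
    by (simp add: cp_contraction_scaleC[OF \<Theta>] mult_scaleC_left)
  have "1 \<in> S" using S by (simp add: operator_system_def)
  then have "gns_mult \<alpha> (\<lambda>n. \<Theta> n 1) u = gns_rep \<alpha> 1 u" by (simp add: limit_fixes_S)
  then show "gns_mult \<alpha> (\<lambda>n. \<Theta> n 1) u = u"
    by (simp add: gns_rep_eq_gns_mult x(2) gns_mult_class[OF \<alpha> gns_multiplier_const[OF \<alpha>] x(1)])
next
  show "completely_positive (gns_space \<alpha>) (\<lambda>a. gns_mult \<alpha> (\<lambda>n. \<Theta> n a))"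
    unfolding completely_positive_def op_matrix_pos_def
  proof (intro allI impI)
    fix n :: nat and X :: "nat \<Rightarrow> nat \<Rightarrow> 'a" and h
    assume X: "matrix_pos n X" and h: "\<forall>i<n. h i \<in> hcarrier (gns_space \<alpha>)"
    define x where "x i = gns_rep_seq (h i)" for i
    have x: "x i \<in> gns_cauchy \<alpha>" "gns_class \<alpha> (x i) = h i" if "i < n" for i
      using gns_carrier_class[OF \<alpha>] h that by (auto simp: x_def)
    have "(\<lambda>k. \<Sum>i<n. \<Sum>j<n. \<alpha> (star (x i k) * (\<Theta> k (X i j) * x j k))) \<longlonglongrightarrow>
        (\<Sum>i<n. \<Sum>j<n. hinner (gns_space \<alpha>) (gns_mult \<alpha> (\<lambda>n. \<Theta> n (X i j)) (h j)) (h i))"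
    proof (intro tendsto_sum)
      fix i j assume "i \<in> {..<n}" "j \<in> {..<n}"
      then show "(\<lambda>k. \<alpha> (star (x i k) * (\<Theta> k (X i j) * x j k))) \<longlonglongrightarrow>
          hinner (gns_space \<alpha>) (gns_mult \<alpha> (\<lambda>n. \<Theta> n (X i j)) (h j)) (h i)"
        using hinner_gns_class[OF \<alpha> gns_mult_cauchy[OF \<alpha> limit_multiplier x(1)] x(1)]
        by (simp add: x gns_mult_class[OF \<alpha> limit_multiplier x(1), symmetric])
    qed
    moreover have "closed (\<real>\<^sub>\<ge>\<^sub>0 :: complex set)" by (rule closed_nonneg_Reals_complex)
    ultimately show "(\<Sum>i<n. \<Sum>j<n. hinner (gns_space \<alpha>) (gns_mult \<alpha> (\<lambda>n. \<Theta> n (X i j)) (h j)) (h i)) \<in> \<real>\<^sub>\<ge>\<^sub>0"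
      by (rule Lim_in_closed_set[rotated 3])
         (use cp_contraction_positive[OF \<Theta> \<alpha> X] in auto)
  qed
qed (rule gns_mult_bounded_ops[OF \<alpha> limit_multiplier])

lemma limit_dilation_map: "dilation_map S \<alpha> (\<lambda>a. lim (\<lambda>n. \<alpha> (\<Theta> n a))) (\<lambda>a. gns_mult \<alpha> (\<lambda>n. \<Theta> n a))"
  unfolding dilation_map_def
  using limit_ucp limit_fixes_S limI[OF limit_tendsto_hinner] by simp

lemma limit_strong_dilation: "strong_dilation_le S \<alpha> (\<lambda>a. lim (\<lambda>n. \<alpha> (\<Theta> n a)))"
  unfolding strong_dilation_le_def
  using limit_dilation_map gns_mult_bicommutant[OF \<alpha> limit_multiplier] by blast

text \<open>Integral subdivision demands a family with values in \<open>states\<close>, which is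
  recorded here separately from the dilation property.\<close>

lemma limit_state: "(\<lambda>a. lim (\<lambda>n. \<alpha> (\<Theta> n a))) \<in> states"
  unfolding states_def
proof (clarify, intro conjI allI)
  fix a b :: 'a and c :: complex
  show "lim (\<lambda>n. \<alpha> (\<Theta> n (a + b))) = lim (\<lambda>n. \<alpha> (\<Theta> n a)) + lim (\<lambda>n. \<alpha> (\<Theta> n b))"
    using tendsto_add[OF limit_tendsto limit_tendsto, of a b]
    by (intro limI) (simp add: cp_contraction_add[OF \<Theta>] state_add[OF \<alpha>])
  show "lim (\<lambda>n. \<alpha> (\<Theta> n (scaleC c a))) = c * lim (\<lambda>n. \<alpha> (\<Theta> n a))"
    using tendsto_mult_left[OF limit_tendsto, of c a]
    by (intro limI) (simp add: cp_contraction_scaleC[OF \<Theta>] state_scaleC[OF \<alpha>])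
  show "lim (\<lambda>n. \<alpha> (\<Theta> n (star a * a))) \<in> \<real>\<^sub>\<ge>\<^sub>0"
  proof (rule Lim_in_closed_set[OF closed_nonneg_Reals_complex _ _ limit_tendsto])
    show "\<forall>\<^sub>F n in sequentially. \<alpha> (\<Theta> n (star a * a)) \<in> \<real>\<^sub>\<ge>\<^sub>0"
      using cp_contraction_positive[OF \<Theta> \<alpha> matrix_pos_1[of a], of "\<lambda>_. 1"] by simp
  qed simp
  have "1 \<in> S" using S by (simp add: operator_system_def)
  then have "(\<lambda>n. \<alpha> (\<Theta> n 1 - 1)) \<longlonglongrightarrow> 0"
    by (intro Lim_null_comparison[OF _ fixes_S]) (auto simp: cmod_state_le_gns_seminorm[OF \<alpha>])
  then have "(\<lambda>n. \<alpha> (\<Theta> n 1)) \<longlonglongrightarrow> 1"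
    by (simp add: state_diff[OF \<alpha>] state_one[OF \<alpha>] LIM_zero_iff)
  then show "lim (\<lambda>n. \<alpha> (\<Theta> n 1)) = 1" by (rule limI)
qed

end

text \<open>Averaging a strong dilation map over the pieces of fine partitions of unity gives completely
  positive contractions of the algebra that converge to it.\<close>

lemma strong_dilation_approximation:
  fixes S :: "'a set" and d :: "nat \<Rightarrow> 'a"
  assumes S: "operator_system S" and \<phi>: "\<phi> \<in> states"
    and \<Phi>: "dilation_map S \<phi> \<psi> \<Phi>" and bi: "range \<Phi> \<subseteq> bicommutant (gns_space \<phi>) (range (gns_rep \<phi>))"
    and dense: "\<And>y e. e > 0 \<Longrightarrow> \<exists>i. norm (y - d i) < e"
  obtains \<Theta> where "\<And>j. cp_contraction (\<Theta> j)" "\<And>j a. \<phi> (\<Theta> j a) = \<psi> a"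
    and "\<And>a. (\<lambda>j. \<Theta> j a) \<in> gns_cauchy \<phi>"
    and "\<And>s. s \<in> S \<Longrightarrow> (\<lambda>j. gns_seminorm \<phi> (\<Theta> j s - s)) \<longlonglongrightarrow> 0"
proof -
  let ?H = "gns_space \<phi>"
  obtain n b where part: "\<And>j. partition_of_unity (n j) (b j)"
    and fine: "\<And>\<phi> y :: 'a. \<phi> \<in> states \<Longrightarrow> (\<lambda>j. total_variance \<phi> (n j) (b j) y) \<longlonglongrightarrow> 0"
    using fine_partition_sequence[OF dense] by blast
  have ucp: "ucp ?H \<Phi>" and \<Phi>S: "\<And>s. s \<in> S \<Longrightarrow> \<Phi> s = gns_rep \<phi> s"
    and \<psi>: "\<And>a. \<psi> a = hinner ?H (\<Phi> a (gns_vec \<phi>)) (gns_vec \<phi>)"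
    using \<Phi> by (auto simp: dilation_map_def)
  define const where "const y = gns_class \<phi> (\<lambda>_. y)" for y
  have const: "const y \<in> hcarrier ?H" for y by (simp add: const_def \<phi>)
  have vec: "gns_vec \<phi> = const 1" by (simp add: gns_vec_def const_def)
  have rep_const: "gns_rep \<phi> z (const y) = const (z * y)" for y z
    by (simp add: const_def gns_rep_eq_gns_mult gns_mult_class[OF \<phi>] \<phi>)
  have \<Phi>c: "\<Phi> a u \<in> hcarrier ?H" if "u \<in> hcarrier ?H" for a u
    using ucp that by (auto simp: ucp_def bounded_ops_def)
  \<comment> \<open>Commutativity of the algebra puts the representation inside its own commutant,
    and operators in the bicommutant commute with that.\<close>
  have comm_rep: "gns_rep \<phi> z \<in> commutant ?H (range (gns_rep \<phi>))" for z
    using gns_mult_bounded_ops[OF \<phi> gns_multiplier_const[OF \<phi>, of z]]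
  proof (simp add: commutant_def gns_rep_eq_gns_mult, intro allI)
    fix w
    show "compose (hcarrier ?H) (gns_mult \<phi> (\<lambda>_. z)) (gns_mult \<phi> (\<lambda>_. w)) =
        compose (hcarrier ?H) (gns_mult \<phi> (\<lambda>_. w)) (gns_mult \<phi> (\<lambda>_. z))"
    proof
      fix u
      show "compose (hcarrier ?H) (gns_mult \<phi> (\<lambda>_. z)) (gns_mult \<phi> (\<lambda>_. w)) u =
        compose (hcarrier ?H) (gns_mult \<phi> (\<lambda>_. w)) (gns_mult \<phi> (\<lambda>_. z)) u"
      proof (cases "u \<in> hcarrier ?H")
        case True
        then obtain x where "x \<in> gns_cauchy \<phi>" "u = gns_class \<phi> x" using gns_carrierE[OF \<phi>] by blast
        with True show ?thesis
          by (simp add: compose_eq gns_mult_class[OF \<phi>] gns_mult_cauchy[OF \<phi>] gns_multiplier_const[OF \<phi>] left_comm)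
      qed (simp add: compose_def)
    qed
  qed
  \<comment> \<open>So \<open>\<Phi> a\<close> acts as multiplication by the vector
    \<open>\<Phi> a (gns_vec \<phi>)\<close> and can be read off a sequence \<open>x a\<close> that
    represents this vector.\<close>
  have \<Phi>_const: "\<Phi> a (const y) = gns_rep \<phi> y (\<Phi> a (gns_vec \<phi>))" for a y
  proof -
    have "compose (hcarrier ?H) (\<Phi> a) (gns_rep \<phi> y) = compose (hcarrier ?H) (gns_rep \<phi> y) (\<Phi> a)"
      using bi comm_rep[of y] by (auto simp: bicommutant_def commutant_def)
    from fun_cong[OF this, of "gns_vec \<phi>"] show ?thesis
      by (simp add: compose_eq const vec rep_const)
  qed
  define x where "x a = gns_rep_seq (\<Phi> a (gns_vec \<phi>))" for a
  have x: "x a \<in> gns_cauchy \<phi>" "\<Phi> a (gns_vec \<phi>) = gns_class \<phi> (x a)" for a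
    using gns_carrier_class[OF \<phi> \<Phi>c] const vec by (auto simp: x_def)
  define q where "q y a = hinner ?H (\<Phi> a (const y)) (const y)" for y a
  have q_lim: "(\<lambda>k. \<phi> (star y * y * x a k)) \<longlonglongrightarrow> q y a" for y a
    using hinner_gns_class[OF \<phi> gns_mult_cauchy[OF \<phi> gns_multiplier_const[OF \<phi>, of y] x(1)[of a]] gns_cauchy_const[OF \<phi>, of y]]
    by (simp add: q_def \<Phi>_const x(2) gns_rep_eq_gns_mult gns_mult_class[OF \<phi> gns_multiplier_const[OF \<phi>] x(1)]
        mult.assoc flip: const_def)
  \<comment> \<open>A functional with two faces: normalised, it is the vector state of
    \<open>\<Phi>\<close> at \<open>const y\<close>, hence a state in \<open>a\<close>; by
    \<open>c_lim\<close> it is also the mean over the piece \<open>y\<close> of the function that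
    \<open>x a\<close> represents.\<close>
  define c where "c y a = q y a / \<phi> (star y * y)" for y a
  have c_lim: "(\<lambda>k. local_mean \<phi> y (x a k)) \<longlonglongrightarrow> c y a" for y a
    unfolding local_mean_def c_def divide_inverse by (rule tendsto_mult_right[OF q_lim])
  have c_state: "c y \<in> states \<or> c y = (\<lambda>_. 0)" for y
  proof (cases "\<phi> (star y * y) = 0")
    case False
    have "c y \<in> states"
      unfolding states_def
    proof (clarify, intro conjI allI)
      fix a a' :: 'a and k :: complex
      show "c y (a + a') = c y a + c y a'"
        using ucp by (simp add: c_def q_def ucp_def const hinner_gns_hadd[OF \<phi>] \<Phi>c add_divide_distrib)
      show "c y (scaleC k a) = k * c y a"
        using ucp by (simp add: c_def q_def ucp_def const hinner_gns_hscale[OF \<phi>] \<Phi>c)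
      have "op_matrix_pos ?H 1 (\<lambda>_ _. \<Phi> (star a * a))"
        using ucp matrix_pos_1[of a] by (auto simp: ucp_def completely_positive_def)
      then have "q y (star a * a) \<in> \<real>\<^sub>\<ge>\<^sub>0"
        using const[of y] by (auto simp: op_matrix_pos_def q_def dest!: spec[of _ "\<lambda>_. const y"])
      then show "c y (star a * a) \<in> \<real>\<^sub>\<ge>\<^sub>0"
        unfolding c_def by (intro nonneg_Reals_divide_I state_pos[OF \<phi>])
      have "q y 1 = \<phi> (star y * y)"
        using ucp const[of y] by (simp add: q_def ucp_def) (simp add: const_def hinner_gns_const[OF \<phi>])
      then show "c y 1 = 1" using False by (simp add: c_def)
    qed
    then show ?thesis ..
  qed (auto simp: c_def)
  define \<Theta> where "\<Theta> j = partition_map (n j) (b j) (\<lambda>i. c (b j i))" for j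
  have cp: "cp_contraction (\<Theta> j)" for j
    unfolding \<Theta>_def by (rule cp_contraction_partition_map[OF part c_state])
  have val: "\<phi> (\<Theta> j a) = \<psi> a" for j a
  proof -
    have "(\<lambda>k. \<Sum>i<n j. local_mean \<phi> (b j i) (x a k) * \<phi> (star (b j i) * b j i)) \<longlonglongrightarrow> \<phi> (\<Theta> j a)"
      unfolding \<Theta>_def state_partition_map[OF \<phi>] by (intro tendsto_intros c_lim)
    moreover have "(\<Sum>i<n j. local_mean \<phi> (b j i) y * \<phi> (star (b j i) * b j i)) = \<phi> y" for y
      using part[of j] by (simp add: local_mean_mult[OF \<phi>] partition_of_unity_def flip: state_sum[OF \<phi>] sum_distrib_right)
    moreover have "(\<lambda>k. \<phi> (x a k)) \<longlonglongrightarrow> \<psi> a"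
      using q_lim[of 1 a] by (simp add: q_def \<psi> vec)
    ultimately show ?thesis by (simp add: LIMSEQ_unique)
  qed
  \<comment> \<open>Averaging does not increase the seminorm, so \<open>\<Theta> j a\<close> is
    within \<open>e\<close> of the average of the single term \<open>x a M\<close>. That term is an
    element of \<open>A\<close>, and its average differs from it only by its variance.\<close>
  have approx: "gns_seminorm \<phi> (\<Theta> j a - x a M) \<le> e + sqrt (total_variance \<phi> (n j) (b j) (x a M))"
    if e: "\<And>k. k \<ge> M \<Longrightarrow> gns_seminorm \<phi> (x a k - x a M) \<le> e" for j a M e
  proof -
    let ?P = "partition_map (n j) (b j) (\<lambda>i. local_mean \<phi> (b j i))"
    have "e \<ge> 0" using e[of M] by (simp add: \<phi>)
    have "(\<lambda>k. \<Sum>i<n j. (cmod (local_mean \<phi> (b j i) (x a k) - local_mean \<phi> (b j i) (x a M)))\<^sup>2 * (gns_seminorm \<phi> (b j i))\<^sup>2)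
        \<longlonglongrightarrow> (\<Sum>i<n j. (cmod (c (b j i) a - local_mean \<phi> (b j i) (x a M)))\<^sup>2 * (gns_seminorm \<phi> (b j i))\<^sup>2)"
      by (intro tendsto_intros c_lim)
    moreover have "(\<Sum>i<n j. (cmod (local_mean \<phi> (b j i) (x a k) - local_mean \<phi> (b j i) (x a M)))\<^sup>2 * (gns_seminorm \<phi> (b j i))\<^sup>2) \<le> e\<^sup>2"
      if "k \<ge> M" for k
    proof -
      have "(\<Sum>i<n j. (cmod (local_mean \<phi> (b j i) (x a k) - local_mean \<phi> (b j i) (x a M)))\<^sup>2 * (gns_seminorm \<phi> (b j i))\<^sup>2)
          \<le> (\<Sum>i<n j. (gns_seminorm \<phi> (b j i * (x a k - x a M)))\<^sup>2)"
        by (intro sum_mono) (simp only: local_mean_diff[OF \<phi>, symmetric] local_mean_bound[OF \<phi>])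
      also have "\<dots> = (gns_seminorm \<phi> (x a k - x a M))\<^sup>2" by (rule gns_seminorm_partition[OF \<phi> part])
      also have "\<dots> \<le> e\<^sup>2" by (intro power_mono e that gns_seminorm_nonneg[OF \<phi>])
      finally show ?thesis .
    qed
    ultimately have le: "(\<Sum>i<n j. (cmod (c (b j i) a - local_mean \<phi> (b j i) (x a M)))\<^sup>2 * (gns_seminorm \<phi> (b j i))\<^sup>2) \<le> e\<^sup>2"
      by (intro LIMSEQ_le_const2) blast+
    have "(gns_seminorm \<phi> (\<Theta> j a - ?P (x a M)))\<^sup>2 \<le>
        (\<Sum>i<n j. (cmod (c (b j i) a - local_mean \<phi> (b j i) (x a M)))\<^sup>2 * (gns_seminorm \<phi> (b j i))\<^sup>2)"
      unfolding \<Theta>_def by (rule partition_map_diff[OF \<phi> part])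
    then have "(gns_seminorm \<phi> (\<Theta> j a - ?P (x a M)))\<^sup>2 \<le> e\<^sup>2"
      using le by linarith
    then have "gns_seminorm \<phi> (\<Theta> j a - ?P (x a M)) \<le> e"
      using \<open>e \<ge> 0\<close> by (rule power2_le_imp_le)
    moreover have "gns_seminorm \<phi> (?P (x a M) - x a M) \<le> sqrt (total_variance \<phi> (n j) (b j) (x a M))"
      by (intro real_le_rsqrt partition_map_local_mean[OF \<phi> part])
    ultimately show ?thesis
      using gns_seminorm_diff_triangle[OF \<phi>, of "\<Theta> j a" "x a M" "?P (x a M)"] by linarith
  qed
  have cauchy: "(\<lambda>j. \<Theta> j a) \<in> gns_cauchy \<phi>" for a
    unfolding gns_cauchy_def
  proof clarify
    fix e :: real assume "e > 0"
    obtain M where M: "\<And>k l. k \<ge> M \<Longrightarrow> l \<ge> M \<Longrightarrow> gns_seminorm \<phi> (x a k - x a l) < e / 4"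
      using gns_cauchyD[OF \<phi> x(1)[of a], of "e / 4"] \<open>e > 0\<close> by auto
    have "(\<lambda>j. sqrt (total_variance \<phi> (n j) (b j) (x a M))) \<longlonglongrightarrow> 0"
      using tendsto_real_sqrt[OF fine[OF \<phi>, of "x a M"]] by simp
    then have "\<forall>\<^sub>F j in sequentially. sqrt (total_variance \<phi> (n j) (b j) (x a M)) < e / 4"
      using \<open>e > 0\<close> by (intro order_tendstoD(2)) auto
    then obtain J where J: "\<And>j. j \<ge> J \<Longrightarrow> sqrt (total_variance \<phi> (n j) (b j) (x a M)) < e / 4"
      by (auto simp: eventually_sequentially)
    have near: "gns_seminorm \<phi> (\<Theta> j a - x a M) < e / 2" if "j \<ge> J" for j
      using approx[of M a "e / 4" j] M[of _ M] J[OF that] by (simp add: less_imp_le)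
    have "gns_seminorm \<phi> (\<Theta> j a - \<Theta> k a) < e" if "j \<ge> J" "k \<ge> J" for j k
      using near[OF that(1)] near[OF that(2)] gns_seminorm_minus_commute[OF \<phi>, of "\<Theta> k a"]
        gns_seminorm_diff_triangle[OF \<phi>, of "\<Theta> j a" "\<Theta> k a" "x a M"] by simp
    then show "\<exists>M. \<forall>m\<ge>M. \<forall>n\<ge>M. gns_seminorm \<phi> (\<Theta> m a - \<Theta> n a) < e" by blast
  qed
  have "(\<lambda>j. gns_seminorm \<phi> (\<Theta> j s - s)) \<longlonglongrightarrow> 0" if s: "s \<in> S" for s
  proof (rule tendsto_sandwich[OF _ _ tendsto_const])
    \<comment> \<open>On \<open>S\<close> the map \<open>\<Phi>\<close> is the representation
      itself, so \<open>c y s\<close> is exactly the local mean of \<open>s\<close>.\<close>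
    have "q y s = \<phi> (star y * y * s)" for y
      by (simp add: q_def \<Phi>S[OF s] rep_const) (simp add: const_def hinner_gns_const[OF \<phi>] mult.assoc comm[of s])
    then have "c y s = local_mean \<phi> y s" for y by (simp add: c_def local_mean_def)
    then have "\<Theta> j s = partition_map (n j) (b j) (\<lambda>i. local_mean \<phi> (b j i)) s" for j
      by (simp add: \<Theta>_def partition_map_def)
    then show "\<forall>\<^sub>F j in sequentially. gns_seminorm \<phi> (\<Theta> j s - s) \<le> sqrt (total_variance \<phi> (n j) (b j) s)"
      by (simp add: real_le_rsqrt partition_map_local_mean[OF \<phi> part])
    show "(\<lambda>j. sqrt (total_variance \<phi> (n j) (b j) s)) \<longlonglongrightarrow> 0"
      using tendsto_real_sqrt[OF fine[OF \<phi>, of s]] by simp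
  qed (simp add: gns_seminorm_nonneg[OF \<phi>])
  with cp val cauchy show thesis by (rule that)
qed

end

section \<open>Measures on the state space\<close>

lemma borel_measurable_evaluation:
  fixes \<mu> :: "('a::cstar_algebra \<Rightarrow> complex) measure"
  assumes "borel_prob_on_states \<mu>"
  shows "(\<lambda>\<alpha>. \<alpha> a) \<in> borel_measurable \<mu>"
proof -
  have "(\<lambda>\<alpha> :: 'a \<Rightarrow> complex. \<alpha> a) \<in> borel_measurable borel"
    by (intro borel_measurable_continuous_onI continuous_on_product_coordinates)
  then have "(\<lambda>\<alpha>. \<alpha> a) \<in> borel_measurable (restrict_space borel states)"
    by (rule measurable_restrict_space1)
  then show ?thesis
    using assms by (simp add: borel_prob_on_states_def cong: measurable_cong_sets)
qed

lemma space_borel_prob_on_states: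
  assumes "borel_prob_on_states \<mu>"
  shows "space \<mu> = states"
  using sets_eq_imp_space_eq[of \<mu> "restrict_space borel states"] assms
  by (simp add: borel_prob_on_states_def space_restrict_space)

lemma emeasure_space_borel_prob_on_states: "borel_prob_on_states \<mu> \<Longrightarrow> emeasure \<mu> (space \<mu>) = 1"
  by (simp add: borel_prob_on_states_def)

context
  fixes \<mu> :: "('a::cstar_algebra \<Rightarrow> complex) measure" and \<phi> :: "'a \<Rightarrow> complex"
  assumes \<mu>: "borel_prob_on_states \<mu>" and bary: "barycenter \<mu> = \<phi>"
begin

lemma integrable_evaluation: "integrable \<mu> (\<lambda>\<alpha>. \<alpha> a)"
proof -
  interpret finite_measure \<mu>
    using emeasure_space_borel_prob_on_states[OF \<mu>] by (intro finite_measureI) simp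
  show ?thesis
    by (rule integrable_const_bound[where B = "norm a"])
       (auto intro!: AE_I2 borel_measurable_evaluation[OF \<mu>] cmod_state_le_norm simp: space_borel_prob_on_states[OF \<mu>])
qed

lemma integral_evaluation: "(\<integral>\<alpha>. \<alpha> a \<partial>\<mu>) = \<phi> a"
  using bary by (auto simp: barycenter_def)

lemma borel_measurable_gns_seminorm [measurable]: "(\<lambda>\<alpha>. gns_seminorm \<alpha> z) \<in> borel_measurable \<mu>"
  unfolding gns_seminorm_def using borel_measurable_evaluation[OF \<mu>] by measurable

text \<open>The squared seminorm is evaluation at \<open>star z * z\<close>, to which the barycenter
  condition applies. This carries estimates at \<phi> over to the measure.\<close>

lemma nn_integral_gns_seminorm:
  assumes "\<phi> \<in> states"
  shows "(\<integral>\<^sup>+\<alpha>. ennreal ((gns_seminorm \<alpha> z)\<^sup>2) \<partial>\<mu>) = ennreal ((gns_seminorm \<phi> z)\<^sup>2)"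
proof -
  have "(\<integral>\<^sup>+\<alpha>. ennreal ((gns_seminorm \<alpha> z)\<^sup>2) \<partial>\<mu>) = (\<integral>\<^sup>+\<alpha>. ennreal (Re (\<alpha> (star z * z))) \<partial>\<mu>)"
    by (intro nn_integral_cong) (simp add: space_borel_prob_on_states[OF \<mu>] gns_seminorm_square)
  also have "\<dots> = ennreal (\<integral>\<alpha>. Re (\<alpha> (star z * z)) \<partial>\<mu>)"
  proof (rule nn_integral_eq_integral)
    show "integrable \<mu> (\<lambda>\<alpha>. Re (\<alpha> (star z * z)))"
      by (intro integrable_Re integrable_evaluation)
    show "AE \<alpha> in \<mu>. 0 \<le> Re (\<alpha> (star z * z))"
      by (intro AE_I2) (simp add: space_borel_prob_on_states[OF \<mu>] flip: gns_seminorm_square)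
  qed
  also have "(\<integral>\<alpha>. Re (\<alpha> (star z * z)) \<partial>\<mu>) = Re (\<phi> (star z * z))"
    by (simp add: integrable_evaluation integral_evaluation)
  finally show ?thesis using assms by (simp add: gns_seminorm_square)
qed

text \<open>Squares are controlled in the mean, but first powers are to be summed. The conversion is
  \<open>t \<le> (1/2) ^ k + 2 ^ (k + M) * t\<^sup>2\<close>, whose last term pays for the case
  \<open>t > (1/2) ^ k\<close>; its integrals stay geometric by the hypothesis \<open>small\<close>.
  The sum is shifted by \<open>M\<close>, where that hypothesis begins.\<close>

lemma AE_summable_gns_seminorm:
  assumes \<phi>: "\<phi> \<in> states" and small: "\<And>k. k \<ge> M \<Longrightarrow> gns_seminorm \<phi> (z k) \<le> (1/2) ^ k"
  shows "AE \<alpha> in \<mu>. (\<Sum>k. ennreal (gns_seminorm \<alpha> (z (k + M)))) \<noteq> \<infinity>"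
proof -
  let ?f = "\<lambda>k \<alpha>. ennreal ((1/2) ^ k) + ennreal (2 ^ (k + M)) * ennreal ((gns_seminorm \<alpha> (z (k + M)))\<^sup>2)"
  have le: "ennreal (gns_seminorm \<alpha> (z (k + M))) \<le> ?f k \<alpha>" for k \<alpha>
  proof -
    define t where "t = gns_seminorm \<alpha> (z (k + M))"
    have "t \<le> (1/2) ^ k + 2 ^ (k + M) * t\<^sup>2"
    proof (cases "t \<le> (1/2) ^ k")
      case False
      then have "t > 0" by (smt (verit) zero_le_power zero_le_divide_1_iff)
      have "(1/2) ^ k * 2 ^ (k + M) \<ge> (1 :: real)"
        by (simp add: power_add power_divide)
      then have "1 \<le> t * 2 ^ (k + M)"
        using False by (smt (verit, best) mult_right_mono zero_le_power)
      then have "t * 1 \<le> t * (t * 2 ^ (k + M))"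
        using \<open>t > 0\<close> by (intro mult_left_mono) auto
      then have "t \<le> 2 ^ (k + M) * t\<^sup>2" by (simp add: power2_eq_square mult_ac)
      moreover have "(0 :: real) \<le> (1/2) ^ k" by simp
      ultimately show ?thesis by linarith
    next
      case True
      moreover have "0 \<le> 2 ^ (k + M) * t\<^sup>2" by simp
      ultimately show ?thesis by linarith
    qed
    then have "ennreal t \<le> ennreal ((1/2) ^ k + 2 ^ (k + M) * t\<^sup>2)" by (rule ennreal_leI)
    then show ?thesis by (simp add: t_def ennreal_plus ennreal_mult)
  qed
  have "(\<integral>\<^sup>+\<alpha>. (\<Sum>k. ?f k \<alpha>) \<partial>\<mu>) = (\<Sum>k. \<integral>\<^sup>+\<alpha>. ?f k \<alpha> \<partial>\<mu>)"
    by (intro nn_integral_suminf) simp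
  also have "\<dots> = (\<Sum>k. ennreal ((1/2) ^ k) + ennreal (2 ^ (k + M)) * ennreal ((gns_seminorm \<phi> (z (k + M)))\<^sup>2))"
    by (simp add: nn_integral_add nn_integral_cmult nn_integral_gns_seminorm[OF \<phi>]
        emeasure_space_borel_prob_on_states[OF \<mu>])
  also have "\<dots> \<le> (\<Sum>k. ennreal (2 * (1/2) ^ k))"
  proof (intro suminf_le summableI)
    fix k
    have "(gns_seminorm \<phi> (z (k + M)))\<^sup>2 \<le> ((1/2) ^ (k + M))\<^sup>2"
      by (intro power_mono small gns_seminorm_nonneg[OF \<phi>]) simp
    then have "2 ^ (k + M) * (gns_seminorm \<phi> (z (k + M)))\<^sup>2 \<le> 2 ^ (k + M) * ((1/2) ^ (k + M))\<^sup>2"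
      by (intro mult_left_mono) auto
    also have "\<dots> = (1/2 :: real) ^ (k + M)"
      by (simp add: power2_eq_square power_divide)
    also have "\<dots> \<le> (1/2) ^ k" by (rule power_decreasing) auto
    finally show "ennreal ((1/2) ^ k) + ennreal (2 ^ (k + M)) * ennreal ((gns_seminorm \<phi> (z (k + M)))\<^sup>2)
        \<le> ennreal (2 * (1/2) ^ k)"
      by (simp flip: ennreal_mult ennreal_plus)
  qed
  also have "\<dots> < \<infinity>"
  proof -
    have "summable (\<lambda>k. 2 * (1/2 :: real) ^ k)" by (intro summable_mult summable_geometric) simp
    then have "(\<Sum>k. ennreal (2 * (1/2) ^ k)) = ennreal (\<Sum>k. 2 * (1/2) ^ k)" by (intro suminf_ennreal2) auto
    then show ?thesis by simp
  qed
  finally have "AE \<alpha> in \<mu>. (\<Sum>k. ?f k \<alpha>) \<noteq> \<infinity>"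
    by (intro nn_integral_noteq_infinite) (auto simp: less_top)
  then show ?thesis
  proof eventually_elim
    case (elim \<alpha>)
    have "(\<Sum>k. ennreal (gns_seminorm \<alpha> (z (k + M)))) \<le> (\<Sum>k. ?f k \<alpha>)"
      by (intro suminf_le summableI le)
    then show ?case
      by (rule neq_top_trans[OF elim[unfolded infinity_ennreal_def], folded infinity_ennreal_def])
  qed
qed

end

section \<open>From summable increments to Cauchy sequences\<close>

lemma summable_of_shifted_ennreal:
  assumes "\<And>k. 0 \<le> f k" and "(\<Sum>k. ennreal (f (k + M))) \<noteq> \<infinity>"
  shows "summable f"
proof -
  have "summable (\<lambda>k. f (k + M))"
    using assms(2) by (intro summable_suminf_not_top assms(1)) (simp add: infinity_ennreal_def)
  then show ?thesis by (rule summable_iff_shift[THEN iffD1])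
qed

lemma gns_cauchy_of_summable:
  assumes \<alpha>: "\<alpha> \<in> states" and sum: "summable (\<lambda>k. gns_seminorm \<alpha> (x (Suc k) - x k))"
  shows "x \<in> gns_cauchy \<alpha>"
  unfolding gns_cauchy_def
proof clarify
  fix e :: real assume "e > 0"
  then obtain M where M: "\<And>m n. m \<ge> M \<Longrightarrow> norm (\<Sum>k=m..<n. gns_seminorm \<alpha> (x (Suc k) - x k)) < e"
    using sum unfolding summable_Cauchy by blast
  have step: "gns_seminorm \<alpha> (x (m + j) - x m) \<le> (\<Sum>k=m..<m + j. gns_seminorm \<alpha> (x (Suc k) - x k))" for m j
  proof (induction j)
    case (Suc j)
    then show ?case
      using gns_seminorm_diff_triangle[OF \<alpha>, of "x (m + Suc j)" "x m" "x (m + j)"] by simp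
  qed (simp add: \<alpha>)
  have less: "gns_seminorm \<alpha> (x n - x m) < e" if "m \<ge> M" "n \<ge> m" for m n
    using step[of m "n - m"] M[OF that(1), of n] that(2) by simp
  have "gns_seminorm \<alpha> (x m - x n) < e" if "m \<ge> M" "n \<ge> M" for m n
    using less[of m n] less[of n m] that gns_seminorm_minus_commute[OF \<alpha>, of "x m"]
    by (cases "m \<le> n") auto
  then show "\<exists>M. \<forall>m\<ge>M. \<forall>n\<ge>M. gns_seminorm \<alpha> (x m - x n) < e" by blast
qed

text \<open>Each threshold is the maximum over all earlier ones. Monotonicity lets
  \<open>m (Suc k)\<close> satisfy requirement \<open>k\<close> as well, as an estimate of
  consecutive differences needs.\<close>

lemma fast_subsequence:
  fixes P :: "nat \<Rightarrow> nat \<Rightarrow> bool"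
  assumes "\<And>k. \<exists>r. \<forall>j\<ge>r. P k j"
  obtains m :: "nat \<Rightarrow> nat" where "mono m" "\<And>k j. j \<ge> m k \<Longrightarrow> P k j"
proof -
  obtain r where r: "\<And>k j. j \<ge> r k \<Longrightarrow> P k j" using assms by metis
  define m where "m k = Max (r ` {..k})" for k
  have "mono m"
    unfolding m_def by (intro monoI Max_mono) auto
  moreover have "r k \<le> m k" for k unfolding m_def by (intro Max_ge) auto
  ultimately show thesis using r that order_trans by metis
qed

section \<open>From strong dilation to integral subdivision\<close>

context commutative_cstar
begin

lemma strong_dilation_imp_isd:
  fixes S :: "'a set" and d e :: "nat \<Rightarrow> 'a"
  assumes S: "operator_system S" and \<phi>: "\<phi> \<in> states" and strong: "strong_dilation_le S \<phi> \<psi>"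
    and d: "\<And>y \<epsilon>. \<epsilon> > 0 \<Longrightarrow> \<exists>i. norm (y - d i) < \<epsilon>"
    and e: "\<And>i. e i \<in> S" "\<And>s \<epsilon>. s \<in> S \<Longrightarrow> \<epsilon> > 0 \<Longrightarrow> \<exists>i. norm (s - e i) < \<epsilon>"
  shows "isd_le S \<phi> \<psi>"
  unfolding isd_le_def
proof (intro allI impI, elim conjE)
  fix \<mu> :: "('a \<Rightarrow> complex) measure"
  assume \<mu>: "borel_prob_on_states \<mu>" and bary: "barycenter \<mu> = \<phi>"
  obtain \<Phi> where "dilation_map S \<phi> \<psi> \<Phi>" "range \<Phi> \<subseteq> bicommutant (gns_space \<phi>) (range (gns_rep \<phi>))"
    using strong by (auto simp: strong_dilation_le_def)
  from strong_dilation_approximation[OF S \<phi> this d]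
  obtain \<Theta> where \<Theta>: "\<And>j. cp_contraction (\<Theta> j)" "\<And>j a. \<phi> (\<Theta> j a) = \<psi> a"
    "\<And>a. (\<lambda>j. \<Theta> j a) \<in> gns_cauchy \<phi>" "\<And>s. s \<in> S \<Longrightarrow> (\<lambda>j. gns_seminorm \<phi> (\<Theta> j s - s)) \<longlonglongrightarrow> 0"
    by blast
  \<comment> \<open>Requirement \<open>k\<close> involves finitely many elements, those of index at
    most \<open>k\<close>, so a common threshold exists; every element is covered from its own index
    on.\<close>
  define P where "P k r \<longleftrightarrow> (\<forall>j\<ge>r. \<forall>j'\<ge>r. \<forall>i\<le>k. gns_seminorm \<phi> (\<Theta> j (d i) - \<Theta> j' (d i)) \<le> (1/2) ^ k \<and>
      gns_seminorm \<phi> (\<Theta> j (e i) - e i) \<le> (1/2) ^ k)" for k r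
  have "\<exists>r. \<forall>j\<ge>r. P k j" for k
  proof -
    have "\<exists>r. \<forall>j\<ge>r. \<forall>j'\<ge>r. gns_seminorm \<phi> (\<Theta> j (d i) - \<Theta> j' (d i)) \<le> (1/2) ^ k \<and>
        gns_seminorm \<phi> (\<Theta> j (e i) - e i) \<le> (1/2) ^ k" for i
    proof -
      obtain M where M: "\<And>j j'. j \<ge> M \<Longrightarrow> j' \<ge> M \<Longrightarrow> gns_seminorm \<phi> (\<Theta> j (d i) - \<Theta> j' (d i)) < (1/2) ^ k"
        using gns_cauchyD[OF \<phi> \<Theta>(3)[of "d i"], of "(1/2) ^ k"] by auto
      obtain N where N: "\<And>j. j \<ge> N \<Longrightarrow> gns_seminorm \<phi> (\<Theta> j (e i) - e i) < (1/2) ^ k"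
        using LIMSEQ_D[OF \<Theta>(4)[OF e(1)[of i]], of "(1/2) ^ k"] by (auto simp: gns_seminorm_nonneg[OF \<phi>])
      show ?thesis using M N by (intro exI[of _ "max M N"]) (auto intro: less_imp_le)
    qed
    then obtain r where r: "\<And>i j j'. j \<ge> r i \<Longrightarrow> j' \<ge> r i \<Longrightarrow> gns_seminorm \<phi> (\<Theta> j (d i) - \<Theta> j' (d i)) \<le> (1/2) ^ k \<and>
        gns_seminorm \<phi> (\<Theta> j (e i) - e i) \<le> (1/2) ^ k" by metis
    have "r i \<le> Max (r ` {..k})" if "i \<le> k" for i using that by (intro Max_ge) auto
    then show ?thesis
      unfolding P_def using r by (intro exI[of _ "Max (r ` {..k})"]) (meson order_trans)
  qed
  from fast_subsequence[of P, OF this]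
  obtain m where m: "mono m" "\<And>k j. j \<ge> m k \<Longrightarrow> P k j" by blast
  define \<Lambda> where "\<Lambda> k = \<Theta> (m k)" for k
  have small_d: "gns_seminorm \<phi> (\<Lambda> (Suc k) (d i) - \<Lambda> k (d i)) \<le> (1/2) ^ k" if "k \<ge> i" for k i
    using m(2)[of k "m k"] monoD[OF m(1), of k "Suc k"] that by (auto simp: P_def \<Lambda>_def)
  have small_e: "gns_seminorm \<phi> (\<Lambda> k (e i) - e i) \<le> (1/2) ^ k" if "k \<ge> i" for k i
    using m(2)[of k "m k"] that by (auto simp: P_def \<Lambda>_def)
  \<comment> \<open>Sums in \<open>ennreal\<close> always exist, so this is a measurable condition.
    The sum for index \<open>i\<close> starts at \<open>i\<close>, where the estimates for that
    element begin.\<close>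
  define good where "good \<alpha> \<longleftrightarrow>
      (\<forall>i. (\<Sum>k. ennreal (gns_seminorm \<alpha> (\<Lambda> (Suc (k + i)) (d i) - \<Lambda> (k + i) (d i)))) \<noteq> \<infinity>) \<and>
      (\<forall>i. (\<Sum>k. ennreal (gns_seminorm \<alpha> (\<Lambda> (k + i) (e i) - e i))) \<noteq> \<infinity>)" for \<alpha>
  note [measurable] = borel_measurable_gns_seminorm[OF \<mu>] borel_measurable_evaluation[OF \<mu>]
  have good_meas [measurable]: "Measurable.pred \<mu> good"
    unfolding good_def by measurable
  have good_AE: "AE \<alpha> in \<mu>. good \<alpha>"
    unfolding good_def AE_conj_iff AE_all_countable
    using AE_summable_gns_seminorm[OF \<mu> bary \<phi>, of _ "\<lambda>k. \<Lambda> (Suc k) (d _) - \<Lambda> k (d _)"]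
      AE_summable_gns_seminorm[OF \<mu> bary \<phi>, of _ "\<lambda>k. \<Lambda> k (e _) - e _"] small_d small_e by auto
  have cp: "cp_contraction (\<Lambda> k)" for k by (simp add: \<Lambda>_def \<Theta>)
  have cauchy: "(\<lambda>k. \<Lambda> k a) \<in> gns_cauchy \<alpha>" if "\<alpha> \<in> states" "good \<alpha>" for \<alpha> a
  proof (rule gns_cauchy_dense[OF that(1) cp d])
    fix i
    show "(\<lambda>k. \<Lambda> k (d i)) \<in> gns_cauchy \<alpha>"
      by (rule gns_cauchy_of_summable[OF that(1) summable_of_shifted_ennreal[where M = i]])
         (use that in \<open>auto simp: good_def gns_seminorm_nonneg\<close>)
  qed
  have null: "(\<lambda>k. gns_seminorm \<alpha> (\<Lambda> k s - s)) \<longlonglongrightarrow> 0" if "\<alpha> \<in> states" "good \<alpha>" "s \<in> S" for \<alpha> s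
  proof (rule gns_null_dense[OF that(1) cp e(2)[OF that(3)]])
    fix i
    show "(\<lambda>k. gns_seminorm \<alpha> (\<Lambda> k (e i) - e i)) \<longlonglongrightarrow> 0"
      by (rule summable_LIMSEQ_zero[OF summable_of_shifted_ennreal[where M = i]])
         (use that in \<open>auto simp: good_def gns_seminorm_nonneg\<close>)
  qed
  \<comment> \<open>Outside the good states any measurable choice of states will do, because the
    exceptional set is null; \<alpha> itself is one.\<close>
  define \<Psi> where "\<Psi> \<alpha> = (if good \<alpha> then (\<lambda>a. lim (\<lambda>k. \<alpha> (\<Lambda> k a))) else \<alpha>)" for \<alpha>
  have \<Psi>_states: "\<Psi> \<in> states \<rightarrow> states"
    using limit_state[OF S _ cp cauchy null] by (auto simp: \<Psi>_def)
  have meas: "(\<lambda>\<alpha>. \<Psi> \<alpha> a) \<in> borel_measurable \<mu>" for a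
  proof -
    have "(\<lambda>\<alpha>. \<Psi> \<alpha> a) = (\<lambda>\<alpha>. if good \<alpha> then lim (\<lambda>k. \<alpha> (\<Lambda> k a)) else \<alpha> a)" by (auto simp: \<Psi>_def)
    then show ?thesis by simp
  qed
  have "dilation_le S \<alpha> (\<Psi> \<alpha>)" if "\<alpha> \<in> states" "good \<alpha>" for \<alpha>
    using limit_dilation_map[OF S that(1) cp cauchy null] that by (auto simp: \<Psi>_def dilation_le_def)
  then have dil: "AE \<alpha> in completion \<mu>. dilation_le S \<alpha> (\<Psi> \<alpha>)"
    using good_AE AE_space by (intro AE_completion) (auto simp: space_borel_prob_on_states[OF \<mu>])
  have "\<psi> a = (\<integral>\<alpha>. \<Psi> \<alpha> a \<partial>completion \<mu>)" for a
  proof -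
    \<comment> \<open>The integrals on the left are constant in \<open>k\<close>: by the barycenter
      condition they equal \<open>\<phi> (\<Lambda> k a)\<close>, which is \<open>\<psi> a\<close>.
      Dominated convergence thus identifies the integral of the limits.\<close>
    have "(\<lambda>k. \<integral>\<alpha>. \<alpha> (\<Lambda> k a) \<partial>\<mu>) \<longlonglongrightarrow> (\<integral>\<alpha>. \<Psi> \<alpha> a \<partial>\<mu>)"
    proof (rule integral_dominated_convergence[where w = "\<lambda>_. norm a"])
      show "integrable \<mu> (\<lambda>_. norm a)"
        using emeasure_space_borel_prob_on_states[OF \<mu>]
        by (intro finite_measure.integrable_const finite_measureI) simp
      show "AE \<alpha> in \<mu>. (\<lambda>k. \<alpha> (\<Lambda> k a)) \<longlonglongrightarrow> \<Psi> \<alpha> a"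
        using good_AE AE_space
      proof eventually_elim
        case (elim \<alpha>)
        then have "\<alpha> \<in> states" by (simp add: space_borel_prob_on_states[OF \<mu>])
        from limit_tendsto[OF S this cp cauchy[OF this] null[OF this]] elim(1)
        show ?case by (simp add: \<Psi>_def)
      qed
      show "AE \<alpha> in \<mu>. norm (\<alpha> (\<Lambda> k a)) \<le> norm a" for k
      proof (rule AE_I2)
        fix \<alpha> assume "\<alpha> \<in> space \<mu>"
        then have \<alpha>: "\<alpha> \<in> states" by (simp add: space_borel_prob_on_states[OF \<mu>])
        show "norm (\<alpha> (\<Lambda> k a)) \<le> norm a"
          using cmod_state_le_gns_seminorm[OF \<alpha>] cp_contraction_le_norm[OF cp \<alpha>] order_trans by blast
      qed
    qed (use meas in auto)
    then have "\<psi> a = (\<integral>\<alpha>. \<Psi> \<alpha> a \<partial>\<mu>)"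
      by (simp add: integral_evaluation[OF \<mu> bary] \<Lambda>_def \<Theta>(2) LIMSEQ_const_iff)
    then show ?thesis by (simp add: integral_completion meas)
  qed
  then show "\<exists>\<Psi>\<in>states \<rightarrow> states.
      (\<forall>a. (\<lambda>\<alpha>. \<Psi> \<alpha> a) \<in> borel_measurable (completion \<mu>)) \<and>
      (AE \<alpha> in completion \<mu>. dilation_le S \<alpha> (\<Psi> \<alpha>)) \<and>
      (\<forall>a. \<psi> a = (\<integral>\<alpha>. \<Psi> \<alpha> a \<partial>completion \<mu>))"
    using \<Psi>_states meas dil by (intro bexI[of _ \<Psi>]) (auto intro: measurable_completion)
qed

end

text \<open>Agreement on \<open>S\<close> is all that the converse direction extracts from the
  dilations supplied by integral subdivision. Complete positivity is recovered from scalar states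
  through \<open>partition_map\<close>.\<close>

lemma (in commutative_cstar) dilation_le_eq_on:
  fixes \<alpha> :: "'a \<Rightarrow> complex"
  assumes \<alpha>: "\<alpha> \<in> states" and le: "dilation_le S \<alpha> \<beta>" and s: "s \<in> S"
  shows "\<beta> s = \<alpha> s"
proof -
  obtain \<Phi> where "\<Phi> s = gns_rep \<alpha> s" and "\<beta> s = hinner (gns_space \<alpha>) (\<Phi> s (gns_vec \<alpha>)) (gns_vec \<alpha>)"
    using le s by (auto simp: dilation_le_def dilation_map_def)
  then show ?thesis
    by (simp add: gns_vec_def gns_rep_eq_gns_mult gns_mult_class[OF \<alpha>] gns_multiplier_const[OF \<alpha>]
        gns_cauchy_const[OF \<alpha>] hinner_gns_const[OF \<alpha>])
qed

section \<open>Discrete measures on the state space\<close>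

text \<open>A singleton is an intersection of closed conditions, one for each element of the
  algebra; closedness makes the possibly uncountable index set harmless.\<close>

lemma singleton_state_measurable:
  assumes "borel_prob_on_states \<mu>" and "\<gamma> \<in> states"
  shows "{\<gamma>} \<in> sets \<mu>"
proof -
  have "{\<gamma>} = (\<Inter>a. (\<lambda>\<alpha>. \<alpha> a) -` {\<gamma> a})" by auto
  also have "closed \<dots>"
    by (intro closed_INT ballI closed_vimage continuous_on_product_coordinates) simp
  finally have "{\<gamma>} \<in> sets borel" by simp
  then have "{\<gamma>} \<in> sets (restrict_space borel states)"
    using assms(2) by (subst sets_restrict_space) (auto intro!: image_eqI[of _ _ "{\<gamma>}"])
  then show ?thesis using assms(1) by (simp add: borel_prob_on_states_def)
qed

text \<open>The push-forward of a weighted index set, so that the masses of coinciding states among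
  the \<open>g i\<close> simply accumulate.\<close>

definition discrete_measure ::
  "nat \<Rightarrow> (nat \<Rightarrow> real) \<Rightarrow> (nat \<Rightarrow> 'a::cstar_algebra \<Rightarrow> complex) \<Rightarrow> ('a \<Rightarrow> complex) measure" where
  "discrete_measure n w g = distr (point_measure {..<n} (\<lambda>i. ennreal (w i))) (restrict_space borel states) g"

context
  fixes n :: nat and w :: "nat \<Rightarrow> real" and g :: "nat \<Rightarrow> 'a::cstar_algebra \<Rightarrow> complex"
  assumes w: "\<And>i. w i \<ge> 0" "(\<Sum>i<n. w i) = 1" and g: "\<And>i. g i \<in> states"
begin

lemma discrete_measure_measurable:
  "g \<in> point_measure {..<n} (\<lambda>i. ennreal (w i)) \<rightarrow>\<^sub>M restrict_space borel states"
  using g by (simp add: space_restrict_space)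

lemma borel_prob_discrete_measure: "borel_prob_on_states (discrete_measure n w g)"
proof -
  have "emeasure (discrete_measure n w g) (space (discrete_measure n w g)) =
      emeasure (point_measure {..<n} (\<lambda>i. ennreal (w i))) {..<n}"
    unfolding discrete_measure_def
    using g sets.top[of "restrict_space borel states"] by (subst emeasure_distr[OF discrete_measure_measurable])
      (auto simp: space_point_measure space_restrict_space intro!: arg_cong2[where f = emeasure])
  also have "\<dots> = 1"
    using w by (simp add: emeasure_point_measure_finite sum_ennreal)
  finally show ?thesis by (simp add: borel_prob_on_states_def discrete_measure_def)
qed

lemma integral_discrete_measure:
  fixes f :: "('a \<Rightarrow> complex) \<Rightarrow> complex"
  assumes "f \<in> borel_measurable (discrete_measure n w g)"
  shows "(\<integral>\<alpha>. f \<alpha> \<partial>discrete_measure n w g) = (\<Sum>i<n. w i * f (g i))"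
  using assms w unfolding discrete_measure_def
  by (simp add: integral_distr[OF discrete_measure_measurable] lebesgue_integral_point_measure_finite scaleR_conv_of_real)

lemma AE_discrete_measure:
  assumes "AE \<alpha> in discrete_measure n w g. Q \<alpha>" and "i < n" "w i > 0"
  shows "Q (g i)"
  using AE_distrD[OF discrete_measure_measurable assms(1)[unfolded discrete_measure_def]] assms(2,3)
  by (simp add: AE_point_measure)

text \<open>Since \<open>f\<close> is measurable for the completion only, it is first replaced by a
  combination \<open>h\<close> of indicators of the atoms, which is measurable for the measure
  itself and agrees with \<open>f\<close> off a null set.\<close>

lemma integral_completion_discrete_measure:
  fixes f :: "('a \<Rightarrow> complex) \<Rightarrow> complex"
  assumes f: "f \<in> borel_measurable (completion (discrete_measure n w g))"
  shows "(\<integral>\<alpha>. f \<alpha> \<partial>completion (discrete_measure n w g)) = (\<Sum>i<n. w i * f (g i))"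
proof -
  let ?\<mu> = "discrete_measure n w g"
  define h where "h \<alpha> = (\<Sum>\<gamma>\<in>g ` {..<n}. indicator {\<gamma>} \<alpha> *\<^sub>R f \<gamma>)" for \<alpha>
  have sing: "{\<gamma>} \<in> sets ?\<mu>" if "\<gamma> \<in> g ` {..<n}" for \<gamma>
    using that g by (intro singleton_state_measurable[OF borel_prob_discrete_measure]) auto
  have h: "h \<in> borel_measurable ?\<mu>"
    unfolding h_def[abs_def] by (intro borel_measurable_sum borel_measurable_scaleR borel_measurable_indicator sing) auto
  have hg: "h \<alpha> = f \<alpha>" if "\<alpha> \<in> g ` {..<n}" for \<alpha>
  proof -
    have "h \<alpha> = (\<Sum>\<gamma>\<in>g ` {..<n}. if \<alpha> = \<gamma> then f \<gamma> else 0)"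
      unfolding h_def by (intro sum.cong) auto
    then show ?thesis using that by (simp add: sum.delta')
  qed
  have "g ` {..<n} = (\<Union>\<gamma>\<in>g ` {..<n}. {\<gamma>})" by auto
  also have "\<dots> \<in> sets ?\<mu>" using sing by (intro sets.finite_UN) auto
  finally have G: "g ` {..<n} \<in> sets ?\<mu>" .
  have "AE \<alpha> in ?\<mu>. \<alpha> \<in> g ` {..<n}"
    unfolding discrete_measure_def
  proof (subst AE_distr_iff[OF discrete_measure_measurable])
    show "{x \<in> space (restrict_space borel states). x \<in> g ` {..<n}} \<in> sets (restrict_space borel states)"
      using G sets.Int_space_eq1[OF G] by (simp add: discrete_measure_def Int_def)
  qed (simp add: AE_point_measure)
  then have "AE \<alpha> in completion ?\<mu>. f \<alpha> = h \<alpha>"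
    by (intro AE_completion) (auto simp: hg elim: eventually_mono)
  then have "(\<integral>\<alpha>. f \<alpha> \<partial>completion ?\<mu>) = (\<integral>\<alpha>. h \<alpha> \<partial>completion ?\<mu>)"
    by (intro integral_cong_AE f measurable_completion h)
  also have "\<dots> = (\<integral>\<alpha>. h \<alpha> \<partial>?\<mu>)" by (rule integral_completion[OF h])
  also have "\<dots> = (\<Sum>i<n. w i * h (g i))" by (rule integral_discrete_measure[OF h])
  also have "\<dots> = (\<Sum>i<n. w i * f (g i))" by (intro sum.cong refl) (simp add: hg)
  finally show ?thesis .
qed

end

section \<open>From integral subdivision to strong dilation\<close>

context commutative_cstar
begin

lemma local_mean_state:
  fixes \<phi> :: "'a \<Rightarrow> complex"
  assumes \<phi>: "\<phi> \<in> states" and "\<phi> (star b * b) \<noteq> 0"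
  shows "local_mean \<phi> b \<in> states"
  unfolding states_def
proof (clarify, intro conjI allI)
  fix x y :: 'a and c :: complex
  show "local_mean \<phi> b (x + y) = local_mean \<phi> b x + local_mean \<phi> b y"
    by (rule local_mean_add[OF \<phi>])
  show "local_mean \<phi> b (scaleC c x) = c * local_mean \<phi> b x"
    by (rule local_mean_scaleC[OF \<phi>])
  have "star b * b * (star x * x) = star (b * x) * (b * x)"
    by (simp add: star_mult mult_ac)
  then show "local_mean \<phi> b (star x * x) \<in> \<real>\<^sub>\<ge>\<^sub>0"
    unfolding local_mean_def by (metis nonneg_Reals_divide_I state_pos[OF \<phi>])
  show "local_mean \<phi> b 1 = 1" using assms(2) by (simp add: local_mean_def)
qed

text \<open>The integral subdivision relation is applied to the discrete measure that a partition of unity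
  puts on its local means.\<close>

lemma isd_partition:
  fixes S :: "'a set"
  assumes \<phi>: "\<phi> \<in> states" and isd: "isd_le S \<phi> \<psi>" and b: "partition_of_unity n b"
  obtains c where "\<And>i. i < n \<Longrightarrow> c i \<in> states \<or> c i = (\<lambda>_. 0)"
    and "\<And>i s. i < n \<Longrightarrow> s \<in> S \<Longrightarrow> c i s = local_mean \<phi> (b i) s"
    and "\<And>a. \<psi> a = (\<Sum>i<n. c i a * \<phi> (star (b i) * b i))"
proof -
  define w where "w i = (gns_seminorm \<phi> (b i))\<^sup>2" for i
  have w: "\<phi> (star (b i) * b i) = of_real (w i)" for i
    by (simp add: w_def state_star_mult_self[OF \<phi>])
  \<comment> \<open>A piece of weight 0 still needs some state attached; \<phi> is at hand.\<close>
  define g where "g i = (if w i > 0 then local_mean \<phi> (b i) else \<phi>)" for i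
  have w0: "w i \<ge> 0" for i by (simp add: w_def)
  have w1: "(\<Sum>i<n. w i) = 1"
    using gns_seminorm_partition[OF \<phi> b, of 1] by (simp add: w_def \<phi>)
  have g: "g i \<in> states" for i
    using local_mean_state[OF \<phi>, of "b i"] \<phi> by (simp add: g_def w)
  let ?\<mu> = "discrete_measure n w g"
  have prob: "borel_prob_on_states ?\<mu>" by (rule borel_prob_discrete_measure[OF w0 w1 g])
  have wg: "of_real (w i) * g i a = \<phi> (star (b i) * b i * a)" for i a
  proof (cases "w i > 0")
    case True
    then show ?thesis using local_mean_mult[OF \<phi>, of "b i" a] by (simp add: g_def w mult.commute)
  next
    case False
    then have "w i = 0" using w0[of i] by simp
    then show ?thesis using null_piece[OF \<phi>, of "b i" a] by (simp add: w)
  qed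
  have "barycenter ?\<mu> = \<phi>"
  proof
    fix a
    have "barycenter ?\<mu> a = (\<Sum>i<n. of_real (w i) * g i a)"
      unfolding barycenter_def
      by (rule integral_discrete_measure[OF w0 w1 g borel_measurable_evaluation[OF prob]])
    also have "\<dots> = \<phi> ((\<Sum>i<n. star (b i) * b i) * a)"
      by (simp add: wg sum_distrib_right state_sum[OF \<phi>])
    also have "\<dots> = \<phi> a" using b by (simp add: partition_of_unity_def)
    finally show "barycenter ?\<mu> a = \<phi> a" .
  qed
  with isd prob obtain \<Psi> where \<Psi>: "\<Psi> \<in> states \<rightarrow> states"
    and meas: "\<And>a. (\<lambda>\<alpha>. \<Psi> \<alpha> a) \<in> borel_measurable (completion ?\<mu>)"
    and dil: "AE \<alpha> in completion ?\<mu>. dilation_le S \<alpha> (\<Psi> \<alpha>)"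
    and int: "\<And>a. \<psi> a = (\<integral>\<alpha>. \<Psi> \<alpha> a \<partial>completion ?\<mu>)"
    unfolding isd_le_def by blast
  \<comment> \<open>The value 0 on null pieces matches \<open>local_mean\<close>, which is 0 there
    by the convention on division.\<close>
  define c where "c i = (if w i > 0 then \<Psi> (g i) else (\<lambda>_. 0))" for i
  show thesis
  proof (rule that)
    show "c i \<in> states \<or> c i = (\<lambda>_. 0)" for i
      using \<Psi> g by (auto simp: c_def)
    show "c i s = local_mean \<phi> (b i) s" if "i < n" "s \<in> S" for i s
    proof (cases "w i > 0")
      case True
      have "dilation_le S (g i) (\<Psi> (g i))"
        using AE_discrete_measure[OF w0 w1 g dil[unfolded AE_completion_iff] that(1) True] .
      then show ?thesis
        using dilation_le_eq_on[OF g \<open>dilation_le S (g i) (\<Psi> (g i))\<close> that(2)] True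
        by (simp add: c_def g_def)
    next
      case False
      then have "w i = 0" using w0[of i] by simp
      then show ?thesis by (simp add: c_def local_mean_def w)
    qed
    fix a
    have "\<psi> a = (\<Sum>i<n. w i * \<Psi> (g i) a)"
      unfolding int by (rule integral_completion_discrete_measure[OF w0 w1 g meas])
    also have "\<dots> = (\<Sum>i<n. c i a * \<phi> (star (b i) * b i))"
    proof (rule sum.cong[OF refl])
      fix i
      show "w i * \<Psi> (g i) a = c i a * \<phi> (star (b i) * b i)"
        using w0[of i] by (cases "w i > 0") (auto simp: c_def w mult.commute)
    qed
    finally show "\<psi> a = (\<Sum>i<n. c i a * \<phi> (star (b i) * b i))" .
  qed
qed

text \<open>Minimising a weighted sum of squared seminorms over decreasing convex sets turns approximate
  solutions into a Cauchy sequence, by the parallelogram law.\<close>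

lemma minimizing_sequence_cauchy:
  fixes C :: "nat \<Rightarrow> ('a \<Rightarrow> 'a) set" and d :: "nat \<Rightarrow> 'a"
  assumes \<phi>: "\<phi> \<in> states"
    and cp: "\<And>n \<Theta>. \<Theta> \<in> C n \<Longrightarrow> cp_contraction \<Theta>"
    and ne: "\<And>n. C n \<noteq> {}" and dec: "\<And>n. C (Suc n) \<subseteq> C n"
    and mid: "\<And>n \<Theta> \<Theta>'. \<Theta> \<in> C n \<Longrightarrow> \<Theta>' \<in> C n \<Longrightarrow> (\<lambda>a. scaleR (1/2) (\<Theta> a + \<Theta>' a)) \<in> C n"
  obtains \<Theta> where "\<And>n. \<Theta> n \<in> C n" "\<And>i. (\<lambda>n. \<Theta> n (d i)) \<in> gns_cauchy \<phi>"
proof -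
  \<comment> \<open>Chosen so that the i-th term of \<open>G\<close> is at most
    \<open>(1/2) ^ i\<close> for every contraction; the summand 1 covers
    \<open>d i = 0\<close>.\<close>
  define w where "w i = (1/2) ^ i / (1 + (norm (d i))\<^sup>2)" for i
  have den: "1 + (norm (d i))\<^sup>2 > 0" for i by (simp add: add_pos_nonneg)
  have w: "w i > 0" for i using den by (simp add: w_def)
  \<comment> \<open>Truncation at \<open>n\<close> keeps the sum finite. The growth of
    \<open>G n\<close> and the shrinking of \<open>C n\<close> both raise the infimum
    \<open>D n\<close>, so \<open>D\<close> increases to a limit.\<close>
  define G where "G n \<Theta> = (\<Sum>i<n. w i * (gns_seminorm \<phi> (\<Theta> (d i)))\<^sup>2)" for n and \<Theta> :: "'a \<Rightarrow> 'a"
  have G0: "G n \<Theta> \<ge> 0" for n \<Theta>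
    unfolding G_def using w by (intro sum_nonneg mult_nonneg_nonneg) (simp_all add: less_imp_le)
  have G_mono: "G m \<Theta> \<le> G n \<Theta>" if "m \<le> n" for m n \<Theta>
    unfolding G_def using that w by (intro sum_mono2) (auto intro!: mult_nonneg_nonneg simp: less_imp_le)
  have G2: "G n \<Theta> \<le> 2" if "\<Theta> \<in> C k" for n k \<Theta>
  proof -
    have "G n \<Theta> \<le> (\<Sum>i<n. (1/2) ^ i)"
      unfolding G_def
    proof (rule sum_mono)
      fix i
      have "(gns_seminorm \<phi> (\<Theta> (d i)))\<^sup>2 \<le> (norm (d i))\<^sup>2"
        by (intro power_mono cp_contraction_le_norm cp[OF that] \<phi> gns_seminorm_nonneg[OF \<phi>])
      then have "(gns_seminorm \<phi> (\<Theta> (d i)))\<^sup>2 \<le> 1 + (norm (d i))\<^sup>2" by simp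
      then have "w i * (gns_seminorm \<phi> (\<Theta> (d i)))\<^sup>2 \<le> w i * (1 + (norm (d i))\<^sup>2)"
        using w[of i] by (intro mult_left_mono) auto
      also have "\<dots> = (1/2) ^ i" using den[of i] by (simp add: w_def)
      finally show "w i * (gns_seminorm \<phi> (\<Theta> (d i)))\<^sup>2 \<le> (1/2) ^ i" .
    qed
    also have "\<dots> = 2 - 2 * (1/2) ^ n" by (induction n) auto
    also have "\<dots> \<le> 2" by simp
    finally show ?thesis .
  qed
  define D where "D n = Inf (G n ` C n)" for n
  have bdd: "bdd_below (G n ` C m)" for m n using G0 by (intro bdd_belowI[of _ 0]) auto
  have D_le: "D n \<le> G n \<Theta>" if "\<Theta> \<in> C n" for n \<Theta>
    unfolding D_def using that by (intro cInf_lower bdd) auto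
  have "incseq D"
  proof (rule incseq_SucI)
    fix n
    show "D n \<le> D (Suc n)"
      unfolding D_def[of "Suc n"]
    proof (rule cInf_greatest)
      fix r assume "r \<in> G (Suc n) ` C (Suc n)"
      then obtain \<Theta> where \<Theta>: "\<Theta> \<in> C (Suc n)" "r = G (Suc n) \<Theta>" by auto
      have "D n \<le> G n \<Theta>" using D_le \<Theta>(1) dec by blast
      also have "\<dots> \<le> r" unfolding \<Theta>(2) by (rule G_mono) simp
      finally show "D n \<le> r" .
    qed (use ne in auto)
  qed
  moreover have "D n \<le> 2" for n
    using ne[of n] D_le G2 order_trans by blast
  ultimately have "convergent D"
    using incseq_convergent[of D 2] by (metis convergentI)
  then have D_cauchy: "Cauchy D" by (rule convergent_Cauchy)
  have "\<exists>\<Theta>\<in>C n. G n \<Theta> < D n + 1 / Suc n" for n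
    using cInf_lessD[of "G n ` C n" "D n + 1 / Suc n"] ne[of n] by (auto simp: D_def)
  then obtain \<Theta> where \<Theta>: "\<And>n. \<Theta> n \<in> C n" "\<And>n. G n (\<Theta> n) < D n + 1 / Suc n" by metis
  have C_mono: "C n \<subseteq> C m" if "m \<le> n" for m n
    using that by (induction n rule: dec_induct) (use dec in auto)
  \<comment> \<open>The midpoint of two near-minimisers lies in \<open>C m\<close> and cannot fall
    below \<open>D m\<close>, so the parallelogram law keeps them close. Each of their excesses is
    at most \<open>1 / Suc m\<close> and enters with a factor 2, hence
    \<open>4 / Suc m\<close>.\<close>
  have bound: "w i * (gns_seminorm \<phi> (\<Theta> n (d i) - \<Theta> m (d i)))\<^sup>2 \<le> 2 * D n - 2 * D m + 4 / Suc m"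
    if "i < m" "m \<le> n" for i m n
  proof -
    define x where "x = (\<lambda>i. gns_seminorm \<phi> (\<Theta> n (d i) - \<Theta> m (d i)))"
    have par: "(gns_seminorm \<phi> (scaleR (1/2) (u + v)))\<^sup>2 =
        ((gns_seminorm \<phi> u)\<^sup>2 + (gns_seminorm \<phi> v)\<^sup>2) / 2 - (gns_seminorm \<phi> (u - v))\<^sup>2 / 4" for u v
    proof -
      have half: "(gns_seminorm \<phi> (scaleR (1/2) (u + v)))\<^sup>2 = (gns_seminorm \<phi> (u + v))\<^sup>2 / 4"
        by (simp add: scaleR_scaleC gns_seminorm_scaleC[OF \<phi>] power_divide)
      have minus: "(gns_seminorm \<phi> (u - v))\<^sup>2 =
          (gns_seminorm \<phi> u)\<^sup>2 - 2 * Re (\<phi> (star u * v)) + (gns_seminorm \<phi> v)\<^sup>2"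
        using gns_seminorm_add_square[OF \<phi>, of u "- v"]
        by (simp add: gns_seminorm_minus[OF \<phi>] state_minus[OF \<phi>])
      show ?thesis
        unfolding half minus gns_seminorm_add_square[OF \<phi>, of u v] by (simp add: field_simps)
    qed
    let ?mid = "\<lambda>a. scaleR (1/2) (\<Theta> n a + \<Theta> m a)"
    have "\<Theta> n \<in> C m" using \<Theta>(1) C_mono[OF that(2)] by blast
    then have "D m \<le> G m ?mid" by (intro D_le mid \<Theta>(1))
    also have "G m ?mid = (G m (\<Theta> n) + G m (\<Theta> m)) / 2 - (\<Sum>i<m. w i * (x i)\<^sup>2) / 4"
      by (simp only: G_def par x_def)
         (simp add: sum_subtractf sum.distrib sum_divide_distrib right_diff_distrib distrib_left add_divide_distrib)
    finally have "(\<Sum>i<m. w i * (x i)\<^sup>2) \<le> 2 * (G m (\<Theta> n) + G m (\<Theta> m)) - 4 * D m" by linarith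
    moreover have "G m (\<Theta> n) \<le> D n + 1 / Suc m"
    proof -
      have "1 / real (Suc n) \<le> 1 / Suc m" using that(2) by (intro divide_left_mono) auto
      then show ?thesis using G_mono[OF that(2), of "\<Theta> n"] \<Theta>(2)[of n] by linarith
    qed
    moreover have "G m (\<Theta> m) \<le> D m + 1 / Suc m" using \<Theta>(2)[of m] by simp
    moreover have "w i * (x i)\<^sup>2 \<le> (\<Sum>i<m. w i * (x i)\<^sup>2)"
      using that(1) w by (intro member_le_sum) (auto intro!: mult_nonneg_nonneg simp: less_imp_le)
    ultimately have "w i * (x i)\<^sup>2 \<le> 2 * D n - 2 * D m + 4 * (1 / Suc m)"
      by (simp add: algebra_simps)
    then show ?thesis by (simp add: x_def)
  qed
  have "(\<lambda>n. \<Theta> n (d i)) \<in> gns_cauchy \<phi>" for i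
    unfolding gns_cauchy_def
  proof clarify
    fix e :: real assume "e > 0"
    define \<delta> where "\<delta> = w i * e\<^sup>2"
    have "\<delta> > 0" using w[of i] \<open>e > 0\<close> by (simp add: \<delta>_def)
    \<comment> \<open>The budget \<open>\<delta>\<close> is spent as twice
      \<open>\<delta> / 4\<close> here and four times \<open>\<delta> / 8\<close> below.\<close>
    obtain M where M: "\<And>m n. m \<ge> M \<Longrightarrow> n \<ge> M \<Longrightarrow> norm (D m - D n) < \<delta> / 4"
      using CauchyD[OF D_cauchy, of "\<delta> / 4"] \<open>\<delta> > 0\<close> by auto
    obtain K :: nat where K: "1 / Suc K < \<delta> / 8"
      using nat_approx_posE[of "\<delta> / 8"] \<open>\<delta> > 0\<close> by auto
    define N where "N = max (max M K) (Suc i)"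
    have less: "gns_seminorm \<phi> (\<Theta> n (d i) - \<Theta> m (d i)) < e" if "m \<ge> N" "n \<ge> m" for m n
    proof -
      have "1 / real (Suc m) \<le> 1 / Suc K" using that by (intro divide_left_mono) (auto simp: N_def)
      then have "4 / real (Suc m) < \<delta> / 2" using K by simp
      moreover have "D n - D m < \<delta> / 4"
      proof (rule le_less_trans[OF abs_ge_self])
        show "\<bar>D n - D m\<bar> < \<delta> / 4"
          using M[of n m] that by (simp add: N_def)
      qed
      moreover have "w i * (gns_seminorm \<phi> (\<Theta> n (d i) - \<Theta> m (d i)))\<^sup>2 \<le> 2 * D n - 2 * D m + 4 / Suc m"
        using that by (intro bound) (auto simp: N_def)
      ultimately have "w i * (gns_seminorm \<phi> (\<Theta> n (d i) - \<Theta> m (d i)))\<^sup>2 < w i * e\<^sup>2"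
        unfolding \<delta>_def[symmetric] by linarith
      then have "(gns_seminorm \<phi> (\<Theta> n (d i) - \<Theta> m (d i)))\<^sup>2 < e\<^sup>2" using w[of i] by simp
      then show ?thesis by (rule power2_less_imp_less) (use \<open>e > 0\<close> in simp)
    qed
    have "gns_seminorm \<phi> (\<Theta> m (d i) - \<Theta> n (d i)) < e" if "m \<ge> N" "n \<ge> N" for m n
      using less[of m n] less[of n m] that gns_seminorm_minus_commute[OF \<phi>, of "\<Theta> m (d i)"]
      by (cases "m \<le> n") auto
    then show "\<exists>N. \<forall>m\<ge>N. \<forall>n\<ge>N. gns_seminorm \<phi> (\<Theta> m (d i) - \<Theta> n (d i)) < e" by blast
  qed
  with \<Theta>(1) show thesis by (rule that)
qed

lemma isd_imp_strong_dilation: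
  fixes S :: "'a set" and d e :: "nat \<Rightarrow> 'a"
  assumes S: "operator_system S" and \<phi>: "\<phi> \<in> states" and isd: "isd_le S \<phi> \<psi>"
    and d: "\<And>y \<epsilon>. \<epsilon> > 0 \<Longrightarrow> \<exists>i. norm (y - d i) < \<epsilon>"
    and e: "\<And>i. e i \<in> S" "\<And>s \<epsilon>. s \<in> S \<Longrightarrow> \<epsilon> > 0 \<Longrightarrow> \<exists>i. norm (s - e i) < \<epsilon>"
  shows "strong_dilation_le S \<phi> \<psi>"
proof -
  obtain n b where part: "\<And>j. partition_of_unity (n j) (b j)"
    and fine: "\<And>\<phi> y :: 'a. \<phi> \<in> states \<Longrightarrow> (\<lambda>j. total_variance \<phi> (n j) (b j) y) \<longlonglongrightarrow> 0"
    using fine_partition_sequence[OF d] by blast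
  \<comment> \<open>All conditions are convex. Fixing \<open>S\<close> is demanded only up to a
    tolerance and for finitely many \<open>e i\<close>, so that a single fine partition supplies a
    member of each set, while the sets decrease and in the end account for every
    \<open>e i\<close>.\<close>
  define C where "C k = {\<Theta>. cp_contraction \<Theta> \<and> (\<forall>a. \<phi> (\<Theta> a) = \<psi> a) \<and>
      (\<forall>i<k. gns_seminorm \<phi> (\<Theta> (e i) - e i) \<le> 1 / Suc k)}" for k
  have ne: "C k \<noteq> {}" for k
  proof -
    have "\<forall>\<^sub>F j in sequentially. sqrt (total_variance \<phi> (n j) (b j) (e i)) < 1 / Suc k" for i
      using tendsto_real_sqrt[OF fine[OF \<phi>, of "e i"]] by (intro order_tendstoD(2)) auto
    then have "\<forall>\<^sub>F j in sequentially. \<forall>i\<in>{..<k}. sqrt (total_variance \<phi> (n j) (b j) (e i)) < 1 / Suc k"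
      by (intro eventually_ball_finite) auto
    then obtain j where j: "\<And>i. i < k \<Longrightarrow> sqrt (total_variance \<phi> (n j) (b j) (e i)) < 1 / Suc k"
      by (auto simp: eventually_sequentially)
    obtain c where c: "\<And>i. i < n j \<Longrightarrow> c i \<in> states \<or> c i = (\<lambda>_. 0)"
      "\<And>i s. i < n j \<Longrightarrow> s \<in> S \<Longrightarrow> c i s = local_mean \<phi> (b j i) s"
      "\<And>a. \<psi> a = (\<Sum>i<n j. c i a * \<phi> (star (b j i) * b j i))"
      using isd_partition[OF \<phi> isd part[of j]] by blast
    let ?\<Theta> = "partition_map (n j) (b j) c"
    have "gns_seminorm \<phi> (?\<Theta> (e i) - e i) \<le> 1 / Suc k" if "i < k" for i
    proof -
      have "?\<Theta> (e i) = partition_map (n j) (b j) (\<lambda>i. local_mean \<phi> (b j i)) (e i)"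
        unfolding partition_map_def using c(2) e(1) by simp
      then have "gns_seminorm \<phi> (?\<Theta> (e i) - e i) \<le> sqrt (total_variance \<phi> (n j) (b j) (e i))"
        by (simp add: real_le_rsqrt partition_map_local_mean[OF \<phi> part])
      with j[OF that] show ?thesis by linarith
    qed
    moreover have "cp_contraction ?\<Theta>" by (rule cp_contraction_partition_map[OF part c(1)])
    moreover have "\<phi> (?\<Theta> a) = \<psi> a" for a by (simp add: state_partition_map[OF \<phi>] c(3))
    ultimately have "?\<Theta> \<in> C k" by (simp add: C_def)
    then show ?thesis by blast
  qed
  have dec: "C (Suc k) \<subseteq> C k" for k
  proof
    fix \<Theta> assume \<Theta>: "\<Theta> \<in> C (Suc k)"
    have "1 / real (Suc (Suc k)) \<le> 1 / Suc k" by (intro divide_left_mono) auto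
    moreover have "gns_seminorm \<phi> (\<Theta> (e i) - e i) \<le> 1 / Suc (Suc k)" if "i < k" for i
      using \<Theta> that by (simp add: C_def)
    ultimately have "gns_seminorm \<phi> (\<Theta> (e i) - e i) \<le> 1 / Suc k" if "i < k" for i
      using that by (meson order_trans)
    then show "\<Theta> \<in> C k" using \<Theta> by (simp add: C_def)
  qed
  have mid: "(\<lambda>a. scaleR (1/2) (\<Theta> a + \<Theta>' a)) \<in> C k" if "\<Theta> \<in> C k" "\<Theta>' \<in> C k" for k \<Theta> \<Theta>'
  proof -
    have "gns_seminorm \<phi> (scaleR (1/2) (\<Theta> (e i) + \<Theta>' (e i)) - e i) \<le> 1 / Suc k" if i: "i < k" for i
    proof -
      have "e i = scaleR (1/2) (e i + e i)" by (simp flip: scaleR_2)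
      then have "scaleR (1/2) (\<Theta> (e i) + \<Theta>' (e i)) - e i =
          scaleR (1/2) ((\<Theta> (e i) + \<Theta>' (e i)) - (e i + e i))"
        by (metis scaleR_diff_right)
      also have "(\<Theta> (e i) + \<Theta>' (e i)) - (e i + e i) = (\<Theta> (e i) - e i) + (\<Theta>' (e i) - e i)" by simp
      finally have "gns_seminorm \<phi> (scaleR (1/2) (\<Theta> (e i) + \<Theta>' (e i)) - e i) =
          1 / 2 * gns_seminorm \<phi> ((\<Theta> (e i) - e i) + (\<Theta>' (e i) - e i))"
        by (simp add: scaleR_scaleC gns_seminorm_scaleC[OF \<phi>])
      also have "\<dots> \<le> 1 / 2 * (gns_seminorm \<phi> (\<Theta> (e i) - e i) + gns_seminorm \<phi> (\<Theta>' (e i) - e i))"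
        by (intro mult_left_mono gns_seminorm_triangle[OF \<phi>]) simp
      also have "\<dots> \<le> 1 / 2 * (1 / Suc k + 1 / Suc k)"
        using \<open>\<Theta> \<in> C k\<close> \<open>\<Theta>' \<in> C k\<close> i by (intro mult_left_mono add_mono) (auto simp: C_def)
      finally show ?thesis by simp
    qed
    moreover have "cp_contraction (\<lambda>a. scaleR (1/2) (\<Theta> a + \<Theta>' a))"
      using that by (intro cp_contraction_midpoint) (auto simp: C_def)
    moreover have "\<phi> (scaleR (1/2) (\<Theta> a + \<Theta>' a)) = \<psi> a" for a
      using that by (simp add: C_def scaleR_scaleC state_scaleC[OF \<phi>] state_add[OF \<phi>])
    ultimately show ?thesis by (simp add: C_def)
  qed
  have cpC: "cp_contraction \<Theta>" if "\<Theta> \<in> C k" for k \<Theta>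
    using that by (simp add: C_def)
  have "\<exists>\<Theta>. (\<forall>k. \<Theta> k \<in> C k) \<and> (\<forall>i. (\<lambda>k. \<Theta> k (d i)) \<in> gns_cauchy \<phi>)"
    by (rule minimizing_sequence_cauchy[of \<phi> C d]) (rule \<phi> ne dec | erule cpC | erule (1) mid | blast)+
  then obtain \<Theta> where \<Theta>: "\<And>k. \<Theta> k \<in> C k" "\<And>i. (\<lambda>k. \<Theta> k (d i)) \<in> gns_cauchy \<phi>"
    by blast
  have cp: "cp_contraction (\<Theta> k)" and val: "\<phi> (\<Theta> k a) = \<psi> a" for k a
    using \<Theta>(1)[of k] by (auto simp: C_def)
  have cauchy: "(\<lambda>k. \<Theta> k a) \<in> gns_cauchy \<phi>" for a
    by (rule gns_cauchy_dense[OF \<phi> cp d \<Theta>(2)])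
  have null: "(\<lambda>k. gns_seminorm \<phi> (\<Theta> k s - s)) \<longlonglongrightarrow> 0" if "s \<in> S" for s
  proof (rule gns_null_dense[OF \<phi> cp e(2)[OF that]])
    fix i
    show "(\<lambda>k. gns_seminorm \<phi> (\<Theta> k (e i) - e i)) \<longlonglongrightarrow> 0"
    proof (rule tendsto_sandwich[OF _ _ tendsto_const])
      have "gns_seminorm \<phi> (\<Theta> k (e i) - e i) \<le> 1 / Suc k" if "i < k" for k
        using \<Theta>(1)[of k] that by (simp add: C_def)
      then show "\<forall>\<^sub>F k in sequentially. gns_seminorm \<phi> (\<Theta> k (e i) - e i) \<le> 1 / Suc k"
        using eventually_gt_at_top[of i] by (rule eventually_mono[rotated])
      show "(\<lambda>k. 1 / real (Suc k)) \<longlonglongrightarrow> 0" using lim_1_over_n LIMSEQ_Suc by blast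
    qed (simp add: gns_seminorm_nonneg[OF \<phi>])
  qed
  show ?thesis
    using limit_strong_dilation[OF S \<phi> cp cauchy null] by (simp add: val)
qed

end

section \<open>Separability of the algebra and of the operator system\<close>

text \<open>The points \<open>d i\<close> need not lie in \<open>S\<close>. For each index
  \<open>i\<close> and accuracy \<open>1 / Suc m\<close>, encoded in one number, a point of
  \<open>S\<close> that close to \<open>d i\<close> is chosen if there is one.\<close>

lemma dense_sequence_in_subset:
  fixes S :: "'a::real_normed_vector set" and d :: "nat \<Rightarrow> 'a"
  assumes dense: "\<And>y e. e > 0 \<Longrightarrow> \<exists>i::nat. norm (y - d i) < e" and "s0 \<in> S"
  obtains f :: "nat \<Rightarrow> 'a" where "\<And>i. f i \<in> S" "\<And>s e. s \<in> S \<Longrightarrow> e > 0 \<Longrightarrow> \<exists>i. norm (s - f i) < e"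
proof -
  have "\<forall>k. \<exists>s\<in>S. (\<exists>s\<in>S. norm (s - d (fst (prod_decode k))) < 1 / real (Suc (snd (prod_decode k)))) \<longrightarrow>
      norm (s - d (fst (prod_decode k))) < 1 / real (Suc (snd (prod_decode k)))"
    using assms(2) by blast
  then obtain f where f: "\<And>k. f k \<in> S"
    "\<And>k s. s \<in> S \<Longrightarrow> norm (s - d (fst (prod_decode k))) < 1 / real (Suc (snd (prod_decode k))) \<Longrightarrow>
      norm (f k - d (fst (prod_decode k))) < 1 / real (Suc (snd (prod_decode k)))"
    by metis
  have "\<exists>i. norm (s - f i) < e" if s: "s \<in> S" and e: "e > 0" for s e
  proof -
    obtain m :: nat where m: "1 / Suc m < e / 2" by (rule nat_approx_posE[of "e / 2"]) (use e in auto)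
    obtain i where i: "norm (s - d i) < 1 / Suc m" using dense[of "1 / Suc m" s] by auto
    define k where "k = prod_encode (i, m)"
    have "norm (f k - d i) < 1 / Suc m" using f(2)[OF s, of k] i by (simp add: k_def)
    then have "norm (s - f k) < e"
      using i m norm_triangle_ineq4[of "s - d i" "f k - d i"] by simp
    then show ?thesis ..
  qed
  with f(1) show thesis by (rule that)
qed

lemma separable_dense_sequence:
  assumes "separable_space (euclidean :: 'a::real_normed_vector topology)"
  obtains d :: "nat \<Rightarrow> 'a::real_normed_vector" where "\<And>y e. e > 0 \<Longrightarrow> \<exists>i. norm (y - d i) < e"
proof -
  obtain U :: "'a set" where U: "countable U" "closure U = UNIV"
    using assms by (auto simp: separable_space_def)
  then have "U \<noteq> {}" by auto
  then have range: "range (from_nat_into U) = U" using U(1) by (rule range_from_nat_into)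
  show thesis
  proof (rule that)
    fix y :: 'a and e :: real assume "e > 0"
    then obtain u where "u \<in> U" "dist u y < e" using U(2) closure_approachable[of y U] by auto
    then show "\<exists>i. norm (y - from_nat_into U i) < e"
      using range by (metis dist_commute dist_norm imageE)
  qed
qed

theorem corollary5p4:
  fixes S :: "'a::cstar_algebra set" and \<phi> \<psi> :: "'a \<Rightarrow> complex"
  assumes commutative: "\<forall>a b :: 'a. a * b = b * a"
    and separable: "separable_space (euclidean :: 'a topology)"
    and "operator_system S"
    and "generated_cstar S = (UNIV :: 'a set)"
    and "\<phi> \<in> states" and "\<psi> \<in> states"
  shows "(strong_dilation_le S \<phi> \<psi> \<longleftrightarrow> isd_le S \<phi> \<psi>) \<and>
         (maximal_state (strong_dilation_le S) \<phi> \<longleftrightarrow> maximal_state (isd_le S) \<phi>)"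
proof -
  interpret commutative_cstar "TYPE('a)"
    using commutative by unfold_locales blast
  obtain d :: "nat \<Rightarrow> 'a" where d: "\<And>y e. e > 0 \<Longrightarrow> \<exists>i. norm (y - d i) < e"
    using separable_dense_sequence[OF separable] by blast
  have "1 \<in> S" using assms(3) by (simp add: operator_system_def)
  from dense_sequence_in_subset[OF d this]
  obtain e :: "nat \<Rightarrow> 'a" where e: "\<And>i. e i \<in> S" "\<And>s \<epsilon>. s \<in> S \<Longrightarrow> \<epsilon> > 0 \<Longrightarrow> \<exists>i. norm (s - e i) < \<epsilon>"
    by blast
  \<comment> \<open>Proved for every second argument, so that the two notions of maximality, which
    quantify over it, coincide at once.\<close>
  have "strong_dilation_le S \<phi> \<psi>' \<longleftrightarrow> isd_le S \<phi> \<psi>'" for \<psi>'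
    using strong_dilation_imp_isd[OF assms(3,5) _ d e] isd_imp_strong_dilation[OF assms(3,5) _ d e] by blast
  then show ?thesis by (simp add: maximal_state_def)
qed

end
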